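(* Let $K$ be a field of characteristic zero, $R=K[x,y,z]$, and let $\alpha,\beta,\gamma,t$ be integers with $0<\alpha\le\beta\le\gamma\le2(\alpha+\beta)$, $t\ge\frac13(\alpha+\beta+\gamma)$, and $\alpha+\beta+\gamma$ divisible by three. Let $$I=(x^{\alpha+t},y^{\beta+t},z^{\gamma+t},x^\alpha y^\beta z^\gamma)\subset R.$$ Then: (i) $R/I$ fails to have the weak Lefschetz property when $t$ is even, $\alpha+\beta+\gamma$ is odd, and $\alpha=\beta$ or $\beta=\gamma$; (ii) $R/I$ has the weak Lefschetz property when (a) $t$ and $\alpha+\beta+\gamma$ have the same parity, or (b) $t$ is odd and $\alpha=\beta=\gamma$ is even.
   Context: $R$ is standard graded. An artinian standard graded $K$-algebra $Q$ has the weak Lefschetz property if there is a linear form $\ell\in[Q]_1$ such that for all integers $d$ the map $\times\ell:[Q]_d\to[Q]_{d+1}$ is injective or surjective. *)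

theory Defs
  imports Complex_Main "HOL-Library.Poly_Mapping" "HOL-Algebra.Algebraic_Closure_Type"
begin

datatype xyz = x_var | y_var | z_var

text \<open>
  Polynomials with indeterminates in \<open>'v\<close> and coefficients in \<open>'k\<close>: finitely supported
  functions from monomials (finitely supported exponent vectors) to coefficients, with the
  convolution product. Thus \<open>K[x,y,z]\<close> is the type \<open>(xyz, 'k) mpol\<close>.
\<close>
type_synonym ('v, 'k) mpol = "('v \<Rightarrow>\<^sub>0 nat) \<Rightarrow>\<^sub>0 'k"

definition indet :: "'v \<Rightarrow> ('v, 'k::field) mpol" where
  "indet v = Poly_Mapping.single (Poly_Mapping.single v 1) 1"

definition monom_degree :: "('v \<Rightarrow>\<^sub>0 nat) \<Rightarrow> nat" where
  "monom_degree m = (\<Sum>v\<in>Poly_Mapping.keys m. Poly_Mapping.lookup m v)"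

text \<open>Degrees range over all integers; the components of negative degree are zero.\<close>
definition homogeneous_component :: "int \<Rightarrow> ('v, 'k::field) mpol set" where
  "homogeneous_component d =
     {f. \<forall>m\<in>Poly_Mapping.keys f. int (monom_degree m) = d}"

text \<open>
  The polynomial ring as a ring record, so that the ideals and quotient rings of HOL-Algebra
  apply.
\<close>
abbreviation mpol_ring :: "('v, 'k::field) mpol ring" where
  "mpol_ring \<equiv> ring_of_type_algebra"

text \<open>
  The grading that the quotient by a homogeneous ideal \<open>I\<close> inherits from the standard grading:
  \<open>[R/I]\<^sub>d\<close> is the image of \<open>[R]\<^sub>d\<close> under the projection.
\<close>
definition quotient_component ::
  "('v, 'k::field) mpol set \<Rightarrow> int \<Rightarrow> ('v, 'k) mpol set set" where
  "quotient_component I d = (\<lambda>f. I +>\<^bsub>mpol_ring\<^esub> f) ` homogeneous_component d"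

text \<open>
  \<open>A d\<close> is the degree \<open>d\<close> component of the graded algebra \<open>Q\<close>. The notion is meant for
  artinian standard graded algebras only; these conditions are not part of the predicate, so
  its negation says that an algebra fails the property, not that it is outside this class.
\<close>
definition weak_Lefschetz :: "('q, 'm) ring_scheme \<Rightarrow> (int \<Rightarrow> 'q set) \<Rightarrow> bool" where
  "weak_Lefschetz Q A \<longleftrightarrow>
     (\<exists>l\<in>A 1. \<forall>d. inj_on (\<lambda>q. l \<otimes>\<^bsub>Q\<^esub> q) (A d) \<or> (\<lambda>q. l \<otimes>\<^bsub>Q\<^esub> q) ` A d = A (d + 1))"

end

theory Submission
  imports Defs
begin

text \<open>
  Put \<open>m = (\<alpha> + \<beta> + \<gamma>) / 3\<close>. The algebra \<open>R/I\<close> has the same dimension in the degrees \<open>2m + t - 2\<close> and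
  \<open>2m + t - 1\<close>. Its socle lies in the single, larger degree \<open>\<alpha> + \<beta> + \<gamma> + 2t - 3\<close>, so injectivity of
  the multiplication by a linear form passes from a degree below the socle to all smaller ones, and
  surjectivity always passes to larger ones. Everything is thus decided by one square matrix. An
  element of the kernel of its transpose is a function \<open>g\<close> on the exponent vectors of degree
  \<open>2m + t - 1\<close> that is zero on the monomials of \<open>I\<close> and satisfies
  \<open>p g(a+1,b,c) + q g(a,b+1,c) + r g(a,b,c+1) = 0\<close>, where \<open>px + qy + rz\<close> is the linear form: an element
  of Macaulay's inverse system. The domain is a hexagon with a triangular puncture of side
  \<open>t - m\<close>, and the parity of this side governs the behaviour.

  Part (i). If no coefficient of the linear form vanishes, rescaling the variables makes them equal
  to 1. The map then commutes with the exchange of the two variables that have equal exponents.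
  Counting the monomials fixed by the exchange shows that the antisymmetric part is larger in
  degree \<open>2m + t - 1\<close> than in degree \<open>2m + t - 2\<close>, so a nonzero antisymmetric \<open>g\<close> exists. If some
  coefficient vanishes, an explicit \<open>g\<close> lives on a single row of the hexagon.

  Part (ii). The matrix for \<open>x + y + z\<close> has integer entries, so a nonzero \<open>g\<close> over \<open>K\<close> gives a nonzero
  real one. Up to signs, the row of \<open>g\<close> at height \<open>c\<close> consists of the coefficients of
  \<open>(1 + y)\<^sup>c Q\<close>, where \<open>Q\<close> comes from the bottom row, and multiplication by \<open>1 + y\<close> never increases
  the number of sign changes.

  (a) If \<open>t - m\<close> is even, the row at height \<open>\<gamma>\<close> is a multiple of \<open>(1 + y)\<^sup>\<gamma>\<close> with coefficients
  on two blocks of length \<open>m\<close>, separated by the \<open>t - m\<close> zeros of the puncture. The zero of order \<open>\<gamma>\<close> at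
  \<open>y = -1\<close> forces many sign changes of \<open>(-1)\<^sup>n w\<^sub>n\<close>; since the gap is even, this leaves fewer than
  \<open>2m - \<gamma>\<close> sign changes for \<open>w\<close> itself. But after \<open>t\<close> more rows \<open>2m - \<gamma>\<close> consecutive entries
  vanish; a small perturbation that makes these entries alternate, in either of the two
  possible ways, shows that \<open>w\<close> has at least \<open>2m - \<gamma>\<close> weak sign changes. Hence \<open>w = 0\<close>
  (\<open>two_blocks_gap_imp_zero\<close>).

  (b) If \<open>\<alpha> = \<beta> = \<gamma> = m\<close> and \<open>t - m\<close> is odd, three arms of \<open>m\<close> entries extend the sides of the puncture,
  and each determines the preceding one through the matrix \<open>B\<close> with entries
  \<open>(t - m + i + j) choose i\<close>. Going round once gives \<open>B\<^sup>3 v = v\<close>. As \<open>B\<close> is self-adjoint for a positive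
  weight, \<open>B v = v\<close>. A total positivity argument shows that a vector fixed by \<open>B\<close> is zero as soon as
  its first or its last entry is (\<open>arm_transfer_fixed_end_zero\<close>). The reflection of the hexagon
  induces an involution of the fixed vectors that preserves the first entry and, for even \<open>m\<close>,
  reverses the sign of the last entry. So a fixed vector equals its reflection, its last entry is zero, and it vanishes.
\<close>

section \<open>Square systems of linear equations\<close>

lemma underdetermined_system_has_nonzero_solution:
  fixes a :: "'u \<Rightarrow> 'v \<Rightarrow> 'k::field"
  assumes "finite U" and "finite V" and "card U < card V"
  shows "\<exists>g. (\<exists>v\<in>V. g v \<noteq> 0) \<and> (\<forall>u\<in>U. (\<Sum>v\<in>V. a u v * g v) = 0)"
  using assms
proof (induction U arbitrary: V a rule: finite_induct)
  case empty
  then obtain v where "v \<in> V"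
    by (metis card.empty less_numeral_extra(3) ex_in_conv)
  then show ?case by (intro exI[of _ "\<lambda>_. 1"]) auto
next
  case (insert u0 U)
  show ?case
  proof (cases "\<forall>v\<in>V. a u0 v = 0")
    case True
    have "card U < card V" using insert by simp
    from insert.IH[OF insert.prems(1) this, of a] True show ?thesis by auto
  next
    case False
    then obtain w where w: "w \<in> V" "a u0 w \<noteq> 0" by blast
    define W where "W = V - {w}"
    define b where "b u v = a u v - a u w * a u0 v / a u0 w" for u v
    have V: "V = insert w W" and wW: "w \<notin> W" and fW: "finite W"
      using w insert.prems by (auto simp: W_def)
    have "card U < card W" using insert.prems insert.hyps V wW fW by simp
    from insert.IH[OF fW this, of b] obtain h where h: "\<exists>v\<in>W. h v \<noteq> 0"
      "\<forall>u\<in>U. (\<Sum>v\<in>W. b u v * h v) = 0" by blast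
    define s where "s = (\<Sum>v\<in>W. a u0 v * h v)"
    define g where "g v = (if v = w then - s / a u0 w else h v)" for v
    have gW: "(\<Sum>v\<in>W. a u v * g v) = (\<Sum>v\<in>W. a u v * h v)" for u
      using wW by (intro sum.cong) (auto simp: g_def)
    have tot: "(\<Sum>v\<in>V. a u v * g v) = (\<Sum>v\<in>W. a u v * h v) - a u w * s / a u0 w" for u
      using wW fW unfolding V by (simp add: gW) (simp add: g_def)
    have red: "(\<Sum>v\<in>W. b u v * h v) = (\<Sum>v\<in>W. a u v * h v) - a u w * s / a u0 w" for u
      by (simp add: b_def s_def left_diff_distrib sum_subtractf sum_distrib_left sum_divide_distrib
          mult.assoc)
    have "(\<Sum>v\<in>V. a u v * g v) = 0" if "u \<in> insert u0 U" for u
    proof (cases "u = u0")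
      case True
      then show ?thesis using w by (simp add: tot s_def)
    next
      case False
      then show ?thesis using that h(2) red tot by auto
    qed
    moreover have "\<exists>v\<in>V. g v \<noteq> 0" using h(1) wW V by (auto simp: g_def)
    ultimately show ?thesis by blast
  qed
qed

text \<open>
  Adding the right-hand side as one more unknown makes the homogeneous system underdetermined, and
  injectivity keeps the additional unknown away from zero.
\<close>

lemma square_system_injective_imp_surjective:
  fixes a :: "'u \<Rightarrow> 'v \<Rightarrow> 'k::field"
  assumes fin: "finite U" "finite V" and card: "card V = card U"
    and inj: "\<And>g. \<forall>u\<in>U. (\<Sum>v\<in>V. a u v * g v) = 0 \<Longrightarrow> \<forall>v\<in>V. g v = 0"
  shows "\<exists>g. \<forall>u\<in>U. (\<Sum>v\<in>V. a u v * g v) = h u"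
proof -
  \<comment> \<open>\<open>None\<close> stands for the additional unknown\<close>
  define b where "b u x = (case x of None \<Rightarrow> h u | Some v \<Rightarrow> a u v)" for u x
  define S where "S = insert None (Some ` V)"
  have "card U < card S" using fin card
    by (simp add: S_def card_insert_if card_image)
  moreover have "finite S" using fin by (simp add: S_def)
  ultimately obtain k where k: "\<exists>x\<in>S. k x \<noteq> 0" "\<forall>u\<in>U. (\<Sum>x\<in>S. b u x * k x) = 0"
    using underdetermined_system_has_nonzero_solution[OF fin(1), of S b] by blast
  have split: "(\<Sum>x\<in>S. b u x * k x) = h u * k None + (\<Sum>v\<in>V. a u v * k (Some v))" for u
    using fin by (simp add: S_def b_def sum.reindex)
  have nz: "k None \<noteq> 0"
  proof
    assume 0: "k None = 0"
    then have "\<forall>v\<in>V. k (Some v) = 0" using inj[of "\<lambda>v. k (Some v)"] k(2) split by simp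
    with 0 k(1) show False by (auto simp: S_def)
  qed
  have "(\<Sum>v\<in>V. a u v * (- k (Some v) / k None)) = h u" if "u \<in> U" for u
  proof -
    have "(\<Sum>v\<in>V. a u v * (- k (Some v) / k None)) = - (\<Sum>v\<in>V. a u v * k (Some v)) / k None"
      by (simp add: sum_divide_distrib sum_negf)
    also have "\<dots> = h u"
    proof -
      have "h u * k None + (\<Sum>v\<in>V. a u v * k (Some v)) = 0" using k(2) split that by metis
      then have "- (\<Sum>v\<in>V. a u v * k (Some v)) = h u * k None"
        by (simp add: add_eq_0_iff)
      then show ?thesis using nz by simp
    qed
    finally show ?thesis .
  qed
  then show ?thesis by (intro exI[of _ "\<lambda>v. - k (Some v) / k None"]) blast
qed

text \<open>
  Otherwise the transposed system could be solved with the indicator of \<open>v0\<close> on the right, and pairing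
  this solution with \<open>g\<close> would give \<open>g v0 = 0\<close>.
\<close>

lemma square_system_transpose_nonzero_solution:
  fixes a :: "'u \<Rightarrow> 'v \<Rightarrow> 'k::field"
  assumes fin: "finite U" "finite V" and card: "card V = card U"
    and g: "\<forall>u\<in>U. (\<Sum>v\<in>V. a u v * g v) = 0" and v0: "v0 \<in> V" "g v0 \<noteq> 0"
  shows "\<exists>f. (\<exists>u\<in>U. f u \<noteq> 0) \<and> (\<forall>v\<in>V. (\<Sum>u\<in>U. a u v * f u) = 0)"
proof (rule ccontr)
  assume no: "\<not> ?thesis"
  have "\<exists>f. \<forall>v\<in>V. (\<Sum>u\<in>U. a u v * f u) = (if v = v0 then 1 else 0)"
    by (rule square_system_injective_imp_surjective) (use fin card no in auto)
  then obtain f where f: "\<forall>v\<in>V. (\<Sum>u\<in>U. a u v * f u) = (if v = v0 then 1 else 0)" by blast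
  have "g v0 = (\<Sum>v\<in>V. g v * (if v = v0 then 1 else 0))" using v0 fin by (simp add: if_distrib cong: if_cong)
  also have "\<dots> = (\<Sum>v\<in>V. g v * (\<Sum>u\<in>U. a u v * f u))" using f by (intro sum.cong) auto
  also have "\<dots> = (\<Sum>u\<in>U. f u * (\<Sum>v\<in>V. a u v * g v))"
    unfolding sum_distrib_left by (subst sum.swap) (simp add: mult_ac)
  also have "\<dots> = 0" using g by simp
  finally show False using v0 by simp
qed

text \<open>
  If the only rational solution were zero, the transposed rational system would have a solution for
  the indicator of \<open>v0\<close>. It stays a solution over every field of characteristic zero, and the pairing
  with \<open>g\<close> contradicts \<open>g v0 \<noteq> 0\<close>.
\<close>

lemma rational_square_system_change_of_field:
  fixes a :: "'u \<Rightarrow> 'v \<Rightarrow> rat" and g :: "'v \<Rightarrow> 'k::field_char_0"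
  assumes fin: "finite U" "finite V" and card: "card V = card U"
    and g: "\<forall>u\<in>U. (\<Sum>v\<in>V. of_rat (a u v) * g v) = 0" and v0: "v0 \<in> V" "g v0 \<noteq> 0"
  shows "\<exists>h :: 'v \<Rightarrow> real. (\<exists>v\<in>V. h v \<noteq> 0) \<and> (\<forall>u\<in>U. (\<Sum>v\<in>V. of_rat (a u v) * h v) = 0)"
proof -
  have "\<exists>q. (\<exists>v\<in>V. q v \<noteq> 0) \<and> (\<forall>u\<in>U. (\<Sum>v\<in>V. a u v * q v) = 0)"
  proof (rule ccontr)
    assume no: "\<not> ?thesis"
    have no': "\<forall>u\<in>U. f u = 0" if f: "\<forall>v\<in>V. (\<Sum>u\<in>U. a u v * f u) = 0" for f
    proof (rule ccontr)
      assume "\<not> ?thesis"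
      then obtain u0 where "u0 \<in> U" "f u0 \<noteq> 0" by blast
      from square_system_transpose_nonzero_solution[OF fin(2,1) card[symmetric] f this] no
      show False by blast
    qed
    have "\<exists>f. \<forall>v\<in>V. (\<Sum>u\<in>U. a u v * f u) = (if v = v0 then 1 else 0)"
      by (rule square_system_injective_imp_surjective) (use fin card no' in auto)
    then obtain f where f: "\<forall>v\<in>V. (\<Sum>u\<in>U. a u v * f u) = (if v = v0 then 1 else 0)" by blast
    have f': "(\<Sum>u\<in>U. of_rat (a u v) * of_rat (f u)) = (if v = v0 then 1 else 0 :: 'k)"
      if "v \<in> V" for v
    proof -
      have "(\<Sum>u\<in>U. of_rat (a u v) * of_rat (f u)) = (of_rat (\<Sum>u\<in>U. a u v * f u) :: 'k)"
        by (simp add: of_rat_sum of_rat_mult)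
      then show ?thesis using f that by auto
    qed
    have "g v0 = (\<Sum>v\<in>V. g v * (if v = v0 then 1 else 0))"
      using v0 fin by (simp add: if_distrib cong: if_cong)
    also have "\<dots> = (\<Sum>v\<in>V. g v * (\<Sum>u\<in>U. of_rat (a u v) * of_rat (f u)))"
      using f' by (intro sum.cong) auto
    also have "\<dots> = (\<Sum>u\<in>U. of_rat (f u) * (\<Sum>v\<in>V. of_rat (a u v) * g v))"
      unfolding sum_distrib_left by (subst sum.swap) (simp add: mult_ac)
    also have "\<dots> = 0" using g by simp
    finally show False using v0 by simp
  qed
  then obtain q where q: "\<exists>v\<in>V. q v \<noteq> 0" "\<forall>u\<in>U. (\<Sum>v\<in>V. a u v * q v) = 0" by blast
  have "(\<Sum>v\<in>V. of_rat (a u v) * of_rat (q v)) = (0::real)" if "u \<in> U" for u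
  proof -
    have "(\<Sum>v\<in>V. of_rat (a u v) * of_rat (q v)) = (of_rat (\<Sum>v\<in>V. a u v * q v) :: real)"
      by (simp add: of_rat_sum of_rat_mult)
    then show ?thesis using q(2) that by simp
  qed
  then show ?thesis using q(1) by (intro exI[of _ "\<lambda>v. of_rat (q v)"]) auto
qed

section \<open>Sign changes\<close>

text \<open>
  A witness that \<open>v\<close> has at least \<open>k - 1\<close> sign changes, the first sign being that of \<open>s\<close>. Working with
  witnesses instead of the number of sign changes makes zero entries harmless.
\<close>

definition alternating :: "real \<Rightarrow> nat \<Rightarrow> (nat \<Rightarrow> 'a::linorder) \<Rightarrow> ('a \<Rightarrow> real) \<Rightarrow> bool" where
  "alternating s k q v \<longleftrightarrow> strict_mono_on {..<k} q \<and> (\<forall>i<k. s * (-1) ^ i * v (q i) > 0)"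

text \<open>
  The coefficients of \<open>(1 + y) V\<close> when \<open>v\<close> lists the coefficients of the Laurent polynomial \<open>V\<close>.
\<close>

definition pascal_step :: "(int \<Rightarrow> 'k::comm_ring_1) \<Rightarrow> int \<Rightarrow> 'k" where
  "pascal_step v n = v n + v (n - 1)"

text \<open>
  A positive sum has a positive summand, so every chosen position may be moved by 0 or -1 without
  losing its sign. Two neighbours cannot be moved to the same place, as their signs differ.
\<close>

lemma alternating_pascal_step:
  assumes "alternating s k q (pascal_step v)"
  shows "\<exists>q'. alternating s k q' v"
proof -
  have mono: "q i < q j" if "i < j" "j < k" for i j
    using assms that by (auto simp: alternating_def strict_mono_on_def)
  have "\<exists>n. (n = q i \<or> n = q i - 1) \<and> s * (-1) ^ i * v n > 0" if "i < k" for i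
  proof (rule ccontr)
    assume "\<not> ?thesis"
    then have "s * (-1) ^ i * v (q i) \<le> 0" "s * (-1) ^ i * v (q i - 1) \<le> 0"
      by (auto simp: not_less)
    then have "s * (-1) ^ i * pascal_step v (q i) \<le> 0"
      by (simp add: pascal_step_def distrib_left)
    with assms that show False by (auto simp: alternating_def not_less[symmetric])
  qed
  then obtain q' where q': "\<And>i. i < k \<Longrightarrow> q' i = q i \<or> q' i = q i - 1"
    "\<And>i. i < k \<Longrightarrow> s * (-1) ^ i * v (q' i) > 0" by metis
  have "q' i < q' j" if "i < j" "j < k" for i j
  proof (cases "j = Suc i")
    case True
    have "q' i \<noteq> q' j"
    proof
      assume "q' i = q' j"
      with q'(2)[of i] q'(2)[of j] that True show False by simp
    qed
    with q'(1)[of i] q'(1)[of j] mono[of i j] that show ?thesis by auto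
  next
    case False
    then have "q i < q (Suc i)" "q (Suc i) < q j" using that mono by auto
    with q'(1)[of i] q'(1)[of j] that show ?thesis by auto
  qed
  with q' show ?thesis by (intro exI[of _ q']) (auto simp: alternating_def strict_mono_on_def)
qed

lemma alternating_pascal_steps:
  "alternating s k q ((pascal_step ^^ N) v) \<Longrightarrow> \<exists>q'. alternating s k q' v"
proof (induction N arbitrary: q)
  case (Suc N)
  then show ?case using alternating_pascal_step[of s k q "(pascal_step ^^ N) v"] by auto
qed auto

section \<open>Multiplication by a power of \<open>1 + y\<close>\<close>

lemma pascal_steps_support:
  assumes "\<forall>n. n < lo \<or> hi < n \<longrightarrow> v n = 0" and "n < lo \<or> hi + int N < n"
  shows "(pascal_step ^^ N) v n = 0"
  using assms(2)
proof (induction N arbitrary: n)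
  case 0
  then show ?case using assms(1) by auto
next
  case (Suc N)
  then show ?case by (auto simp: pascal_step_def)
qed

lemma pascal_steps_eq_0_imp:
  assumes "\<And>n. n < lo \<Longrightarrow> v n = 0" and "\<And>n. (pascal_step ^^ N) v n = 0"
  shows "v n = 0"
  using assms
proof (induction N arbitrary: v n)
  case (Suc N)
  have "pascal_step v n = 0" for n
  proof (rule Suc.IH)
    show "pascal_step v n = 0" if "n < lo" for n using that Suc.prems(1) by (simp add: pascal_step_def)
    show "(pascal_step ^^ N) (pascal_step v) n = 0" for n
      using Suc.prems(2)[of n] by (simp add: funpow_swap1)
  qed
  then have step: "v n = - v (n - 1)" for n by (simp add: pascal_step_def eq_neg_iff_add_eq_0)
  show ?case
  proof (cases "n < lo")
    case False
    then have "lo - 1 \<le> n" by simp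
    then show ?thesis
    proof (induction n rule: int_ge_induct)
      case base
      then show ?case using Suc.prems(1) by simp
    next
      case (step i)
      then show ?case using \<open>\<And>n. v n = - v (n - 1)\<close>[of "i + 1"] by simp
    qed
  qed (use Suc.prems in auto)
qed auto

lemma pascal_steps_linear:
  "(pascal_step ^^ N) (\<lambda>n. v n + c * u n) n = (pascal_step ^^ N) v n + c * (pascal_step ^^ N) u n"
  by (induction N arbitrary: n) (auto simp: pascal_step_def algebra_simps)

lemma pascal_steps_sum:
  "(pascal_step ^^ N) (\<lambda>n. \<Sum>j\<in>A. x j * u j n) n = (\<Sum>j\<in>A. x j * (pascal_step ^^ N) (u j) n)"
  by (induction N arbitrary: n) (auto simp: pascal_step_def algebra_simps sum.distrib)

text \<open>
  The polynomial functions of degree less than \<open>N\<close>, described by their \<open>N\<close>-th differences, which is the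
  form in which they occur in summation by parts.
\<close>

primrec differences_vanish :: "nat \<Rightarrow> (int \<Rightarrow> real) \<Rightarrow> bool" where
  "differences_vanish 0 \<phi> \<longleftrightarrow> (\<forall>n. \<phi> n = 0)"
| "differences_vanish (Suc N) \<phi> \<longleftrightarrow> differences_vanish N (\<lambda>n. \<phi> (n + 1) - \<phi> n)"

lemma differences_vanish_add:
  "differences_vanish N \<phi> \<Longrightarrow> differences_vanish N \<psi> \<Longrightarrow> differences_vanish N (\<lambda>n. \<phi> n + \<psi> n)"
proof (induction N arbitrary: \<phi> \<psi>)
  case (Suc N)
  then show ?case using Suc.IH[of "\<lambda>n. \<phi> (n + 1) - \<phi> n" "\<lambda>n. \<psi> (n + 1) - \<psi> n"]
    by (simp add: algebra_simps)
qed auto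

lemma differences_vanish_shift:
  "differences_vanish N \<phi> \<Longrightarrow> differences_vanish N (\<lambda>n. \<phi> (n + 1))"
proof (induction N arbitrary: \<phi>)
  case (Suc N)
  then show ?case using Suc.IH[of "\<lambda>n. \<phi> (n + 1) - \<phi> n"] by simp
qed auto

lemma differences_vanish_times_linear:
  "differences_vanish N \<phi> \<Longrightarrow> differences_vanish (Suc N) (\<lambda>n. of_int (n - z) * \<phi> n)"
proof (induction N arbitrary: \<phi>)
  case (Suc N)
  have "differences_vanish (Suc N) (\<lambda>n. of_int (n - z) * (\<phi> (n + 1) - \<phi> n) + \<phi> (n + 1))"
    using Suc.IH[of "\<lambda>n. \<phi> (n + 1) - \<phi> n"] Suc.prems differences_vanish_shift[of "Suc N" \<phi>]
    by (intro differences_vanish_add) simp_all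
  moreover have "(\<lambda>n. of_int (n - z) * (\<phi> (n + 1) - \<phi> n) + \<phi> (n + 1))
      = (\<lambda>n. of_int (n + 1 - z) * \<phi> (n + 1) - of_int (n - z) * \<phi> n)"
    by (rule ext) (simp add: algebra_simps)
  ultimately show ?case unfolding differences_vanish.simps(2)[of "Suc N"] by metis
qed auto

lemma differences_vanish_prod:
  "finite Z \<Longrightarrow> differences_vanish (Suc (card Z)) (\<lambda>n. \<Prod>z\<in>Z. of_int (n - z))"
proof (induction Z rule: finite_induct)
  case (insert z Z)
  have "(\<lambda>n. \<Prod>z\<in>insert z Z. real_of_int (n - z))
      = (\<lambda>n. of_int (n - z) * (\<Prod>z\<in>Z. real_of_int (n - z)))"
    by (rule ext) (rule prod.insert[OF insert.hyps])
  moreover have "card (insert z Z) = Suc (card Z)" using insert.hyps by simp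
  ultimately show ?case using differences_vanish_times_linear[OF insert.IH, of z] by (simp only:)
qed simp

definition int_sign :: "int \<Rightarrow> real" where
  "int_sign n = (if even n then 1 else -1)"

text \<open>
  A multiple of \<open>(1 + y)\<^sup>N\<close> vanishes to order \<open>N\<close> at \<open>-1\<close>. Summation by parts moves one factor \<open>1 + y\<close>
  to \<open>\<phi>\<close>, where it acts as a difference operator.
\<close>

lemma pascal_steps_orthogonal_interval:
  assumes "\<forall>n. n < lo \<or> hi < n \<longrightarrow> v n = 0" and "differences_vanish N \<phi>"
  shows "(\<Sum>n\<in>{lo..hi + int N}. int_sign n * (pascal_step ^^ N) v n * \<phi> n) = 0"
  using assms(2)
proof (induction N arbitrary: \<phi>)
  case (Suc N)
  define u where "u = (pascal_step ^^ N) v"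
  define H where "H = hi + int N"
  have u0: "u n = 0" if "n < lo \<or> H < n" for n
    using pascal_steps_support[OF assms(1), of n N] that by (auto simp: u_def H_def)
  have "(\<Sum>n\<in>{lo..hi + int (Suc N)}. int_sign n * (pascal_step ^^ Suc N) v n * \<phi> n)
      = (\<Sum>n\<in>{lo..H + 1}. int_sign n * u n * \<phi> n) + (\<Sum>n\<in>{lo..H + 1}. int_sign n * u (n - 1) * \<phi> n)"
    by (simp add: u_def[symmetric] H_def pascal_step_def algebra_simps flip: sum.distrib)
  also have "(\<Sum>n\<in>{lo..H + 1}. int_sign n * u n * \<phi> n) = (\<Sum>n\<in>{lo..H}. int_sign n * u n * \<phi> n)"
    by (intro sum.mono_neutral_right) (auto simp: u0)
  also have "(\<Sum>n\<in>{lo..H + 1}. int_sign n * u (n - 1) * \<phi> n)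
      = (\<Sum>n\<in>{lo + 1..H + 1}. int_sign n * u (n - 1) * \<phi> n)"
    by (intro sum.mono_neutral_right) (auto simp: u0)
  also have "\<dots> = (\<Sum>n\<in>{lo..H}. int_sign (n + 1) * u n * \<phi> (n + 1))"
    by (intro sum.reindex_bij_witness[of _ "\<lambda>n. n + 1" "\<lambda>n. n - 1"]) auto
  also have "(\<Sum>n\<in>{lo..H}. int_sign n * u n * \<phi> n) + (\<Sum>n\<in>{lo..H}. int_sign (n + 1) * u n * \<phi> (n + 1))
      = - (\<Sum>n\<in>{lo..H}. int_sign n * u n * (\<phi> (n + 1) - \<phi> n))"
    by (simp add: int_sign_def algebra_simps flip: sum.distrib sum_negf)
       (intro sum.cong; auto)
  also have "\<dots> = 0" using Suc.IH[of "\<lambda>n. \<phi> (n + 1) - \<phi> n"] Suc.prems by (simp add: u_def H_def)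
  finally show ?case .
qed simp

lemma pascal_steps_orthogonal:
  assumes "\<forall>n. n < lo \<or> hi < n \<longrightarrow> v n = 0" and "differences_vanish N \<phi>" and "finite D"
    and D: "\<And>n. n \<notin> D \<Longrightarrow> (pascal_step ^^ N) v n * \<phi> n = 0"
  shows "(\<Sum>n\<in>D. int_sign n * (pascal_step ^^ N) v n * \<phi> n) = 0"
proof -
  have out: "(pascal_step ^^ N) v n = 0" if "n \<notin> {lo..hi + int N}" for n
    using pascal_steps_support[OF assms(1), of n N] that by auto
  have "(\<Sum>n\<in>D. int_sign n * (pascal_step ^^ N) v n * \<phi> n)
      = (\<Sum>n\<in>D \<inter> {lo..hi + int N}. int_sign n * (pascal_step ^^ N) v n * \<phi> n)"
    using assms(3) out by (intro sum.mono_neutral_right) auto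
  also have "\<dots> = (\<Sum>n\<in>{lo..hi + int N}. int_sign n * (pascal_step ^^ N) v n * \<phi> n)"
  proof (rule sum.mono_neutral_left)
    show "\<forall>n\<in>{lo..hi + int N} - D \<inter> {lo..hi + int N}. int_sign n * (pascal_step ^^ N) v n * \<phi> n = 0"
      using D by (metis Diff_iff Int_iff mult.assoc mult_zero_right)
  qed auto
  also have "\<dots> = 0" by (rule pascal_steps_orthogonal_interval[OF assms(1,2)])
  finally show ?thesis .
qed

text \<open>
  A multiple of \<open>(1 + y)\<^sup>N\<close> with at most \<open>N\<close> terms is zero: test it against the polynomial that vanishes
  on all of these exponents but one.
\<close>

lemma pascal_steps_few_terms:
  assumes "\<forall>n. n < lo \<or> hi < n \<longrightarrow> v n = 0" and "finite T" and "card T = N"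
    and T: "\<And>n. n \<notin> T \<Longrightarrow> (pascal_step ^^ N) v n = 0"
  shows "(pascal_step ^^ N) v n = (0::real)"
proof (cases "n \<in> T")
  case True
  define \<phi> :: "int \<Rightarrow> real" where "\<phi> x = (\<Prod>z\<in>T - {n}. of_int (x - z))" for x
  have "Suc (card (T - {n})) = N" using True assms(2,3) by (metis card_Suc_Diff1)
  then have "differences_vanish N \<phi>"
    using differences_vanish_prod[of "T - {n}"] assms(2) by (simp add: \<phi>_def[abs_def])
  moreover have "(pascal_step ^^ N) v x * \<phi> x = 0" if "x \<notin> {n}" for x
    using that T[of x] assms(2) by (cases "x \<in> T") (auto simp: \<phi>_def intro!: bexI[of _ x])
  ultimately have "(\<Sum>x\<in>{n}. int_sign x * (pascal_step ^^ N) v x * \<phi> x) = 0"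
    by (intro pascal_steps_orthogonal[OF assms(1)]) auto
  moreover have "\<phi> n \<noteq> 0" using assms(2) by (auto simp: \<phi>_def)
  ultimately show ?thesis by (simp add: int_sign_def split: if_splits)
qed (use T in auto)

text \<open>
  The inequalities on \<open>k0\<close> place the window of \<open>p\<close> prescribed coefficients inside the support of
  \<open>(1 + y)\<^sup>t U\<close>. If they are all zero, at most \<open>t\<close> terms remain, so the square system for \<open>u\<close> is injective.
\<close>

lemma pascal_steps_prescribed_values:
  assumes k0: "k0 \<le> r0" "r0 \<le> k0 + int t"
  shows "\<exists>u :: int \<Rightarrow> real. (\<forall>n. n < k0 \<or> k0 + int p \<le> n \<longrightarrow> u n = 0) \<and>
    (\<forall>i<p. (pascal_step ^^ t) u (r0 + int i) = h i)"
proof -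
  define e :: "nat \<Rightarrow> int \<Rightarrow> real" where "e j n = (if n = k0 + int j then 1 else 0)" for j n
  define U where "U x n = (\<Sum>j\<in>{..<p}. x j * e j n)" for x n
  have Uout: "U x n = 0" if "n < k0 \<or> k0 + int p \<le> n" for x n
    unfolding U_def by (rule sum.neutral) (use that in \<open>auto simp: e_def\<close>)
  have Uin: "U x (k0 + int j) = x j" if "j < p" for x j
    using that by (simp add: U_def e_def if_distrib cong: if_cong)
  have val: "(pascal_step ^^ t) (U x) n = (\<Sum>j\<in>{..<p}. (pascal_step ^^ t) (e j) n * x j)" for x n
    unfolding U_def pascal_steps_sum by (simp add: mult.commute)
  have "\<exists>x. \<forall>i\<in>{..<p}. (\<Sum>j\<in>{..<p}. (pascal_step ^^ t) (e j) (r0 + int i) * x j) = h i"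
  proof (rule square_system_injective_imp_surjective)
    fix x assume x: "\<forall>i\<in>{..<p}. (\<Sum>j\<in>{..<p}. (pascal_step ^^ t) (e j) (r0 + int i) * x j) = 0"
    define T where "T = {k0..<k0 + int p + int t} - {r0..<r0 + int p}"
    have sup: "\<forall>n. n < k0 \<or> k0 + int p - 1 < n \<longrightarrow> U x n = 0" using Uout[of _ x] by auto
    have "card T = card {k0..<k0 + int p + int t} - card {r0..<r0 + int p}"
      unfolding T_def using k0 by (intro card_Diff_subset) auto
    then have cT: "card T = t" by simp
    have "(pascal_step ^^ t) (U x) n = 0" if "n \<notin> T" for n
    proof (cases "n \<in> {r0..<r0 + int p}")
      case True
      then have "n = r0 + int (nat (n - r0))" "nat (n - r0) < p" by auto
      then show ?thesis using x val[of x n] by (metis lessThan_iff)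
    next
      case False
      then show ?thesis using that pascal_steps_support[OF sup, of n t] by (auto simp: T_def)
    qed
    then have z: "(pascal_step ^^ t) (U x) n = 0" for n
      using pascal_steps_few_terms[OF sup _ cT] by (auto simp: T_def)
    have "U x n = 0" for n
      by (rule pascal_steps_eq_0_imp[of k0 "U x" t]) (use sup z in \<open>auto\<close>)
    then show "\<forall>j\<in>{..<p}. x j = 0" using Uin by (metis lessThan_iff)
  qed auto
  then obtain x where "\<forall>i<p. (pascal_step ^^ t) (U x) (r0 + int i) = h i" unfolding val by auto
  then show ?thesis using Uout by (intro exI[of _ "U x"]) auto
qed

section \<open>Multiples of a power of \<open>1 + y\<close> with a gap\<close>

lemma prod_differences_sign:
  fixes n :: int
  assumes "finite Z"
  shows "(\<Prod>z\<in>Z. real_of_int (n - z)) = (-1) ^ card {z\<in>Z. n < z} * (\<Prod>z\<in>Z. \<bar>real_of_int (n - z)\<bar>)"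
  using assms
proof (induction Z rule: finite_induct)
  case (insert x Z)
  define P where "P = (\<Prod>z\<in>Z. \<bar>real_of_int (n - z)\<bar>)"
  have "{z \<in> insert x Z. n < z} = (if n < x then insert x {z\<in>Z. n < z} else {z\<in>Z. n < z})"
    by auto
  then have c: "card {z \<in> insert x Z. n < z} = (if n < x then 1 else 0) + card {z\<in>Z. n < z}"
    using insert.hyps by simp
  show ?case
    unfolding prod.insert[OF insert.hyps] insert.IH c P_def[symmetric]
    by (simp add: abs_if algebra_simps)
qed simp

lemma card_below_strict_mono_image:
  fixes q :: "nat \<Rightarrow> 'a::linorder"
  assumes "strict_mono_on {..<k} q" and "i < k"
  shows "card {x\<in>q ` {..<k}. x < q i} = i"
proof -
  have "q j < q i \<longleftrightarrow> j < i" if "j < k" for j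
    using strict_mono_onD[OF assms(1), of i j] strict_mono_onD[OF assms(1), of j i] that assms(2)
    by (cases i j rule: linorder_cases) auto
  then have "{x\<in>q ` {..<k}. x < q i} = q ` {..<i}" using assms(2) by force
  moreover have "inj_on q {..<i}"
    using assms by (auto intro!: inj_on_subset[OF strict_mono_on_imp_inj_on[OF assms(1)]])
  ultimately show ?thesis by (simp add: card_image)
qed

text \<open>
  The exponents that can occur in the row of the hexagon through a side of the puncture: the puncture
  fills the gap, of length \<open>t - m\<close>, between the two blocks.
\<close>

definition two_blocks :: "int \<Rightarrow> nat \<Rightarrow> nat \<Rightarrow> int set" where
  "two_blocks e m t = {e..<e + int m} \<union> {e + int t..<e + int t + int m}"

lemma card_two_blocks: "m \<le> t \<Longrightarrow> card (two_blocks e m t) = 2 * m"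
  unfolding two_blocks_def by (subst card_Un_disjoint) auto

lemma finite_two_blocks [simp]: "finite (two_blocks e m t)"
  by (simp add: two_blocks_def)

text \<open>
  Because the gap is even, the parity of an exponent and the parity of its rank among the two blocks
  differ by a constant.
\<close>

lemma int_sign_eq_position:
  assumes "m \<le> t" and "even (t - m)" and n: "n \<in> two_blocks e m t"
  shows "int_sign n = int_sign e * (-1) ^ card {x\<in>two_blocks e m t. x < n}"
proof (cases "n < e + int m")
  case True
  then have "{x\<in>two_blocks e m t. x < n} = {e..<n}" using assms by (auto simp: two_blocks_def)
  moreover have "e \<le> n" using assms True by (auto simp: two_blocks_def)
  ultimately show ?thesis by (auto simp: int_sign_def even_nat_iff uminus_power_if)
next
  case False
  then have n': "e + int t \<le> n" "n < e + int t + int m" using n by (auto simp: two_blocks_def)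
  have "{x\<in>two_blocks e m t. x < n} = {e..<e + int m} \<union> {e + int t..<n}"
    using n' assms(1) by (auto simp: two_blocks_def)
  then have "card {x\<in>two_blocks e m t. x < n} = m + nat (n - e - int t)"
    using assms(1) by (simp add: card_Un_disjoint diff_diff_eq)
  moreover have "even m \<longleftrightarrow> even t" using assms(1,2) by auto
  ultimately show ?thesis using n' by (auto simp: int_sign_def even_nat_iff uminus_power_if)
qed

text \<open>
  In this context \<open>w\<close> has a zero of order \<open>N\<close> at \<open>-1\<close> and lives on \<open>2m\<close> positions. Its entries therefore satisfy
  enough linear relations to eliminate any \<open>N - 1\<close> of them.
\<close>

context
  fixes v w :: "int \<Rightarrow> real" and lo hi e :: int and m t N :: nat
  assumes v_support: "\<forall>n. n < lo \<or> hi < n \<longrightarrow> v n = 0"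
    and w_def: "w = (pascal_step ^^ N) v"
    and w_support: "\<And>n. n \<notin> two_blocks e m t \<Longrightarrow> w n = 0"
    and mt: "m \<le> t" "even (t - m)"
    and N: "0 < N" "N \<le> 2 * m"
begin

lemma orthogonal_two_blocks:
  assumes Z: "Z \<subseteq> two_blocks e m t" "Suc (card Z) = N"
  shows "(\<Sum>n\<in>two_blocks e m t - Z. int_sign n * w n * (\<Prod>z\<in>Z. of_int (n - z))) = 0"
proof -
  define \<phi> where "\<phi> n = (\<Prod>z\<in>Z. real_of_int (n - z))" for n
  have fZ: "finite Z" using Z(1) finite_two_blocks finite_subset by blast
  have "differences_vanish N \<phi>"
    using differences_vanish_prod[OF fZ] Z(2) by (simp add: \<phi>_def[abs_def])
  moreover have "(pascal_step ^^ N) v n * \<phi> n = 0" if "n \<notin> two_blocks e m t - Z" for n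
    using that w_support[of n] fZ by (auto simp: \<phi>_def w_def intro!: prod_zero)
  ultimately have "(\<Sum>n\<in>two_blocks e m t - Z. int_sign n * (pascal_step ^^ N) v n * \<phi> n) = 0"
    by (intro pascal_steps_orthogonal[OF v_support]) auto
  then show ?thesis by (simp add: w_def \<phi>_def)
qed

text \<open>
  The \<open>N - 1\<close> positions outside \<open>q\<close> and \<open>n\<close> can be eliminated by a polynomial of degree \<open>N - 1\<close>, and the
  remaining relation involves \<open>w n\<close> alone.
\<close>

lemma two_blocks_vanish:
  assumes q: "q \<subseteq> two_blocks e m t" "card q + N = 2 * m" and z: "\<And>n. n \<in> q \<Longrightarrow> w n = 0"
  shows "w n = 0"
proof (rule ccontr)
  assume nz: "w n \<noteq> 0"
  then have n: "n \<in> two_blocks e m t" "n \<notin> q" using w_support z by auto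
  define Z where "Z = two_blocks e m t - insert n q"
  have "card (insert n q) = Suc (card q)" using n q(1) finite_subset by fastforce
  then have "card Z = 2 * m - Suc (card q)"
    unfolding Z_def using n q(1) mt by (subst card_Diff_subset) (auto simp: card_two_blocks finite_subset)
  then have "Suc (card Z) = N" using q(2) N by simp
  moreover have "Z \<subseteq> two_blocks e m t" by (auto simp: Z_def)
  ultimately have "(\<Sum>x\<in>two_blocks e m t - Z. int_sign x * w x * (\<Prod>z\<in>Z. of_int (x - z))) = 0"
    by (rule orthogonal_two_blocks[rotated])
  moreover have "two_blocks e m t - Z = insert n q" using n q(1) by (auto simp: Z_def)
  moreover have "(\<Sum>x\<in>q. int_sign x * w x * (\<Prod>z\<in>Z. real_of_int (x - z))) = 0"
    by (rule sum.neutral) (simp add: z)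
  moreover have "finite q" using q(1) finite_two_blocks finite_subset by blast
  ultimately have "int_sign n * w n * (\<Prod>z\<in>Z. of_int (n - z)) = 0" using n by simp
  then have "(\<Prod>z\<in>Z. real_of_int (n - z)) = 0" using nz by (simp add: int_sign_def split: if_splits)
  then show False by (auto simp: Z_def)
qed

text \<open>
  Eliminate the \<open>N - 1\<close> positions that do not belong to \<open>q\<close>. In the relation that remains, the sign of the
  product at \<open>q i\<close> is given by the number of eliminated positions above \<open>q i\<close>, the sign \<open>int_sign\<close> by the
  rank of \<open>q i\<close>. Together they alternate with \<open>i\<close>, so all summands have the same sign and must vanish.
\<close>

lemma two_blocks_weak_alternation:
  assumes mono: "strict_mono_on {..<k} q" and q: "\<And>i. i < k \<Longrightarrow> q i \<in> two_blocks e m t"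
    and k: "k + N = Suc (2 * m)" and s: "s \<noteq> 0"
    and alt: "\<And>i. i < k \<Longrightarrow> s * (-1) ^ i * w (q i) \<ge> 0" and i: "i < k"
  shows "w (q i) = 0"
proof -
  define Z where "Z = two_blocks e m t - q ` {..<k}"
  define P where "P n = (\<Prod>z\<in>Z. \<bar>real_of_int (n - z)\<bar>)" for n
  have inj: "inj_on q {..<k}" by (rule strict_mono_on_imp_inj_on[OF mono])
  have fZ: "finite Z" by (simp add: Z_def)
  have sub: "q ` {..<k} \<subseteq> two_blocks e m t" using q by auto
  then have "card Z = 2 * m - k"
    unfolding Z_def using mt inj by (subst card_Diff_subset) (auto simp: card_two_blocks card_image)
  then have cZ: "Suc (card Z) = N" using k N by simp
  have sgn: "int_sign (q j) * (\<Prod>z\<in>Z. real_of_int (q j - z)) = int_sign e * (-1) ^ card Z * ((-1) ^ j * P (q j))"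
    if j: "j < k" for j
  proof -
    have "q j \<notin> Z" using j by (auto simp: Z_def)
    have "{x\<in>two_blocks e m t. x < q j} = {x\<in>q ` {..<k}. x < q j} \<union> {z\<in>Z. z < q j}"
      using sub by (auto simp: Z_def)
    moreover have "card \<dots> = card {x\<in>q ` {..<k}. x < q j} + card {z\<in>Z. z < q j}"
      by (rule card_Un_disjoint) (auto simp: Z_def)
    ultimately have c1: "card {x\<in>two_blocks e m t. x < q j} = j + card {z\<in>Z. z < q j}"
      using card_below_strict_mono_image[OF mono j] by simp
    have "z < q j \<or> q j < z" if "z \<in> Z" for z
      using that \<open>q j \<notin> Z\<close> by (cases z "q j" rule: linorder_cases) auto
    then have "Z = {z\<in>Z. z < q j} \<union> {z\<in>Z. q j < z}" by blast
    moreover have "card \<dots> = card {z\<in>Z. z < q j} + card {z\<in>Z. q j < z}"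
      using fZ by (intro card_Un_disjoint) auto
    ultimately have c2: "card Z = card {z\<in>Z. z < q j} + card {z\<in>Z. q j < z}" by simp
    have "int_sign (q j) * (\<Prod>z\<in>Z. real_of_int (q j - z))
        = int_sign e * (-1) ^ (j + card {z\<in>Z. z < q j}) * ((-1) ^ card {z\<in>Z. q j < z} * P (q j))"
      unfolding int_sign_eq_position[OF mt q[OF j]] prod_differences_sign[OF fZ] P_def c1 ..
    then show ?thesis unfolding c2 by (simp add: power_add mult_ac)
  qed
  have "(\<Sum>n\<in>two_blocks e m t - Z. int_sign n * w n * (\<Prod>z\<in>Z. of_int (n - z))) = 0"
    by (rule orthogonal_two_blocks) (use cZ in \<open>auto simp: Z_def\<close>)
  moreover have "two_blocks e m t - Z = q ` {..<k}" using sub by (auto simp: Z_def)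
  ultimately have "(\<Sum>j<k. int_sign (q j) * w (q j) * (\<Prod>z\<in>Z. real_of_int (q j - z))) = 0"
    using inj by (simp add: sum.reindex)
  moreover have "(\<Sum>j<k. int_sign (q j) * w (q j) * (\<Prod>z\<in>Z. real_of_int (q j - z)))
      = int_sign e * (-1) ^ card Z / s * (\<Sum>j<k. (s * (-1) ^ j * w (q j)) * P (q j))"
    unfolding sum_distrib_left
  proof (rule sum.cong[OF refl])
    fix j assume "j \<in> {..<k}"
    then have j: "j < k" by simp
    have "int_sign (q j) * w (q j) * (\<Prod>z\<in>Z. real_of_int (q j - z))
        = w (q j) * (int_sign (q j) * (\<Prod>z\<in>Z. real_of_int (q j - z)))"
      by (simp only: mult_ac)
    also note sgn[OF j]
    finally have "int_sign (q j) * w (q j) * (\<Prod>z\<in>Z. real_of_int (q j - z))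
        = w (q j) * (int_sign e * (-1) ^ card Z * ((-1) ^ j * P (q j)))" .
    then show "int_sign (q j) * w (q j) * (\<Prod>z\<in>Z. real_of_int (q j - z))
        = int_sign e * (-1) ^ card Z / s * ((s * (-1) ^ j * w (q j)) * P (q j))"
      using s by (simp add: field_simps)
  qed
  ultimately have "(\<Sum>j<k. (s * (-1) ^ j * w (q j)) * P (q j)) = 0"
    using s by (simp add: int_sign_def split: if_splits)
  moreover have Ppos: "P (q j) > 0" if "j < k" for j
    unfolding P_def by (rule prod_pos) (use that in \<open>auto simp: Z_def\<close>)
  ultimately have "(s * (-1) ^ i * w (q i)) * P (q i) = 0"
    using i alt by (subst (asm) sum_nonneg_eq_0_iff) (auto simp: less_imp_le)
  then show ?thesis using Ppos[OF i] s by simp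
qed

end

lemma small_perturbation:
  fixes w u :: "'a \<Rightarrow> real"
  assumes "finite D"
  shows "\<exists>\<delta>>0. \<forall>n\<in>D. w n \<noteq> 0 \<longrightarrow> \<delta> * \<bar>u n\<bar> < \<bar>w n\<bar>"
  using assms
proof (induction D rule: finite_induct)
  case (insert x D)
  then obtain \<delta> where \<delta>: "\<delta> > 0" "\<forall>n\<in>D. w n \<noteq> 0 \<longrightarrow> \<delta> * \<bar>u n\<bar> < \<bar>w n\<bar>" by blast
  \<comment> \<open>the denominator is shifted by 1 because \<open>u x\<close> may be zero\<close>
  define \<eta> where "\<eta> = (if w x = 0 then \<delta> else min \<delta> (\<bar>w x\<bar> / (2 * (\<bar>u x\<bar> + 1))))"
  have pos: "\<eta> > 0" "\<eta> \<le> \<delta>" using \<delta>(1) by (auto simp: \<eta>_def)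
  have "\<eta> * \<bar>u n\<bar> < \<bar>w n\<bar>" if "n \<in> insert x D" "w n \<noteq> 0" for n
  proof (cases "n = x")
    case True
    then have "\<eta> \<le> \<bar>w x\<bar> / (2 * (\<bar>u x\<bar> + 1))" using that by (simp add: \<eta>_def)
    then have "\<eta> * \<bar>u x\<bar> \<le> \<bar>w x\<bar> / (2 * (\<bar>u x\<bar> + 1)) * \<bar>u x\<bar>" by (intro mult_right_mono) auto
    also have "\<dots> < \<bar>w x\<bar>" using that True by (simp add: field_simps add_strict_increasing)
    finally show ?thesis using True by simp
  next
    case False
    then have "\<eta> * \<bar>u n\<bar> \<le> \<delta> * \<bar>u n\<bar>" using pos by (intro mult_right_mono) auto
    also have "\<dots> < \<bar>w n\<bar>" using False that \<delta>(2) by auto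
    finally show ?thesis .
  qed
  with pos show ?case by blast
qed (auto intro: exI[of _ 1])

text \<open>
  If the vector \<open>w\<close> of coefficients of \<open>(1 + y)\<^sup>N V\<close> is perturbed so that the \<open>p\<close> vanishing entries of
  \<open>(1 + y)\<^sup>t W\<close> alternate, the alternation pulls back to the perturbed \<open>w\<close>; in the limit \<open>w\<close> alternates
  weakly at \<open>p\<close> places. Both starting signs can be obtained. Two such sequences that differ somewhere
  merge into a weakly alternating sequence of length \<open>p + 1\<close>, which the orthogonality relations do not
  admit unless \<open>w\<close> is zero; if they agree, \<open>w\<close> is zero at their common places.
\<close>

theorem two_blocks_gap_imp_zero:
  fixes v :: "int \<Rightarrow> real" and e r0 k0 :: int and m t N p :: nat
  assumes v_support: "\<forall>n. n < lo \<or> hi < n \<longrightarrow> v n = 0"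
    and w_support: "\<And>n. n \<notin> two_blocks e m t \<Longrightarrow> (pascal_step ^^ N) v n = 0"
    and mt: "m \<le> t" "even (t - m)" and N: "0 < N" "p + N = 2 * m"
    and gap: "\<And>n. r0 \<le> n \<Longrightarrow> n < r0 + int p \<Longrightarrow> (pascal_step ^^ (t + N)) v n = 0"
    and k0: "e \<le> k0" "k0 + int p \<le> e + int m" "k0 \<le> r0" "r0 \<le> k0 + int t"
  shows "v n = 0"
proof -
  define D where "D = two_blocks e m t"
  define w where "w = (pascal_step ^^ N) v"
  have N2: "N \<le> 2 * m" using N by simp
  have wD: "w n = 0" if "n \<notin> two_blocks e m t" for n using w_support that by (simp add: w_def)
  note vanish = two_blocks_vanish[where e = e, OF v_support w_def wD mt N(1) N2]
  note weak = two_blocks_weak_alternation[where e = e, OF v_support w_def wD mt N(1) N2]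
  have gap': "(pascal_step ^^ t) w (r0 + int i) = 0" if "i < p" for i
    using gap[of "r0 + int i"] that by (simp add: w_def funpow_add)
  obtain u :: "int \<Rightarrow> real" where u: "\<forall>n. n < k0 \<or> k0 + int p \<le> n \<longrightarrow> u n = 0"
    "\<forall>i<p. (pascal_step ^^ t) u (r0 + int i) = (-1) ^ i"
    using pascal_steps_prescribed_values[OF k0(3,4), of p "\<lambda>i. (-1) ^ i"] by blast
  obtain \<delta> where \<delta>: "\<delta> > 0" "\<forall>n\<in>D. w n \<noteq> 0 \<longrightarrow> \<delta> * \<bar>u n\<bar> < \<bar>w n\<bar>"
    using small_perturbation[of D w u] by (auto simp: D_def)
  have pert: "\<exists>q. strict_mono_on {..<p} q \<and> (\<forall>i<p. q i \<in> D \<and> s * (-1) ^ i * w (q i) \<ge> 0)"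
    if s: "s = 1 \<or> s = -1" for s :: real
  proof -
    define y where "y n = w n + (s * \<delta>) * u n" for n
    have "alternating s p (\<lambda>i. r0 + int i) ((pascal_step ^^ t) y)"
      unfolding alternating_def
    proof (intro conjI allI impI)
      fix i assume i: "i < p"
      have "(pascal_step ^^ t) y (r0 + int i) = s * \<delta> * (-1) ^ i"
        unfolding y_def pascal_steps_linear using i gap' u(2) by simp
      moreover have "s * (-1) ^ i * (s * \<delta> * (-1) ^ i) = \<delta>"
        using s by (auto simp flip: power_add mult_2)
      ultimately show "s * (-1) ^ i * (pascal_step ^^ t) y (r0 + int i) > 0" using \<delta>(1) by (simp only:)
    qed (auto simp: strict_mono_on_def)
    then obtain q where q: "alternating s p q y" using alternating_pascal_steps by blast
    have "q i \<in> D \<and> s * (-1) ^ i * w (q i) \<ge> 0" if i: "i < p" for i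
    proof
      have pos: "s * (-1) ^ i * y (q i) > 0" using q i by (simp add: alternating_def)
      then have "y (q i) \<noteq> 0" by auto
      moreover have "y n = 0" if "n \<notin> D" for n
        using that wD[of n] u(1) k0 by (auto simp: y_def D_def two_blocks_def)
      ultimately show "q i \<in> D" by blast
      show "s * (-1) ^ i * w (q i) \<ge> 0"
      proof (rule ccontr)
        assume neg: "\<not> ?thesis"
        then have "w (q i) \<noteq> 0" by auto
        then have "\<delta> * \<bar>u (q i)\<bar> < \<bar>w (q i)\<bar>" using \<delta>(2) \<open>q i \<in> D\<close> by blast
        moreover have "\<bar>s * (-1) ^ i * w (q i)\<bar> = \<bar>w (q i)\<bar>" using s by (auto simp: abs_mult power_abs)
        moreover have "\<bar>s * (-1) ^ i * (s * \<delta> * u (q i))\<bar> = \<delta> * \<bar>u (q i)\<bar>"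
          using s \<delta>(1) by (auto simp: abs_mult power_abs)
        moreover have "s * (-1) ^ i * y (q i) = s * (-1) ^ i * w (q i) + s * (-1) ^ i * (s * \<delta> * u (q i))"
          by (simp add: y_def algebra_simps)
        ultimately show False using pos neg by linarith
      qed
    qed
    then show ?thesis using q by (auto simp: alternating_def)
  qed
  obtain f where f: "strict_mono_on {..<p} f" "\<forall>i<p. f i \<in> D \<and> (-1) ^ i * w (f i) \<ge> 0"
    using pert[of 1] by auto
  obtain g where g: "strict_mono_on {..<p} g" "\<forall>i<p. g i \<in> D \<and> (-1) ^ i * w (g i) \<le> 0"
    using pert[of "-1"] by auto
  have merge: "w n = 0" if f: "strict_mono_on {..<p} f" "\<forall>i<p. f i \<in> D \<and> s * (-1) ^ i * w (f i) \<ge> 0"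
    and g: "strict_mono_on {..<p} g" "\<forall>i<p. g i \<in> D \<and> s * (-1) ^ i * w (g i) \<le> 0"
    and l: "l < p" "f l < g l" and s: "s \<noteq> 0" for f g l n and s :: real
  proof -
    \<comment> \<open>follow \<open>f\<close> up to the place \<open>l\<close> where it is smaller, then continue with \<open>g\<close> from its place \<open>l\<close> on\<close>
    define q where "q i = (if i \<le> l then f i else g (i - 1))" for i
    have mono: "strict_mono_on {..<Suc p} q"
    proof (rule strict_mono_onI)
      fix i j assume ij: "i \<in> {..<Suc p}" "j \<in> {..<Suc p}" "i < j"
      consider "j \<le> l" | "i \<le> l" "l < j" | "l < i" by linarith
      then show "q i < q j"
      proof cases
        case 1
        then show ?thesis using ij l strict_mono_onD[OF f(1)] by (auto simp: q_def)
      next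
        case 2
        have "f i \<le> f l" using 2 l strict_mono_onD[OF f(1), of i l] by (cases "i = l") auto
        also have "f l < g l" by fact
        also have "g l \<le> g (j - 1)"
        proof (cases "l = j - 1")
          case False
          then have "l < j - 1" "j - 1 < p" using 2 ij by auto
          then show ?thesis using strict_mono_onD[OF g(1), of l "j - 1"] l by simp
        qed simp
        finally show ?thesis using 2 by (simp add: q_def)
      next
        case 3
        then show ?thesis using ij strict_mono_onD[OF g(1), of "i - 1" "j - 1"] by (auto simp: q_def)
      qed
    qed
    have qD: "q i \<in> two_blocks e m t" "s * (-1) ^ i * w (q i) \<ge> 0" if i: "i < Suc p" for i
    proof -
      show "q i \<in> two_blocks e m t" using i f(2) g(2) l by (auto simp: q_def D_def)
      show "s * (-1) ^ i * w (q i) \<ge> 0"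
      proof (cases "i \<le> l")
        case False
        then obtain j where j: "i = Suc j" "j < p" using i by (cases i) auto
        then show ?thesis using g(2) False by (auto simp: q_def)
      qed (use f(2) l in \<open>auto simp: q_def\<close>)
    qed
    have z: "w (q i) = 0" if "i < Suc p" for i
      by (rule weak[OF _ mono _ _ s _ that]) (use qD N in \<open>auto\<close>)
    have "inj_on q {..<p}"
      using strict_mono_on_imp_inj_on[OF mono] by (rule inj_on_subset) auto
    then show "w n = 0"
      by (intro vanish[of "q ` {..<p}" n]) (use qD(1) z N in \<open>auto simp: card_image\<close>)
  qed
  have "w n = 0" for n
  proof (cases "\<exists>l<p. f l \<noteq> g l")
    case True
    then obtain l where l: "l < p" "f l \<noteq> g l" by blast
    show ?thesis
    proof (cases "f l < g l")
      case True
      show ?thesis by (rule merge[OF f(1) _ g(1) _ l(1) True, of 1]) (use f g in auto)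
    next
      case False
      then have "g l < f l" using l by simp
      show ?thesis by (rule merge[OF g(1) _ f(1) _ l(1) \<open>g l < f l\<close>, of "-1"]) (use f g in auto)
    qed
  next
    case False
    have "w (f i) = 0" if "i < p" for i
    proof -
      have "(-1) ^ i * w (f i) \<ge> 0" "(-1) ^ i * w (f i) \<le> 0" using f(2) g(2) False that by auto
      then have "(-1) ^ i * w (f i) = 0" by linarith
      then show ?thesis by simp
    qed
    moreover have "card (f ` {..<p}) = p"
      using strict_mono_on_imp_inj_on[OF f(1)] by (simp add: card_image)
    ultimately show ?thesis
      by (intro vanish[of "f ` {..<p}" n]) (use f(2) N in \<open>auto simp: D_def\<close>)
  qed
  then have z: "(pascal_step ^^ N) v n = 0" for n by (simp add: w_def)
  show "v n = 0"
    by (rule pascal_steps_eq_0_imp[of lo v N n, rotated]) (use v_support z in \<open>auto\<close>)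
qed

section \<open>The inverse system\<close>

text \<open>
  The exponent vectors of the monomials outside the ideal.
\<close>

definition standard_exponents :: "nat \<Rightarrow> nat \<Rightarrow> nat \<Rightarrow> nat \<Rightarrow> nat \<Rightarrow> nat \<Rightarrow> nat \<Rightarrow> bool" where
  "standard_exponents \<alpha> \<beta> \<gamma> t a b c \<longleftrightarrow>
     a < \<alpha> + t \<and> b < \<beta> + t \<and> c < \<gamma> + t \<and> \<not> (\<alpha> \<le> a \<and> \<beta> \<le> b \<and> \<gamma> \<le> c)"

text \<open>
  The linear forms on the component of degree \<open>d\<close>, given by their values on monomials, that vanish on
  \<open>I\<close> and on all multiples of \<open>px + qy + rz\<close>.
\<close>

definition inverse_system ::
  "nat \<Rightarrow> nat \<Rightarrow> nat \<Rightarrow> nat \<Rightarrow> nat \<Rightarrow> 'k::field \<Rightarrow> 'k \<Rightarrow> 'k \<Rightarrow> (nat \<Rightarrow> nat \<Rightarrow> nat \<Rightarrow> 'k) \<Rightarrow> bool" where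
  "inverse_system \<alpha> \<beta> \<gamma> t d p q r g \<longleftrightarrow>
     (\<forall>a b c. a + b + c = d \<and> \<not> standard_exponents \<alpha> \<beta> \<gamma> t a b c \<longrightarrow> g a b c = 0) \<and>
     (\<forall>a b c. Suc (a + b + c) = d \<longrightarrow> p * g (Suc a) b c + q * g a (Suc b) c + r * g a b (Suc c) = 0)"

lemma inverse_system_outside:
  "inverse_system \<alpha> \<beta> \<gamma> t d p q r g \<Longrightarrow> a + b + c = d \<Longrightarrow> \<not> standard_exponents \<alpha> \<beta> \<gamma> t a b c \<Longrightarrow> g a b c = 0"
  by (simp add: inverse_system_def)

lemma inverse_system_relation:
  "inverse_system \<alpha> \<beta> \<gamma> t d p q r g \<Longrightarrow> Suc (a + b + c) = d \<Longrightarrow>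
    p * g (Suc a) b c + q * g a (Suc b) c + r * g a b (Suc c) = 0"
  by (simp add: inverse_system_def)

text \<open>
  The values with \<open>c = 0\<close>, indexed by \<open>b\<close> and extended by zero.
\<close>

definition bottom_row :: "nat \<Rightarrow> (nat \<Rightarrow> nat \<Rightarrow> nat \<Rightarrow> real) \<Rightarrow> int \<Rightarrow> real" where
  "bottom_row d g n = (if 0 \<le> n \<and> n \<le> int d then g (d - nat n) (nat n) 0 else 0)"

lemma pascal_steps_Suc:
  "(pascal_step ^^ Suc c) v n = (pascal_step ^^ c) v n + (pascal_step ^^ c) v (n - 1)"
  by (simp add: pascal_step_def)

text \<open>
  The relation expresses the row \<open>c + 1\<close> through the row \<open>c\<close> as a multiplication by \<open>-(1 + y)\<close>.
\<close>

lemma inverse_system_rows: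
  assumes g: "inverse_system \<alpha> \<beta> \<gamma> t d 1 1 1 g" and "a + b + c = d"
  shows "(pascal_step ^^ c) (bottom_row d g) (int (b + c)) = (-1) ^ c * g a b c"
  using assms(2)
proof (induction c arbitrary: a b)
  case 0
  then have "d - b = a" by simp
  then show ?case using 0 by (simp add: bottom_row_def)
next
  case (Suc c)
  have "g (Suc a) b c + g a (Suc b) c + g a b (Suc c) = 0"
    using inverse_system_relation[OF g, of a b c] Suc.prems by simp
  then have "g a b (Suc c) = - (g (Suc a) b c + g a (Suc b) c)"
    by (simp add: eq_neg_iff_add_eq_0 algebra_simps)
  moreover have "(pascal_step ^^ c) (bottom_row d g) (int (Suc b + c)) = (-1) ^ c * g a (Suc b) c"
    using Suc.prems by (intro Suc.IH) simp
  moreover have "(pascal_step ^^ c) (bottom_row d g) (int (b + c)) = (-1) ^ c * g (Suc a) b c"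
    using Suc.prems by (intro Suc.IH) simp
  moreover have "int (b + Suc c) - 1 = int (b + c)" by simp
  ultimately show ?case unfolding pascal_steps_Suc by (simp add: right_diff_distrib)
qed

lemma pascal_steps_of_zero:
  "(\<And>n. v n = 0) \<Longrightarrow> (pascal_step ^^ c) v n = 0"
  by (induction c arbitrary: n) (auto simp: pascal_step_def)

text \<open>
  In the bottom row the conditions of vanishing for \<open>a \<ge> \<alpha> + t\<close> and \<open>b \<ge> \<beta> + t\<close> bound the support. The
  row \<open>\<gamma>\<close> contains a side of the puncture, which is the gap between the two blocks, and the row \<open>\<gamma> + t\<close> is
  zero.
\<close>

theorem inverse_system_even_puncture:
  fixes g :: "nat \<Rightarrow> nat \<Rightarrow> nat \<Rightarrow> real"
  assumes sum: "\<alpha> + \<beta> + \<gamma> = 3 * m" and m: "0 < m" "\<alpha> \<le> m" "m \<le> \<gamma>" "\<gamma> \<le> 2 * m" "\<beta> \<le> 2 * m"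
    and t: "m \<le> t" "even (t - m)"
    and g: "inverse_system \<alpha> \<beta> \<gamma> t (2 * m + t - 1) 1 1 1 g"
    and abc: "a + b + c = 2 * m + t - 1"
  shows "g a b c = 0"
proof -
  define d where "d = 2 * m + t - 1"
  define v where "v = bottom_row d g"
  define e where "e = 2 * int m - int \<alpha>"
  define p where "p = 2 * m - \<gamma>"
  \<comment> \<open>a window of \<open>p\<close> positions in the first block from which the zeros in the row \<open>\<gamma> + t\<close> can be varied freely\<close>
  define k0 where "k0 = max e (int \<gamma>)"
  note g = g[folded d_def]
  have d: "int d = 2 * int m + int t - 1" using m by (simp add: d_def)
  note rows = inverse_system_rows[OF g, folded v_def]
  have sumI: "int \<alpha> + int \<beta> + int \<gamma> = 3 * int m" using sum by linarith
  have v_support: "\<forall>n. n < e \<or> int \<beta> + int t - 1 < n \<longrightarrow> v n = 0"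
  proof (intro allI impI)
    fix n assume n: "n < e \<or> int \<beta> + int t - 1 < n"
    show "v n = 0"
    proof (cases "0 \<le> n \<and> n \<le> int d")
      case True
      have "\<not> standard_exponents \<alpha> \<beta> \<gamma> t (d - nat n) (nat n) 0"
        using n True d by (auto simp: standard_exponents_def e_def)
      then have "g (d - nat n) (nat n) 0 = 0"
        using True by (intro inverse_system_outside[OF g]) auto
      then show ?thesis by (simp add: v_def bottom_row_def)
    qed (auto simp: v_def bottom_row_def)
  qed
  have "v n = 0" for n
  proof (rule two_blocks_gap_imp_zero[OF v_support])
    fix n assume n: "n \<notin> two_blocks e m t"
    consider "n < e \<or> int \<beta> + int t - 1 + int \<gamma> < n" | "int \<beta> + int \<gamma> \<le> n" "n < e + int t"
      using n sumI by (force simp: two_blocks_def e_def)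
    then show "(pascal_step ^^ \<gamma>) v n = 0"
    proof cases
      case 1
      then show ?thesis by (rule pascal_steps_support[OF v_support])
    next
      case 2
      define b where "b = nat n - \<gamma>"
      have b: "int b = n - int \<gamma>" using 2 by (simp add: b_def)
      have dn: "int (d - nat n) = int d - n" using 2 d sumI m by (simp add: e_def)
      have "\<not> standard_exponents \<alpha> \<beta> \<gamma> t (d - nat n) b \<gamma>"
        using 2 b dn d by (auto simp: standard_exponents_def e_def)
      moreover have s: "d - nat n + b + \<gamma> = d" using b dn by linarith
      ultimately have "g (d - nat n) b \<gamma> = 0" by (intro inverse_system_outside[OF g])
      then show ?thesis using rows[OF s] b by simp
    qed
  next
    fix n assume n: "int \<gamma> + int t \<le> n" "n < int \<gamma> + int t + int p"
    define b where "b = nat n - (t + \<gamma>)"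
    have b: "int b = n - (int \<gamma> + int t)" using n by (simp add: b_def)
    have dn: "int (d - nat n) = int d - n" using n d m by (simp add: p_def)
    have "\<not> standard_exponents \<alpha> \<beta> \<gamma> t (d - nat n) b (t + \<gamma>)" by (auto simp: standard_exponents_def)
    moreover have s: "d - nat n + b + (t + \<gamma>) = d" using b dn by linarith
    ultimately have "g (d - nat n) b (t + \<gamma>) = 0" by (intro inverse_system_outside[OF g])
    then show "(pascal_step ^^ (t + \<gamma>)) v n = 0" using rows[OF s] b by (simp add: algebra_simps)
  next
    show "e \<le> k0" by (simp add: k0_def)
    show "k0 + int p \<le> e + int m" using m by (simp add: k0_def e_def p_def)
    show "k0 \<le> int \<gamma> + int t" using m t sum by (simp add: k0_def e_def)
    show "int \<gamma> + int t \<le> k0 + int t" by (simp add: k0_def)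
  qed (use m t p_def in auto)
  then have "(-1) ^ c * g a b c = 0"
    using rows[of a b c] abc pascal_steps_of_zero[of v c] by (simp add: d_def)
  then show ?thesis by simp
qed

section \<open>A totally positive binomial matrix\<close>

text \<open>
  The entry \<open>(N + i + j) choose i\<close> counts the lattice paths that lead from place \<open>j\<close> of one arm of the punctured
  hexagon to place \<open>i\<close> of the next, where \<open>N\<close> is the side of the puncture. The rows are not truncated at
  \<open>m\<close>, which makes the passage from \<open>N\<close> to \<open>N + 1\<close> a formation of partial sums.
\<close>

definition arm_transfer :: "nat \<Rightarrow> nat \<Rightarrow> (nat \<Rightarrow> real) \<Rightarrow> nat \<Rightarrow> real" where
  "arm_transfer N m v i = (\<Sum>j<m. real ((N + i + j) choose i) * v j)"

text \<open>
  Consecutive partial sums of opposite sign differ by the sum over an interval, in which some entry has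
  the later sign; the intervals are disjoint and ordered.
\<close>

lemma alternating_interval_sums:
  fixes y z :: "nat \<Rightarrow> real"
  assumes low: "\<And>n. n < j \<Longrightarrow> z n = y n" and high: "\<And>n. j \<le> n \<Longrightarrow> z n = (\<Sum>l\<in>{j..n + \<delta>}. y l)"
    and alt: "alternating s k q z"
  shows "\<exists>q'. alternating s k q' y"
proof -
  \<comment> \<open>the new position for \<open>q i\<close> is sought between \<open>lower i\<close> and \<open>upper i\<close>\<close>
  define upper where "upper i = (if q i < j then q i else q i + \<delta>)" for i
  define lower where "lower i = (if i = 0 then 0 else Suc (upper (i - 1)))" for i
  have mono: "q i < q i'" if "i < i'" "i' < k" for i i'
    using alt that by (auto simp: alternating_def strict_mono_on_def)
  have pos: "s * (-1) ^ i * z (q i) > 0" if "i < k" for i using alt that by (simp add: alternating_def)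
  have pick: "\<exists>l\<in>A. s * (-1) ^ i * y l > 0" if "s * (-1) ^ i * (\<Sum>l\<in>A. y l) > 0" for A i
  proof (rule ccontr)
    assume "\<not> ?thesis"
    then have "(\<Sum>l\<in>A. s * (-1) ^ i * y l) \<le> 0" by (intro sum_nonpos) (auto simp: not_less)
    with that show False by (simp add: sum_distrib_left)
  qed
  have "\<exists>l. lower i \<le> l \<and> l \<le> upper i \<and> s * (-1) ^ i * y l > 0" if i: "i < k" for i
  proof (cases "q i < j")
    case True
    have "lower i \<le> q i"
      using mono[of "i - 1" i] i True by (cases i) (auto simp: lower_def upper_def)
    then show ?thesis using True pos[OF i] low by (intro exI[of _ "q i"]) (auto simp: upper_def)
  next
    case False
    show ?thesis
    proof (cases "i = 0 \<or> q (i - 1) < j")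
      case True
      then have "lower i \<le> j" by (auto simp: lower_def upper_def)
      moreover obtain l where "l \<in> {j..q i + \<delta>}" "s * (-1) ^ i * y l > 0"
        using pick[of i "{j..q i + \<delta>}"] pos[OF i] high[of "q i"] False by auto
      ultimately show ?thesis using False by (intro exI[of _ l]) (auto simp: upper_def)
    next
      case prev: False
      then obtain i' where i': "i = Suc i'" by (cases i) auto
      have lt: "q i' < q i" using mono i i' by simp
      have jq: "j \<le> q i'" using prev i' by simp
      have "{j..q i + \<delta>} = {j..q i' + \<delta>} \<union> {Suc (q i' + \<delta>)..q i + \<delta>}" using lt jq by auto
      then have "(\<Sum>l\<in>{j..q i + \<delta>}. y l) = (\<Sum>l\<in>{j..q i' + \<delta>}. y l) + (\<Sum>l\<in>{Suc (q i' + \<delta>)..q i + \<delta>}. y l)"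
        by (simp add: sum.union_disjoint)
      then have "(\<Sum>l\<in>{Suc (q i' + \<delta>)..q i + \<delta>}. y l) = z (q i) - z (q i')"
        using high[of "q i"] high[of "q i'"] jq False by simp
      moreover have "s * (-1) ^ i * (z (q i) - z (q i')) > 0"
        using pos[OF i] pos[of i'] i i' by (simp add: right_diff_distrib)
      ultimately obtain l where "l \<in> {Suc (q i' + \<delta>)..q i + \<delta>}" "s * (-1) ^ i * y l > 0"
        using pick[of i "{Suc (q i' + \<delta>)..q i + \<delta>}"] by auto
      then show ?thesis using jq False i' by (intro exI[of _ l]) (auto simp: lower_def upper_def)
    qed
  qed
  then obtain q' where q': "\<And>i. i < k \<Longrightarrow> lower i \<le> q' i \<and> q' i \<le> upper i \<and> s * (-1) ^ i * y (q' i) > 0"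
    by metis
  have upper_mono: "upper i \<le> upper i'" if "i \<le> i'" "i' < k" for i i'
    using mono[of i i'] that by (cases "i = i'") (auto simp: upper_def)
  have "q' i < q' i'" if "i < i'" "i' < k" for i i'
  proof -
    have "q' i \<le> upper i" using q' that by simp
    also have "\<dots> \<le> upper (i' - 1)" using that by (intro upper_mono) auto
    also have "\<dots> < lower i'" using that by (simp add: lower_def)
    also have "\<dots> \<le> q' i'" using q' that by simp
    finally show ?thesis .
  qed
  with q' show ?thesis by (intro exI[of _ q']) (auto simp: alternating_def strict_mono_on_def)
qed

text \<open>
  The vectors \<open>\<Psi> j\<close> interpolate between \<open>\<Psi> 0\<close>, which is the image, and \<open>\<Psi> m = v\<close>; each arises from the next one
  by forming partial sums from the position \<open>j\<close> on.
\<close>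

lemma alternating_arm_transfer_0:
  assumes v: "\<And>j. m \<le> j \<Longrightarrow> v j = 0" and alt: "alternating s k q (arm_transfer 0 m v)"
  shows "\<exists>q'. alternating s k q' v"
proof -
  define \<Psi> where "\<Psi> j n = (if n < j then v n
    else (\<Sum>i\<in>{j..<m}. real ((n - j + (i - j)) choose (n - j)) * v i))" for j n
  have start: "\<Psi> 0 = arm_transfer 0 m v"
    by (rule ext) (simp add: \<Psi>_def arm_transfer_def atLeast0LessThan)
  have stop: "\<Psi> m = v" using v by (intro ext) (simp add: \<Psi>_def)
  have rec: "\<Psi> j n = (\<Sum>l\<in>{j..n + 1}. \<Psi> (Suc j) l)" if jn: "j \<le> n" and jm: "j < m" for j n
  proof -
    have "{j..n + 1} = insert j {Suc j..n + 1}" using jn by auto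
    then have "(\<Sum>l\<in>{j..n + 1}. \<Psi> (Suc j) l) = v j + (\<Sum>l\<in>{Suc j..n + 1}. \<Psi> (Suc j) l)"
      by (simp add: \<Psi>_def)
    also have "(\<Sum>l\<in>{Suc j..n + 1}. \<Psi> (Suc j) l) = (\<Sum>x\<le>n - j. \<Psi> (Suc j) (Suc j + x))"
      using jn by (intro sum.reindex_bij_witness[of _ "\<lambda>x. Suc j + x" "\<lambda>l. l - Suc j"]) auto
    also have "\<dots> = (\<Sum>x\<le>n - j. \<Sum>i\<in>{Suc j..<m}. real ((i - Suc j + x) choose x) * v i)"
      by (intro sum.cong refl) (simp add: \<Psi>_def add.commute)
    also have "\<dots> = (\<Sum>i\<in>{Suc j..<m}. (\<Sum>x\<le>n - j. real ((i - Suc j + x) choose x)) * v i)"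
      by (subst sum.swap) (simp add: sum_distrib_right)
    also have "\<dots> = (\<Sum>i\<in>{Suc j..<m}. real ((n - j + (i - j)) choose (n - j)) * v i)"
    proof (rule sum.cong[OF refl])
      fix i assume i: "i \<in> {Suc j..<m}"
      have "(\<Sum>x\<le>n - j. (i - Suc j + x) choose x) = Suc (i - Suc j + (n - j)) choose (n - j)"
        by (rule sum_choose_lower)
      moreover have "Suc (i - Suc j + (n - j)) = n - j + (i - j)" using i by auto
      ultimately have "(\<Sum>x\<le>n - j. real ((i - Suc j + x) choose x)) = real ((n - j + (i - j)) choose (n - j))"
        by (metis of_nat_sum)
      then show "(\<Sum>x\<le>n - j. real ((i - Suc j + x) choose x)) * v i = real ((n - j + (i - j)) choose (n - j)) * v i"
        by simp
    qed
    also have "v j + \<dots> = (\<Sum>i\<in>insert j {Suc j..<m}. real ((n - j + (i - j)) choose (n - j)) * v i)"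
      by simp
    also have "insert j {Suc j..<m} = {j..<m}" using jm by auto
    finally show ?thesis using jn by (simp add: \<Psi>_def)
  qed
  have "j \<le> m \<Longrightarrow> \<exists>q'. alternating s k q' (\<Psi> j)" for j
  proof (induction j)
    case 0
    then show ?case using alt start by auto
  next
    case (Suc j)
    then obtain q' where q': "alternating s k q' (\<Psi> j)" by auto
    show ?case
    proof (rule alternating_interval_sums[OF _ _ q'])
      show "\<Psi> j n = \<Psi> (Suc j) n" if "n < j" for n using that by (simp add: \<Psi>_def)
      show "\<Psi> j n = (\<Sum>l\<in>{j..n + 1}. \<Psi> (Suc j) l)" if "j \<le> n" for n
        using that Suc.prems by (intro rec) auto
    qed
  qed
  from this[of m] show ?thesis using stop by simp
qed

lemma alternating_arm_transfer:
  assumes v: "\<And>j. m \<le> j \<Longrightarrow> v j = 0" and alt: "alternating s k q (arm_transfer N m v)"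
  shows "\<exists>q'. alternating s k q' v"
  using alt
proof (induction N arbitrary: q)
  case 0
  then show ?case by (rule alternating_arm_transfer_0[OF v, rotated])
next
  case (Suc N)
  have rec: "arm_transfer (Suc N) m v n = (\<Sum>l\<in>{0..n + 0}. arm_transfer N m v l)" for n
  proof -
    have "(\<Sum>l\<in>{0..n + 0}. arm_transfer N m v l) = (\<Sum>j<m. (\<Sum>l\<le>n. real ((N + j + l) choose l)) * v j)"
      unfolding arm_transfer_def
      by (subst sum.swap) (simp add: sum_distrib_left atLeast0AtMost ac_simps)
    also have "\<dots> = (\<Sum>j<m. real ((Suc N + n + j) choose n) * v j)"
    proof (rule sum.cong[OF refl])
      fix j
      have "(\<Sum>l\<le>n. (N + j + l) choose l) = Suc (N + j + n) choose n" by (rule sum_choose_lower)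
      moreover have "Suc (N + j + n) = Suc N + n + j" by simp
      ultimately have "(\<Sum>l\<le>n. real ((N + j + l) choose l)) = real ((Suc N + n + j) choose n)"
        by (metis of_nat_sum)
      then show "(\<Sum>l\<le>n. real ((N + j + l) choose l)) * v j = real ((Suc N + n + j) choose n) * v j"
        by simp
    qed
    finally show ?thesis by (simp add: arm_transfer_def)
  qed
  have "\<exists>q'. alternating s k q' (arm_transfer N m v)"
    by (rule alternating_interval_sums[OF _ _ Suc.prems, of 0 _ 0]) (use rec in auto)
  then show ?case using Suc.IH by blast
qed

lemma alternating_length_le:
  assumes v: "\<And>j. m \<le> j \<Longrightarrow> v j = 0" and alt: "alternating s k q (v :: nat \<Rightarrow> real)"
  shows "k \<le> m"
proof -
  have "q i < m" if "i < k" for i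
  proof (rule ccontr)
    assume "\<not> q i < m"
    then have "v (q i) = 0" by (intro v) simp
    with alt that show False by (auto simp: alternating_def)
  qed
  then have "q ` {..<k} \<subseteq> {..<m}" by auto
  moreover have "inj_on q {..<k}"
    using alt by (intro strict_mono_on_imp_inj_on) (auto simp: alternating_def)
  ultimately show ?thesis using card_inj_on_le[of q "{..<k}" "{..<m}"] by simp
qed

text \<open>
  Take an alternating sequence of maximal length in \<open>v\<close>. Shrinking the entry of \<open>v\<close> at the end of this
  sequence that is closer to \<open>e\<close> changes no sign in \<open>v\<close>, but as all entries of the matrix are positive
  it gives the entry \<open>e\<close> of the image the opposite sign. The image then alternates once more than \<open>v\<close> can.
\<close>

lemma arm_transfer_fixed_end_zero:
  assumes v: "\<And>j. m \<le> j \<Longrightarrow> v j = 0" and fix_v: "\<And>i. i < m \<Longrightarrow> arm_transfer N m v i = v i"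
    and m: "0 < m" and e: "e = 0 \<or> e = m - 1" and ve: "v e = 0"
  shows "v n = 0"
proof (rule ccontr)
  assume n: "v n \<noteq> 0"
  define L where "L k \<longleftrightarrow> (\<exists>s q. alternating s k q v)" for k
  have "L 1"
    unfolding L_def alternating_def
    by (rule exI[of _ "v n"], rule exI[of _ "\<lambda>_. n"]) (use n in \<open>auto simp: strict_mono_on_def zero_less_mult_iff linorder_neq_iff\<close>)
  moreover have "\<forall>k. L k \<longrightarrow> k \<le> m" using alternating_length_le[of m v] v by (auto simp: L_def)
  ultimately obtain k where k: "L k" "\<And>k'. L k' \<Longrightarrow> k' \<le> k"
    using Greatest_le_nat[of L _ m] GreatestI_nat[of L 1 m] by metis
  have k0: "0 < k" using k(2)[OF \<open>L 1\<close>] by simp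
  from k(1) obtain s q where alt: "alternating s k q v" by (auto simp: L_def)
  have pos: "s * (-1) ^ i * v (q i) > 0" if "i < k" for i using alt that by (simp add: alternating_def)
  have mono: "q i < q i'" if "i < i'" "i' < k" for i i'
    using alt that by (auto simp: alternating_def strict_mono_on_def)
  have qm: "q i < m" "q i \<noteq> e" if "i < k" for i
  proof -
    have nz: "v (q i) \<noteq> 0" using pos[OF that] by auto
    then show "q i \<noteq> e" using ve by auto
    show "q i < m" using nz v[of "q i"] by (cases "q i < m") auto
  qed
  define x where "x = (if e = 0 then q 0 else q (k - 1))"
  have xm: "x < m" using qm k0 by (auto simp: x_def)
  obtain \<delta> where \<delta>: "\<delta> > 0"
    "\<forall>i\<in>{..<m}. v i \<noteq> 0 \<longrightarrow> \<delta> * \<bar>v x * real ((N + i + x) choose i)\<bar> < \<bar>v i\<bar>"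
    using small_perturbation[of "{..<m}" v "\<lambda>i. v x * real ((N + i + x) choose i)"] by auto
  define \<eta> where "\<eta> = min \<delta> (1/2)"
  have \<eta>: "0 < \<eta>" "\<eta> < 1" "\<eta> \<le> \<delta>" using \<delta> by (auto simp: \<eta>_def)
  define y where "y = v(x := (1 - \<eta>) * v x)"
  have By: "arm_transfer N m y i = v i - \<eta> * (v x * real ((N + i + x) choose i))" if "i < m" for i
  proof -
    have "y j = v j - (if j = x then \<eta> * v x else 0)" for j by (simp add: y_def algebra_simps)
    then have "arm_transfer N m y i = arm_transfer N m v i
        - (\<Sum>j<m. real ((N + i + j) choose i) * (if j = x then \<eta> * v x else 0))"
      by (simp add: arm_transfer_def right_diff_distrib sum_subtractf)
    also have "(\<Sum>j<m. real ((N + i + j) choose i) * (if j = x then \<eta> * v x else 0))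
        = real ((N + i + x) choose i) * (\<eta> * v x)"
      using xm by (simp add: if_distrib cong: if_cong)
    finally show ?thesis using fix_v[OF that] by simp
  qed
  have keep: "s * (-1) ^ i * arm_transfer N m y (q i) > 0" if i: "i < k" for i
  proof -
    let ?u = "v x * real ((N + q i + x) choose q i)"
    have "\<eta> * \<bar>?u\<bar> \<le> \<delta> * \<bar>?u\<bar>" using \<eta> by (intro mult_right_mono) auto
    also have "\<dots> < \<bar>v (q i)\<bar>" using \<delta>(2)[rule_format, of "q i"] qm[OF i] pos[OF i] by force
    finally have "\<bar>\<eta> * ?u\<bar> < \<bar>v (q i)\<bar>" using \<eta> by (simp add: abs_mult)
    then have "v (q i) * (v (q i) - \<eta> * ?u) > 0"
      by (cases "v (q i) > 0") (auto simp: zero_less_mult_iff)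
    then have "v (q i) * arm_transfer N m y (q i) > 0" using By[OF qm(1)[OF i]] by simp
    then show ?thesis using pos[OF i] by (auto simp: zero_less_mult_iff)
  qed
  have em: "e < m" using e m by auto
  have "N + e + x \<ge> e" by simp
  then have "real ((N + e + x) choose e) > 0" by (simp add: zero_less_binomial)
  then have new: "- (v x * arm_transfer N m y e) > 0"
    using By[OF em] ve \<eta> pos[of 0] pos[of "k - 1"] k0 by (auto simp: x_def zero_less_mult_iff mult_less_0_iff)
  have "\<exists>s' q'. alternating s' (Suc k) q' (arm_transfer N m y)"
  proof (cases "e = 0")
    case True
    define q' where "q' i = (case i of 0 \<Rightarrow> 0 | Suc i \<Rightarrow> q i)" for i
    have "alternating (- s) (Suc k) q' (arm_transfer N m y)"
      unfolding alternating_def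
    proof (intro conjI allI impI strict_mono_onI)
      fix i j assume ij: "i \<in> {..<Suc k}" "j \<in> {..<Suc k}" "i < j"
      then obtain j' where j': "j = Suc j'" "j' < k" by (cases j) auto
      have "0 < q j'" using qm(2)[OF j'(2)] True by simp
      then show "q' i < q' j" using j' ij mono by (auto simp: q'_def split: nat.split)
    next
      fix i assume i: "i < Suc k"
      show "- s * (- 1) ^ i * arm_transfer N m y (q' i) > 0"
      proof (cases i)
        case 0
        have "s * v x > 0" using pos[of 0] k0 True by (simp add: x_def)
        with new True have "- s * arm_transfer N m y 0 > 0"
          by (auto simp: zero_less_mult_iff mult_less_0_iff)
        then show ?thesis using 0 by (simp add: q'_def)
      next
        case (Suc i')
        then show ?thesis using keep[of i'] i by (simp add: q'_def)
      qed
    qed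
    then show ?thesis by blast
  next
    case False
    then have e: "e = m - 1" using e by simp
    have "alternating s (Suc k) (q(k := e)) (arm_transfer N m y)"
      unfolding alternating_def
    proof (intro conjI allI impI strict_mono_onI)
      fix i j assume ij: "i \<in> {..<Suc k}" "j \<in> {..<Suc k}" "i < j"
      then have "i < k" by auto
      then have "q i < e" using qm[of i] e by auto
      then show "(q(k := e)) i < (q(k := e)) j" using ij mono \<open>i < k\<close> by auto
    next
      fix i assume i: "i < Suc k"
      show "s * (- 1) ^ i * arm_transfer N m y ((q(k := e)) i) > 0"
      proof (cases "i = k")
        case True
        obtain k' where k': "k = Suc k'" using k0 by (cases k) auto
        have "s * (-1) ^ k' * v x > 0" using pos[of k'] k' \<open>e \<noteq> 0\<close> by (simp add: x_def)
        with new have "- (s * (-1) ^ k' * arm_transfer N m y e) > 0"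
          by (auto simp: zero_less_mult_iff mult_less_0_iff)
        then show ?thesis using True k' by simp
      next
        case False
        then show ?thesis using keep[of i] i by simp
      qed
    qed
    then show ?thesis by blast
  qed
  then obtain s' q' where "alternating s' (Suc k) q' (arm_transfer N m y)" by blast
  moreover have "y j = 0" if "m \<le> j" for j using that v xm by (auto simp: y_def)
  ultimately obtain q'' where q'': "alternating s' (Suc k) q'' y"
    using alternating_arm_transfer[of m y] by blast
  have "s' * (-1) ^ i * v j > 0" if "s' * (-1) ^ i * y j > 0" for i j
  proof (cases "j = x")
    case True
    then have "(1 - \<eta>) * (s' * (-1) ^ i * v j) > 0" using that by (simp add: y_def mult_ac)
    then show ?thesis using \<eta> by (simp add: zero_less_mult_iff)
  qed (use that in \<open>simp add: y_def\<close>)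
  then have "L (Suc k)" using q'' unfolding L_def alternating_def by blast
  then show False using k(2) by fastforce
qed

section \<open>Fixed vectors of the binomial matrix\<close>

text \<open>
  For \<open>x = T v - v\<close> the hypothesis reads \<open>T (T x) + T x + x = 0\<close>. Pairing with \<open>x\<close> and using that \<open>T\<close> is
  self-adjoint for the weight \<open>\<omega>\<close> gives a sum of values of the positive definite form
  \<open>y\<^sup>2 + x y + x\<^sup>2\<close>.
\<close>

lemma symmetrizable_cube_fixed_imp_fixed:
  fixes b :: "nat \<Rightarrow> nat \<Rightarrow> real" and \<omega> v :: "nat \<Rightarrow> real" and m :: nat
  defines "T \<equiv> \<lambda>v i. \<Sum>j<m. b i j * v j"
  assumes sym: "\<And>i j. \<omega> i * b i j = \<omega> j * b j i" and \<omega>: "\<And>i. \<omega> i > 0"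
    and cube: "\<And>i. i < m \<Longrightarrow> T (T (T v)) i = v i" and i: "i < m"
  shows "T v i = v i"
proof -
  define x where "x j = T v j - v j" for j
  define y where "y = T x"
  have T_diff: "T (\<lambda>j. u j - u' j) k = T u k - T u' k" for u u' k
    by (simp add: T_def right_diff_distrib sum_subtractf)
  have y: "y k = T (T v) k - T v k" for k
    unfolding y_def x_def[abs_def] by (rule T_diff)
  have Ty: "T y k = T (T (T v)) k - T (T v) k" for k
    unfolding y[abs_def] by (rule T_diff)
  have sum0: "T y k + y k + x k = 0" if "k < m" for k
    using cube[OF that] by (simp add: Ty y x_def)
  have adj: "(\<Sum>k<m. \<omega> k * x k * T y k) = (\<Sum>k<m. \<omega> k * y k * y k)"
  proof -
    have "(\<Sum>k<m. \<omega> k * x k * T y k) = (\<Sum>k<m. \<Sum>j<m. \<omega> k * b k j * x k * y j)"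
      by (simp add: T_def sum_distrib_left mult_ac)
    also have "\<dots> = (\<Sum>k<m. \<Sum>j<m. \<omega> j * b j k * x k * y j)"
      by (simp only: sym)
    also have "\<dots> = (\<Sum>j<m. \<omega> j * y j * T x j)"
      by (subst sum.swap) (simp add: T_def sum_distrib_left mult_ac)
    finally show ?thesis by (simp add: y_def)
  qed
  have "0 = (\<Sum>k<m. \<omega> k * x k * (T y k + y k + x k))"
    using sum0 by simp
  also have "\<dots> = (\<Sum>k<m. \<omega> k * (y k * y k + x k * y k + x k * x k))"
    using adj by (simp add: distrib_left sum.distrib mult_ac)
  finally have tot: "(\<Sum>k<m. \<omega> k * (y k * y k + x k * y k + x k * x k)) = 0" by simp
  have quad: "a * a + c * a + c * c \<ge> 3/4 * (c * c)" for a c :: real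
  proof -
    have "a * a + c * a + c * c = (a + c / 2)\<^sup>2 + 3/4 * (c * c)"
      by (simp add: power2_eq_square algebra_simps)
    then show ?thesis by simp
  qed
  have nonneg: "\<omega> k * (y k * y k + x k * y k + x k * x k) \<ge> 0" for k
  proof (rule mult_nonneg_nonneg)
    have "0 \<le> 3/4 * (x k * x k)" by simp
    also have "\<dots> \<le> y k * y k + x k * y k + x k * x k" by (rule quad)
    finally show "0 \<le> y k * y k + x k * y k + x k * x k" .
  qed (use \<omega> less_imp_le in blast)
  have "\<omega> i * (y i * y i + x i * y i + x i * x i) = 0"
    using tot nonneg i by (subst (asm) sum_nonneg_eq_0_iff) auto
  then have "y i * y i + x i * y i + x i * x i = 0" using \<omega>[of i] by simp
  then have "x i * x i \<le> 0" using quad[of "x i" "y i"] by simp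
  then have "x i * x i = 0" using zero_le_square[of "x i"] by linarith
  then have "x i = 0" by simp
  then show ?thesis by (simp add: x_def)
qed

text \<open>
  With the weight \<open>i! / (N + i)!\<close> the matrix becomes \<open>(N + i + j)! / ((N + i)! (N + j)!)\<close>, which is
  symmetric.
\<close>

lemma arm_transfer_cube_fixed:
  assumes cube: "\<And>i. i < m \<Longrightarrow> arm_transfer N m (arm_transfer N m (arm_transfer N m v)) i = v i"
    and i: "i < m"
  shows "arm_transfer N m v i = v i"
proof -
  define b where "b i j = real ((N + i + j) choose i)" for i j
  define \<omega> :: "nat \<Rightarrow> real" where "\<omega> i = fact i / fact (N + i)" for i
  have step: "arm_transfer N m = (\<lambda>v i. \<Sum>j<m. b i j * v j)"
    by (intro ext) (simp add: arm_transfer_def b_def)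
  have b: "\<omega> i * b i j = fact (N + i + j) / (fact (N + i) * fact (N + j))" for i j
  proof -
    have "real ((N + i + j) choose i) = fact (N + i + j) / (fact i * fact (N + i + j - i))"
      by (rule binomial_fact) simp
    moreover have "N + i + j - i = N + j" by simp
    ultimately show ?thesis by (simp add: \<omega>_def b_def)
  qed
  show ?thesis
    unfolding step
  proof (rule symmetrizable_cube_fixed_imp_fixed[of \<omega>])
    show "\<omega> i * b i j = \<omega> j * b j i" for i j by (simp add: b add_ac mult_ac)
    show "\<omega> i > 0" for i by (simp add: \<omega>_def)
  qed (use cube i step in auto)
qed

lemma alternating_binomial_sum_Suc:
  fixes f :: "nat \<Rightarrow> real"
  shows "(\<Sum>k\<le>Suc j. (-1) ^ k * real (Suc j choose k) * f k) = (\<Sum>k\<le>j. (-1) ^ k * real (j choose k) * (f k - f (Suc k)))"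
proof -
  have shift: "(\<Sum>k\<le>Suc j. (-1) ^ k * real (j choose k) * f k)
      = f 0 + (\<Sum>k\<le>j. (-1) ^ Suc k * real (j choose Suc k) * f (Suc k))"
    by (subst sum.atMost_Suc_shift) simp
  have "(\<Sum>k\<le>Suc j. (-1) ^ k * real (Suc j choose k) * f k)
      = f 0 + (\<Sum>k\<le>j. (-1) ^ Suc k * real (Suc j choose Suc k) * f (Suc k))"
    by (subst sum.atMost_Suc_shift) simp
  also have "(\<Sum>k\<le>j. (-1) ^ Suc k * real (Suc j choose Suc k) * f (Suc k))
      = (\<Sum>k\<le>j. (-1) ^ Suc k * real (j choose k) * f (Suc k))
        + (\<Sum>k\<le>j. (-1) ^ Suc k * real (j choose Suc k) * f (Suc k))"
    by (simp add: algebra_simps flip: sum.distrib)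
  also have "f 0 + (\<dots>) = (\<Sum>k\<le>j. (-1) ^ Suc k * real (j choose k) * f (Suc k))
      + (\<Sum>k\<le>Suc j. (-1) ^ k * real (j choose k) * f k)"
    by (simp only: shift add_ac)
  also have "(\<Sum>k\<le>Suc j. (-1) ^ k * real (j choose k) * f k) = (\<Sum>k\<le>j. (-1) ^ k * real (j choose k) * f k)"
    by (simp add: binomial_eq_0)
  finally show ?thesis by (simp add: algebra_simps flip: sum.distrib)
qed

lemma alternating_binomial_sum_shifted:
  "(\<Sum>k\<le>j. (-1) ^ k * real (j choose k) * real ((N + k) choose i))
    = (if j \<le> i then (-1) ^ j * real (N choose (i - j)) else 0)"
proof (induction j arbitrary: N)
  case (Suc j)
  have "(\<Sum>k\<le>Suc j. (-1) ^ k * real (Suc j choose k) * real ((N + k) choose i))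
      = (\<Sum>k\<le>j. (-1) ^ k * real (j choose k) * real ((N + k) choose i))
        - (\<Sum>k\<le>j. (-1) ^ k * real (j choose k) * real ((Suc N + k) choose i))"
    unfolding alternating_binomial_sum_Suc by (simp add: right_diff_distrib sum_subtractf)
  also have "\<dots> = (if Suc j \<le> i then (-1) ^ Suc j * real (N choose (i - Suc j)) else 0)"
  proof (cases "j < i")
    case True
    then have "i - j = Suc (i - Suc j)" by simp
    then show ?thesis unfolding Suc.IH using True by (simp add: algebra_simps)
  next
    case False
    then show ?thesis unfolding Suc.IH by (cases "j = i") auto
  qed
  finally show ?case .
qed simp

text \<open>
  By negating the upper index of the second binomial coefficient this becomes Vandermonde's
  identity.
\<close>

lemma alternating_binomial_convolution:
  "(\<Sum>k\<le>i. (-1) ^ k * real ((N + i) choose (i - k)) * real ((N + k + j) choose k)) = (-1) ^ i * real (j choose i)"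
proof -
  have "(\<Sum>k\<le>i. (-1) ^ k * real ((N + i) choose (i - k)) * real ((N + k + j) choose k))
      = (\<Sum>k\<le>i. ((- (real (N + j) + 1)) gchoose k) * (real (N + i) gchoose (i - k)))"
  proof (rule sum.cong[OF refl])
    fix k
    have "(- (real (N + j) + 1)) gchoose k = (-1) ^ k * ((real (N + j) + 1 + real k - 1) gchoose k)"
      by (rule gbinomial_minus)
    also have "real (N + j) + 1 + real k - 1 = real (N + k + j)" by simp
    finally show "(-1) ^ k * real ((N + i) choose (i - k)) * real ((N + k + j) choose k)
        = ((- (real (N + j) + 1)) gchoose k) * (real (N + i) gchoose (i - k))"
      by (simp add: binomial_gbinomial)
  qed
  also have "\<dots> = (- (real (N + j) + 1) + real (N + i)) gchoose i"
    by (rule gbinomial_Vandermonde[unfolded atLeast0AtMost])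
  also have "- (real (N + j) + 1) + real (N + i) = - (real j - real i + 1)" by simp
  also have "(- (real j - real i + 1)) gchoose i = (-1) ^ i * ((real j - real i + 1 + real i - 1) gchoose i)"
    by (rule gbinomial_minus)
  also have "real j - real i + 1 + real i - 1 = real j" by simp
  finally show ?thesis by (simp add: binomial_gbinomial)
qed

text \<open>
  On coefficient vectors of polynomials of degree less than \<open>m\<close> this is the substitution of \<open>1 - x\<close> for \<open>x\<close>.
  Up to sign it carries an arm of the hexagon to an arm of its mirror image.
\<close>

definition reflection :: "nat \<Rightarrow> (nat \<Rightarrow> real) \<Rightarrow> nat \<Rightarrow> real" where
  "reflection m v i = (\<Sum>k<m. (-1) ^ i * real (k choose i) * v k)"

text \<open>
  If \<open>B\<close> is the matrix of \<open>arm_transfer\<close> and \<open>J\<close> that of \<open>reflection\<close>, then \<open>B J = K\<close> and \<open>K B = J\<close> for the lower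
  triangular matrix \<open>K\<close> with entries \<open>(-1)\<^sup>j ((N + i) choose (i - j))\<close>. Hence \<open>B J v = K v = K B v = J v\<close>
  when \<open>B v = v\<close>.
\<close>

lemma arm_transfer_reflection:
  assumes fix_v: "\<And>i. i < m \<Longrightarrow> arm_transfer N m v i = v i" and i: "i < m"
  shows "arm_transfer N m (reflection m v) i = reflection m v i"
proof -
  define K where "K u = (\<Sum>k\<le>i. (-1) ^ k * real ((N + i) choose (i - k)) * u k)" for u :: "nat \<Rightarrow> real"
  have "arm_transfer N m (reflection m v) i
      = (\<Sum>j<m. (\<Sum>k<m. (-1) ^ k * real (j choose k) * real ((N + i + k) choose i)) * v j)"
    unfolding arm_transfer_def reflection_def sum_distrib_left
    by (subst sum.swap) (simp add: sum_distrib_left mult_ac)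
  also have "\<dots> = (\<Sum>j<m. (if j \<le> i then (-1) ^ j * real ((N + i) choose (i - j)) else 0) * v j)"
  proof (rule sum.cong[OF refl])
    fix j assume "j \<in> {..<m}"
    then have "(\<Sum>k<m. (-1) ^ k * real (j choose k) * real ((N + i + k) choose i))
        = (\<Sum>k\<le>j. (-1) ^ k * real (j choose k) * real ((N + i + k) choose i))"
      by (intro sum.mono_neutral_right) (auto simp: binomial_eq_0)
    then show "(\<Sum>k<m. (-1) ^ k * real (j choose k) * real ((N + i + k) choose i)) * v j
        = (if j \<le> i then (-1) ^ j * real ((N + i) choose (i - j)) else 0) * v j"
      by (simp only: alternating_binomial_sum_shifted)
  qed
  also have "\<dots> = (\<Sum>j\<le>i. (if j \<le> i then (-1) ^ j * real ((N + i) choose (i - j)) else 0) * v j)"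
    using i by (intro sum.mono_neutral_right) auto
  also have "\<dots> = K v" by (simp add: K_def)
  also have "\<dots> = K (arm_transfer N m v)" using fix_v i by (simp add: K_def)
  also have "\<dots> = (\<Sum>j<m. (\<Sum>k\<le>i. (-1) ^ k * real ((N + i) choose (i - k)) * real ((N + k + j) choose k)) * v j)"
    unfolding K_def arm_transfer_def sum_distrib_left
    by (subst sum.swap) (simp add: sum_distrib_left mult_ac)
  also have "\<dots> = reflection m v i"
    unfolding alternating_binomial_convolution reflection_def ..
  finally show ?thesis .
qed

text \<open>
  The first entries of \<open>J v\<close> and \<open>B v\<close> are both the sum of all entries of \<open>v\<close>. So \<open>v - J v\<close> is a fixed vector
  with first entry zero, and \<open>v = J v\<close>. As \<open>J\<close> is upper triangular with last diagonal entry
  \<open>(-1)\<^sup>m\<^sup>-\<^sup>1 = -1\<close>, the last entry of \<open>v\<close> is zero.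
\<close>

theorem arm_transfer_fixed_even:
  assumes fix_v: "\<And>i. i < m \<Longrightarrow> arm_transfer N m v i = v i" and m: "even m" "i < m"
  shows "v i = 0"
proof -
  have cong: "arm_transfer N m u = arm_transfer N m u'" if "\<And>j. j < m \<Longrightarrow> u j = u' j" for u u'
    using that by (intro ext) (auto simp: arm_transfer_def)
  have m0: "0 < m" using m by simp
  define y where "y j = (if j < m then v j - reflection m v j else 0)" for j
  have By: "arm_transfer N m y j = y j" if j: "j < m" for j
  proof -
    have "arm_transfer N m y j = arm_transfer N m (\<lambda>j. v j - reflection m v j) j"
      using cong[of y "\<lambda>j. v j - reflection m v j"] by (simp add: y_def)
    also have "\<dots> = arm_transfer N m v j - arm_transfer N m (reflection m v) j"
      by (simp add: arm_transfer_def right_diff_distrib sum_subtractf)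
    finally show ?thesis
      using fix_v[OF j] arm_transfer_reflection[OF fix_v j] j by (simp add: y_def)
  qed
  have "reflection m v 0 = arm_transfer N m v 0" by (simp add: reflection_def arm_transfer_def)
  then have "y 0 = 0" using fix_v[OF m0] m0 by (simp add: y_def)
  have "y j = 0" for j
    by (rule arm_transfer_fixed_end_zero[of m y N 0]) (use By m0 \<open>y 0 = 0\<close> in \<open>auto simp: y_def\<close>)
  then have sym: "v j = reflection m v j" if "j < m" for j
    using that by (metis (no_types) y_def right_minus_eq)
  have "reflection m v (m - 1) = (\<Sum>k\<in>{m - 1}. (-1) ^ (m - 1) * real (k choose (m - 1)) * v k)"
    unfolding reflection_def using m0 by (intro sum.mono_neutral_right) (auto simp: binomial_eq_0)
  also have "\<dots> = - v (m - 1)" using m m0 by simp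
  finally have end0: "v (m - 1) = 0" using sym[of "m - 1"] m0 by simp
  define u where "u j = (if j < m then v j else 0)" for j
  have "u i = 0"
  proof (rule arm_transfer_fixed_end_zero[of m u N "m - 1"])
    show "arm_transfer N m u j = u j" if "j < m" for j
      using cong[of u v] fix_v[OF that] that by (simp add: u_def)
  qed (use m0 end0 in \<open>auto simp: u_def\<close>)
  then show ?thesis using m by (simp add: u_def)
qed

section \<open>Turning around the puncture\<close>

text \<open>
  The number of lattice paths from place \<open>j\<close> of the arm on the line \<open>a = m\<close> to the point with \<open>a = m - 1 - i\<close> at
  height \<open>c\<close> above the puncture's lower side, with the sign that the relation attaches to each step.
\<close>

definition windmill_coeff :: "nat \<Rightarrow> nat \<Rightarrow> nat \<Rightarrow> nat \<Rightarrow> real" where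
  "windmill_coeff N i c j = (if c \<le> N + j
     then (-1) ^ Suc (i + (N + j - c)) * real ((i + (N + j - c)) choose i) else 0)"

lemma windmill_coeff_0:
  "windmill_coeff N 0 c j = - (if N + j = c then 1 else 0) - windmill_coeff N 0 (Suc c) j"
proof (cases "Suc c \<le> N + j")
  case True
  then have "N + j - c = Suc (N + j - Suc c)" by simp
  then show ?thesis using True by (simp add: windmill_coeff_def)
qed (auto simp: windmill_coeff_def)

lemma windmill_coeff_Suc:
  "windmill_coeff N (Suc i) c j = - windmill_coeff N i c j - windmill_coeff N (Suc i) (Suc c) j"
proof (cases "Suc c \<le> N + j")
  case True
  then have "N + j - c = Suc (N + j - Suc c)" by simp
  then show ?thesis using True by (simp add: windmill_coeff_def algebra_simps)
qed (auto simp: windmill_coeff_def)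

text \<open>
  The region \<open>a < m \<le> c\<close> is bounded by the puncture, by one arm on the line \<open>a = m\<close>, and by the line \<open>c = m + t\<close>,
  on which \<open>g\<close> is zero. The relation, solved for the term with the largest second coordinate,
  propagates these boundary values into the region: over \<open>i\<close> upwards and over \<open>c\<close> downwards.
\<close>

lemma windmill_region:
  fixes g :: "nat \<Rightarrow> nat \<Rightarrow> nat \<Rightarrow> real"
  assumes g: "inverse_system m m m t (2 * m + t - 1) 1 1 1 g" and t: "m \<le> t"
    and i: "i < m" and c: "c \<le> t"
  shows "g (m - 1 - i) (t + i - c) (m + c) =
    (\<Sum>j<m. windmill_coeff (t - m) i c j * g m (m - 1 - j) (t + j))"
  using i c
proof (induction i arbitrary: c)
  case (0 c)
  from 0(2) show ?case
  proof (induction c rule: inc_induct)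
    case base
    have "g (m - 1) 0 (m + t) = 0"
      using 0 by (intro inverse_system_outside[OF g]) (auto simp: standard_exponents_def)
    moreover have "windmill_coeff (t - m) 0 t j = 0" if "j < m" for j
      using that t by (simp add: windmill_coeff_def)
    ultimately show ?case by simp
  next
    case (step c)
    have "g (Suc (m - 1)) (t - Suc c) (m + c) + g (m - 1) (Suc (t - Suc c)) (m + c)
        + g (m - 1) (t - Suc c) (Suc (m + c)) = 0"
      using inverse_system_relation[OF g, of "m - 1" "t - Suc c" "m + c"] step 0 by simp
    moreover have "Suc (t - Suc c) = t - c" "Suc (m - 1) = m" using step 0 by auto
    ultimately have eq: "g (m - 1) (t - c) (m + c) = - g m (t - Suc c) (m + c) - g (m - 1) (t - Suc c) (m + Suc c)"
      by simp
    have first: "g m (t - Suc c) (m + c)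
        = (\<Sum>j<m. (if t - m + j = c then 1 else 0) * g m (m - 1 - j) (t + j))"
    proof (cases "t - m \<le> c")
      case True
      define k where "k = c - (t - m)"
      have k: "k < m" "t - Suc c = m - 1 - k" "m + c = t + k" using True t step by (auto simp: k_def)
      have "(t - m + j = c) = (j = k)" for j using True by (auto simp: k_def)
      then show ?thesis using k by (simp add: if_distrib[of "\<lambda>x. x * _"] cong: if_cong)
    next
      case False
      then have "g m (t - Suc c) (m + c) = 0"
        using step 0 t by (intro inverse_system_outside[OF g]) (auto simp: standard_exponents_def)
      moreover have "t - m + j \<noteq> c" for j using False by simp
      ultimately show ?thesis by simp
    qed
    show ?case
      using eq first step.IH 0
      by (simp add: windmill_coeff_0[of "t - m" c] left_diff_distrib sum_subtractf sum_negf)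
  qed
next
  case (Suc i)
  from Suc.prems(2) show ?case
  proof (induction c rule: inc_induct)
    case base
    have "g (m - 1 - Suc i) (t + Suc i - t) (m + t) = 0"
      using Suc.prems t by (intro inverse_system_outside[OF g]) (auto simp: standard_exponents_def)
    moreover have "windmill_coeff (t - m) (Suc i) t j = 0" if "j < m" for j
      using that t by (simp add: windmill_coeff_def)
    ultimately show ?case by simp
  next
    case (step c)
    have "g (Suc (m - 1 - Suc i)) (t + i - c) (m + c) + g (m - 1 - Suc i) (Suc (t + i - c)) (m + c)
        + g (m - 1 - Suc i) (t + i - c) (Suc (m + c)) = 0"
      using inverse_system_relation[OF g, of "m - 1 - Suc i" "t + i - c" "m + c"] step Suc.prems by simp
    moreover have "m - 1 - i = Suc (m - 1 - Suc i)" "t + Suc i - c = Suc (t + i - c)"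
      "t + Suc i - Suc c = t + i - c" "m + Suc c = Suc (m + c)"
      using step Suc.prems by auto
    ultimately have eq: "g (m - 1 - Suc i) (t + Suc i - c) (m + c)
        = - g (m - 1 - i) (t + i - c) (m + c) - g (m - 1 - Suc i) (t + Suc i - Suc c) (m + Suc c)"
      by (simp only:)
    have "g (m - 1 - i) (t + i - c) (m + c) = (\<Sum>j<m. windmill_coeff (t - m) i c j * g m (m - 1 - j) (t + j))"
      using Suc.IH[of c] Suc.prems step by simp
    then show ?case
      using eq step.IH
      by (simp add: windmill_coeff_Suc[of "t - m" i c] left_diff_distrib sum_subtractf sum_negf)
  qed
qed

definition rotate :: "(nat \<Rightarrow> nat \<Rightarrow> nat \<Rightarrow> 'a) \<Rightarrow> nat \<Rightarrow> nat \<Rightarrow> nat \<Rightarrow> 'a" where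
  "rotate g a b c = g c a b"

lemma inverse_system_rotate:
  assumes "inverse_system m m m t d 1 1 1 g"
  shows "inverse_system m m m t d 1 1 1 (rotate g)"
  unfolding inverse_system_def
proof (intro conjI allI impI)
  fix a b c assume "a + b + c = d \<and> \<not> standard_exponents m m m t a b c"
  then show "rotate g a b c = 0"
    unfolding rotate_def by (intro inverse_system_outside[OF assms]) (auto simp: standard_exponents_def)
next
  fix a b c assume "Suc (a + b + c) = d"
  then show "1 * rotate g (Suc a) b c + 1 * rotate g a (Suc b) c + 1 * rotate g a b (Suc c) = 0"
    using inverse_system_relation[OF assms, of c a b] by (simp add: rotate_def ac_simps)
qed

text \<open>
  The values of \<open>g\<close> on the line \<open>c = m\<close> next to the puncture, read away from it; the signs are chosen to turn the
  coefficients of \<open>windmill_region\<close> into positive ones when the puncture has odd side.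
\<close>

definition arm :: "nat \<Rightarrow> nat \<Rightarrow> (nat \<Rightarrow> nat \<Rightarrow> nat \<Rightarrow> real) \<Rightarrow> nat \<Rightarrow> real" where
  "arm m t g i = (-1) ^ i * g (m - 1 - i) (t + i) m"

lemma arm_eq_arm_transfer:
  assumes g: "inverse_system m m m t (2 * m + t - 1) 1 1 1 g" and t: "m \<le> t" "odd (t - m)" and i: "i < m"
  shows "arm m t g i = arm_transfer (t - m) m (arm m t (rotate g)) i"
proof -
  have "g (m - 1 - i) (t + i) m = (\<Sum>j<m. windmill_coeff (t - m) i 0 j * g m (m - 1 - j) (t + j))"
    using windmill_region[OF g t(1) i, of 0] by simp
  then have "arm m t g i = (\<Sum>j<m. (-1) ^ i * (windmill_coeff (t - m) i 0 j * g m (m - 1 - j) (t + j)))"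
    by (simp add: arm_def sum_distrib_left)
  also have "\<dots> = (\<Sum>j<m. real ((t - m + i + j) choose i) * arm m t (rotate g) j)"
  proof (rule sum.cong[OF refl])
    fix j
    have sgn: "(-1::real) ^ i * (-1) ^ Suc (i + (t - m + j)) = (-1) ^ j"
      using t(2) by (auto simp: power_add uminus_power_if)
    have shift: "i + (t - m + j) = t - m + i + j" by simp
    have "(-1) ^ i * (windmill_coeff (t - m) i 0 j * g m (m - 1 - j) (t + j))
        = ((-1) ^ i * (-1) ^ Suc (i + (t - m + j))) * (real ((i + (t - m + j)) choose i) * g m (m - 1 - j) (t + j))"
      by (simp only: windmill_coeff_def le0 if_True diff_zero mult_ac)
    then show "(-1) ^ i * (windmill_coeff (t - m) i 0 j * g m (m - 1 - j) (t + j))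
        = real ((t - m + i + j) choose i) * arm m t (rotate g) j"
      unfolding sgn by (simp only: shift arm_def rotate_def mult_ac)
  qed
  finally show ?thesis by (simp add: arm_transfer_def)
qed

text \<open>
  Three rotations are the identity, so the arm is fixed by the third power of \<open>arm_transfer\<close>.
\<close>

lemma arm_eq_0:
  assumes g: "inverse_system m m m t (2 * m + t - 1) 1 1 1 g" and t: "m \<le> t" "odd (t - m)"
    and m: "even m" "i < m"
  shows "arm m t g i = 0"
proof -
  let ?B = "arm_transfer (t - m) m"
  have cong: "?B u = ?B u'" if "\<And>j. j < m \<Longrightarrow> u j = u' j" for u u'
    using that by (intro ext) (auto simp: arm_transfer_def)
  note g1 = inverse_system_rotate[OF g]
  note g2 = inverse_system_rotate[OF g1]
  have r: "rotate (rotate (rotate g)) = g" by (intro ext) (simp add: rotate_def)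
  have e2: "?B (arm m t g) = ?B (?B (arm m t (rotate g)))"
    by (rule cong) (rule arm_eq_arm_transfer[OF g t])
  have e1: "?B (arm m t (rotate g)) = ?B (?B (arm m t (rotate (rotate g))))"
    by (rule cong) (rule arm_eq_arm_transfer[OF g1 t])
  have e0: "?B (arm m t (rotate (rotate g))) = ?B (?B (arm m t g))"
    by (rule cong) (use arm_eq_arm_transfer[OF g2 t] r in simp)
  have cube: "?B (?B (?B (arm m t g))) j = arm m t g j" if "j < m" for j
    using arm_eq_arm_transfer[OF g t that] e1 e0 by simp
  have "?B (arm m t g) j = arm m t g j" if "j < m" for j
    by (rule arm_transfer_cube_fixed[OF cube that])
  then show ?thesis by (rule arm_transfer_fixed_even[OF _ m])
qed

text \<open>
  The three rotated copies of the region \<open>a < m \<le> c\<close> cover everything outside the puncture, and \<open>g\<close> is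
  determined on each of them by an arm, which vanishes.
\<close>

theorem inverse_system_odd_puncture:
  assumes g: "inverse_system m m m t (2 * m + t - 1) 1 1 1 g" and t: "m \<le> t" "odd (t - m)"
    and m: "0 < m" "even m" and abc: "a + b + c = 2 * m + t - 1"
  shows "g a b c = (0 :: real)"
proof -
  have region: "g a b c = 0" if g: "inverse_system m m m t (2 * m + t - 1) 1 1 1 g"
    and abc: "a + b + c = 2 * m + t - 1" and ac: "a < m" "m \<le> c"
    for g :: "nat \<Rightarrow> nat \<Rightarrow> nat \<Rightarrow> real" and a b c
  proof (cases "c < m + t")
    case True
    define i where "i = m - 1 - a"
    define x where "x = c - m"
    have *: "i < m" "x \<le> t" "a = m - 1 - i" "c = m + x" "b = t + i - x"
      using ac abc True by (auto simp: i_def x_def)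
    have "g m (m - 1 - j) (t + j) = 0" if "j < m" for j
      using arm_eq_0[OF inverse_system_rotate[OF g] t m(2) that] by (simp add: arm_def rotate_def)
    then show ?thesis unfolding *(3-5) windmill_region[OF g t(1) *(1,2)] by simp
  next
    case False
    then show ?thesis using abc by (intro inverse_system_outside[OF g]) (auto simp: standard_exponents_def)
  qed
  note g1 = inverse_system_rotate[OF g]
  note g2 = inverse_system_rotate[OF g1]
  consider "a < m" "m \<le> c" | "b < m" "m \<le> a" | "c < m" "m \<le> b" | "m \<le> a" "m \<le> b" "m \<le> c"
    using abc t m by linarith
  then show ?thesis
  proof cases
    case 1
    then show ?thesis by (rule region[OF g abc])
  next
    case 2
    have "rotate g b c a = 0" by (rule region[OF g1]) (use 2 abc in auto)
    then show ?thesis by (simp add: rotate_def)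
  next
    case 3
    have "rotate (rotate g) c a b = 0" by (rule region[OF g2]) (use 3 abc in auto)
    then show ?thesis by (simp add: rotate_def)
  next
    case 4
    then show ?thesis using abc by (intro inverse_system_outside[OF g]) (auto simp: standard_exponents_def)
  qed
qed

section \<open>Counting standard monomials\<close>

definition triples_above :: "nat \<Rightarrow> nat \<Rightarrow> nat \<Rightarrow> nat \<Rightarrow> (nat \<times> nat \<times> nat) set" where
  "triples_above i j k e = {(a, b, c). a + b + c = e \<and> i \<le> a \<and> j \<le> b \<and> k \<le> c}"

definition standard_triples :: "nat \<Rightarrow> nat \<Rightarrow> nat \<Rightarrow> nat \<Rightarrow> nat \<Rightarrow> (nat \<times> nat \<times> nat) set" where
  "standard_triples \<alpha> \<beta> \<gamma> t e = {(a, b, c). a + b + c = e \<and> standard_exponents \<alpha> \<beta> \<gamma> t a b c}"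

lemma finite_triples_above [simp]: "finite (triples_above i j k e)"
  by (rule finite_subset[of _ "{..e} \<times> {..e} \<times> {..e}"]) (auto simp: triples_above_def)

lemma finite_standard_triples [simp]: "finite (standard_triples \<alpha> \<beta> \<gamma> t e)"
  by (rule finite_subset[of _ "{..e} \<times> {..e} \<times> {..e}"]) (auto simp: standard_triples_def)

text \<open>
  Lowering \<open>c\<close> by one maps the triples with \<open>k < c\<close> onto those of degree \<open>e\<close>; the triples with \<open>c = k\<close> are counted
  by the truncated difference.
\<close>

lemma card_triples_above_Suc:
  "card (triples_above i j k (Suc e)) = card (triples_above i j k e) + (Suc (Suc e) - (i + j + k))"
proof -
  let ?f = "\<lambda>(a, b, c). (a, b, Suc c)" and ?h = "\<lambda>a. (a, Suc e - k - a, k)"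
  let ?A = "if j + k \<le> Suc e then {i..Suc e - k - j} else {}"
  have "triples_above i j k (Suc e) = ?f ` triples_above i j k e \<union> ?h ` ?A"
  proof (intro equalityI subsetI)
    fix x assume "x \<in> triples_above i j k (Suc e)"
    then obtain a b c where x: "x = (a, b, c)" "a + b + c = Suc e" "i \<le> a" "j \<le> b" "k \<le> c"
      by (auto simp: triples_above_def)
    show "x \<in> ?f ` triples_above i j k e \<union> ?h ` ?A"
    proof (cases "c = k")
      case True
      then have "x = ?h a" "a \<in> ?A" using x by auto
      then show ?thesis by blast
    next
      case False
      then obtain c' where "c = Suc c'" using x by (cases c) auto
      then have "x = ?f (a, b, c')" "(a, b, c') \<in> triples_above i j k e"
        using x False by (auto simp: triples_above_def)
      then show ?thesis by blast
    qed
  next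
    fix x assume "x \<in> ?f ` triples_above i j k e \<union> ?h ` ?A"
    then show "x \<in> triples_above i j k (Suc e)"
      by (auto simp: triples_above_def split: if_splits)
  qed
  moreover have "?f ` triples_above i j k e \<inter> ?h ` ?A = {}"
    by (auto simp: triples_above_def)
  moreover have "finite ?A" by simp
  moreover have "card (?f ` triples_above i j k e) = card (triples_above i j k e)"
    by (intro card_image) (auto simp: inj_on_def)
  moreover have "card (?h ` ?A) = card ?A" by (intro card_image) (auto simp: inj_on_def)
  moreover have "card ?A = Suc (Suc e) - (i + j + k)" by auto
  ultimately show ?thesis by (simp add: card_Un_disjoint)
qed

text \<open>
  In degree \<open>e\<close> no monomial is divisible by two of the generators of the ideal, so the simplex of all
  exponent vectors splits into disjoint parts.
\<close>

lemma card_standard_triples: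
  assumes "e < \<alpha> + \<beta> + 2 * t" "e < \<beta> + \<gamma> + 2 * t" "e < \<alpha> + \<gamma> + 2 * t" "e < \<alpha> + \<beta> + \<gamma> + t"
  shows "card (triples_above 0 0 0 e) = card (standard_triples \<alpha> \<beta> \<gamma> t e)
    + card (triples_above (\<alpha> + t) 0 0 e) + card (triples_above 0 (\<beta> + t) 0 e)
    + card (triples_above 0 0 (\<gamma> + t) e) + card (triples_above \<alpha> \<beta> \<gamma> e)"
proof -
  let ?S = "standard_triples \<alpha> \<beta> \<gamma> t e"
  let ?A = "triples_above (\<alpha> + t) 0 0 e" and ?B = "triples_above 0 (\<beta> + t) 0 e"
    and ?C = "triples_above 0 0 (\<gamma> + t) e" and ?D = "triples_above \<alpha> \<beta> \<gamma> e"
  have "triples_above 0 0 0 e = ?S \<union> ?A \<union> ?B \<union> ?C \<union> ?D"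
    by (auto simp: triples_above_def standard_triples_def standard_exponents_def)
  also have "card \<dots> = card (?S \<union> ?A \<union> ?B \<union> ?C) + card ?D"
    by (intro card_Un_disjoint finite_UnI finite_triples_above finite_standard_triples)
      (use assms in \<open>auto simp: triples_above_def standard_triples_def standard_exponents_def\<close>)
  also have "card (?S \<union> ?A \<union> ?B \<union> ?C) = card (?S \<union> ?A \<union> ?B) + card ?C"
    by (intro card_Un_disjoint finite_UnI finite_triples_above finite_standard_triples)
      (use assms in \<open>auto simp: triples_above_def standard_triples_def standard_exponents_def\<close>)
  also have "card (?S \<union> ?A \<union> ?B) = card (?S \<union> ?A) + card ?B"
    by (intro card_Un_disjoint finite_UnI finite_triples_above finite_standard_triples)
      (use assms in \<open>auto simp: triples_above_def standard_triples_def standard_exponents_def\<close>)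
  also have "card (?S \<union> ?A) = card ?S + card ?A"
    by (intro card_Un_disjoint finite_UnI finite_triples_above finite_standard_triples)
      (use assms in \<open>auto simp: triples_above_def standard_triples_def standard_exponents_def\<close>)
  finally show ?thesis .
qed

text \<open>
  By \<open>card_triples_above_Suc\<close> the two cardinalities differ by
  \<open>(2m + t) - (2m - \<alpha>) - (2m - \<beta>) - (2m - \<gamma>) - (t - m) = 0\<close>.
\<close>

lemma card_standard_triples_peak:
  assumes sum: "\<alpha> + \<beta> + \<gamma> = 3 * m" and le: "\<alpha> \<le> 2 * m" "\<beta> \<le> 2 * m" "\<gamma> \<le> 2 * m" and m: "0 < m" "m \<le> t"
  shows "card (standard_triples \<alpha> \<beta> \<gamma> t (2 * m + t - 1)) = card (standard_triples \<alpha> \<beta> \<gamma> t (2 * m + t - 2))"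
proof -
  define e where "e = 2 * m + t - 2"
  have e: "2 * m + t - 1 = Suc e" using m by (simp add: e_def)
  have e2: "Suc (Suc e) = 2 * m + t" using m by (simp add: e_def)
  have "card (triples_above 0 0 0 e) = card (standard_triples \<alpha> \<beta> \<gamma> t e)
    + card (triples_above (\<alpha> + t) 0 0 e) + card (triples_above 0 (\<beta> + t) 0 e)
    + card (triples_above 0 0 (\<gamma> + t) e) + card (triples_above \<alpha> \<beta> \<gamma> e)"
    by (rule card_standard_triples) (use assms e2 in linarith)+
  moreover have "card (triples_above 0 0 0 (Suc e)) = card (standard_triples \<alpha> \<beta> \<gamma> t (Suc e))
    + card (triples_above (\<alpha> + t) 0 0 (Suc e)) + card (triples_above 0 (\<beta> + t) 0 (Suc e))
    + card (triples_above 0 0 (\<gamma> + t) (Suc e)) + card (triples_above \<alpha> \<beta> \<gamma> (Suc e))"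
    by (rule card_standard_triples) (use assms e2 in linarith)+
  ultimately have "card (standard_triples \<alpha> \<beta> \<gamma> t (Suc e)) = card (standard_triples \<alpha> \<beta> \<gamma> t e)"
    unfolding card_triples_above_Suc e2 using assms by simp
  then show ?thesis unfolding e by (simp only: e_def)
qed

section \<open>Failure in the symmetric case\<close>

definition has_inverse_system ::
  "nat \<Rightarrow> nat \<Rightarrow> nat \<Rightarrow> nat \<Rightarrow> nat \<Rightarrow> 'k::field \<Rightarrow> 'k \<Rightarrow> 'k \<Rightarrow> bool" where
  "has_inverse_system \<alpha> \<beta> \<gamma> t d p q r \<longleftrightarrow>
     (\<exists>g. inverse_system \<alpha> \<beta> \<gamma> t d p q r g \<and> (\<exists>a b c. a + b + c = d \<and> g a b c \<noteq> 0))"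

lemma has_inverse_system_rotate:
  assumes "has_inverse_system \<alpha> \<beta> \<gamma> t d p q r"
  shows "has_inverse_system \<gamma> \<alpha> \<beta> t d r p q"
proof -
  obtain g a b c where g: "inverse_system \<alpha> \<beta> \<gamma> t d p q r g" and nz: "a + b + c = d" "g a b c \<noteq> 0"
    using assms by (auto simp: has_inverse_system_def)
  have "inverse_system \<gamma> \<alpha> \<beta> t d r p q (\<lambda>c a b. g a b c)"
    unfolding inverse_system_def
  proof (intro conjI allI impI)
    fix c a b assume "c + a + b = d \<and> \<not> standard_exponents \<gamma> \<alpha> \<beta> t c a b"
    then show "g a b c = 0"
      by (intro inverse_system_outside[OF g]) (auto simp: standard_exponents_def)
  next
    fix c a b assume "Suc (c + a + b) = d"
    then show "r * g a b (Suc c) + p * g (Suc a) b c + q * g a (Suc b) c = 0"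
      using inverse_system_relation[OF g, of a b c] by (simp add: ac_simps)
  qed
  moreover have "c + a + b = d" using nz by simp
  ultimately show ?thesis using nz(2) unfolding has_inverse_system_def by blast
qed

lemma has_inverse_system_rescale:
  fixes p q r :: "'k::field"
  assumes "has_inverse_system \<alpha> \<beta> \<gamma> t d (1::'k) 1 1" and nz: "p \<noteq> 0" "q \<noteq> 0" "r \<noteq> 0"
  shows "has_inverse_system \<alpha> \<beta> \<gamma> t d p q r"
proof -
  obtain g :: "nat \<Rightarrow> nat \<Rightarrow> nat \<Rightarrow> 'k" and a b c
    where g: "inverse_system \<alpha> \<beta> \<gamma> t d 1 1 1 g" and abc: "a + b + c = d" "g a b c \<noteq> 0"
    using assms(1) by (auto simp: has_inverse_system_def)
  have "inverse_system \<alpha> \<beta> \<gamma> t d p q r (\<lambda>a b c. g a b c / (p ^ a * q ^ b * r ^ c))"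
    unfolding inverse_system_def
  proof (intro conjI allI impI)
    fix a b c assume "a + b + c = d \<and> \<not> standard_exponents \<alpha> \<beta> \<gamma> t a b c"
    then show "g a b c / (p ^ a * q ^ b * r ^ c) = 0"
      using inverse_system_outside[OF g] by simp
  next
    fix a b c assume "Suc (a + b + c) = d"
    then have "g (Suc a) b c + g a (Suc b) c + g a b (Suc c) = 0"
      using inverse_system_relation[OF g, of a b c] by simp
    moreover have "p * (g (Suc a) b c / (p ^ Suc a * q ^ b * r ^ c)) + q * (g a (Suc b) c / (p ^ a * q ^ Suc b * r ^ c))
        + r * (g a b (Suc c) / (p ^ a * q ^ b * r ^ Suc c))
        = (g (Suc a) b c + g a (Suc b) c + g a b (Suc c)) / (p ^ a * q ^ b * r ^ c)"
      using nz by (simp add: add_divide_distrib mult.assoc)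
    ultimately show "p * (g (Suc a) b c / (p ^ Suc a * q ^ b * r ^ c)) + q * (g a (Suc b) c / (p ^ a * q ^ Suc b * r ^ c))
        + r * (g a b (Suc c) / (p ^ a * q ^ b * r ^ Suc c)) = 0" by simp
  qed
  moreover have "g a b c / (p ^ a * q ^ b * r ^ c) \<noteq> 0" using abc nz by simp
  ultimately show ?thesis using abc(1) unfolding has_inverse_system_def by blast
qed

text \<open>
  When \<open>r = 0\<close> the relation does not mix rows of constant \<open>c\<close>. The row \<open>c = \<gamma> + t - 1\<close> consists of standard
  monomials only, and a geometric progression solves the relation there.
\<close>

lemma has_inverse_system_degenerate:
  fixes p q :: "'k::field"
  assumes sum: "\<alpha> + \<beta> + \<gamma> = 3 * m" and m: "0 < m" "\<gamma> \<le> 2 * m" "\<alpha> < m + t" "\<beta> < m + t" "0 < t"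
  shows "has_inverse_system \<alpha> \<beta> \<gamma> t (2 * m + t - 1) p q 0"
proof -
  \<comment> \<open>if \<open>p\<close> and \<open>q\<close> both vanish, there is no relation and any nonzero pair serves\<close>
  define p' q' where "p' = (if p = 0 \<and> q = 0 then 1 else p)" and "q' = (if p = 0 \<and> q = 0 then 1 else q)"
  define g where "g a b c = (if c = \<gamma> + t - 1 then q' ^ a * (- p') ^ b else 0)" for a b c :: nat
  have "inverse_system \<alpha> \<beta> \<gamma> t (2 * m + t - 1) p q 0 g"
    unfolding inverse_system_def
  proof (intro conjI allI impI)
    fix a b c assume abc: "a + b + c = 2 * m + t - 1 \<and> \<not> standard_exponents \<alpha> \<beta> \<gamma> t a b c"
    have "c \<noteq> \<gamma> + t - 1"
    proof
      assume c: "c = \<gamma> + t - 1"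
      have ab: "a + b = 2 * m - \<gamma>" using abc c m by linarith
      have "a < \<alpha> + t" "b < \<beta> + t" "c < \<gamma> + t" "\<not> (\<alpha> \<le> a \<and> \<beta> \<le> b)"
        using ab m sum c by linarith+
      with abc show False by (auto simp: standard_exponents_def)
    qed
    then show "g a b c = 0" by (simp add: g_def)
  next
    fix a b c
    show "p * g (Suc a) b c + q * g a (Suc b) c + 0 * g a b (Suc c) = 0"
      by (simp add: g_def p'_def q'_def)
  qed
  moreover have "\<exists>a b c. a + b + c = 2 * m + t - 1 \<and> g a b c \<noteq> 0"
  proof (cases "q' = 0")
    case True
    then have "p' \<noteq> 0" by (auto simp: p'_def q'_def split: if_splits)
    then show ?thesis using m
      by (intro exI[of _ 0] exI[of _ "2 * m - \<gamma>"] exI[of _ "\<gamma> + t - 1"]) (auto simp: g_def)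
  next
    case False
    then show ?thesis using m
      by (intro exI[of _ "2 * m - \<gamma>"] exI[of _ 0] exI[of _ "\<gamma> + t - 1"]) (auto simp: g_def)
  qed
  ultimately show ?thesis unfolding has_inverse_system_def by blast
qed

lemma card_off_diagonal:
  assumes "finite S" and swap: "\<And>a b c. (a, b, c) \<in> S \<Longrightarrow> (b, a, c) \<in> S"
  shows "card S = 2 * card {(a, b, c)\<in>S. a < b} + card {(a, b, c)\<in>S. a = (b :: nat)}"
proof -
  let ?L = "{(a, b, c)\<in>S. a < b}" and ?D = "{(a, b, c)\<in>S. a = b}" and ?f = "\<lambda>(a, b, c). (b, a, c)"
  have fin: "finite ?L" "finite ?D" by (rule finite_subset[OF _ assms(1)]; auto)+
  have "S = ?L \<union> ?f ` ?L \<union> ?D"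
  proof (intro equalityI subsetI)
    fix x assume x: "x \<in> S"
    obtain a b c where abc: "x = (a, b, c)" by (cases x)
    show "x \<in> ?L \<union> ?f ` ?L \<union> ?D"
    proof (cases "b < a")
      case True
      then have "x = ?f (b, a, c)" "(b, a, c) \<in> ?L" using x abc swap by auto
      then show ?thesis by blast
    qed (use x abc in auto)
  qed (use swap in auto)
  moreover have "card (?L \<union> ?f ` ?L \<union> ?D) = card (?L \<union> ?f ` ?L) + card ?D"
    by (intro card_Un_disjoint finite_UnI finite_imageI fin) auto
  moreover have "card (?L \<union> ?f ` ?L) = card ?L + card (?f ` ?L)"
    by (intro card_Un_disjoint finite_imageI fin) auto
  moreover have "card (?f ` ?L) = card ?L" by (intro card_image) (auto simp: inj_on_def)
  ultimately show ?thesis by simp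
qed

text \<open>
  Dividing by the third variable injects the fixed monomials of degree \<open>2m + t - 1\<close> into those of degree
  \<open>2m + t - 2\<close>: as \<open>2m + t - 1\<close> is odd, the third exponent of a fixed monomial is odd, hence positive.
  The fixed monomial with third exponent \<open>\<gamma> + t - 1\<close> is not reached.
\<close>

lemma card_diagonal_standard_triples_less:
  assumes sum: "2 * \<alpha> + \<gamma> = 3 * m" and m: "0 < m" "\<gamma> \<le> 2 * m" "m \<le> t" and par: "even t" "odd m"
  shows "card {(a, b, c)\<in>standard_triples \<alpha> \<alpha> \<gamma> t (2 * m + t - 1). a = b}
    < card {(a, b, c)\<in>standard_triples \<alpha> \<alpha> \<gamma> t (2 * m + t - 2). a = b}"
proof -
  let ?D = "\<lambda>e. {(a, b, c)\<in>standard_triples \<alpha> \<alpha> \<gamma> t e. a = b}"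
  let ?f = "\<lambda>(a, b, c). (a, b, c - 1 :: nat)"
  have odd_c: "0 < c" if "(a, a, c) \<in> standard_triples \<alpha> \<alpha> \<gamma> t (2 * m + t - 1)" for a c
  proof -
    have "a + a + c = 2 * m + t - 1" using that by (simp add: standard_triples_def)
    then have "Suc (2 * a + c) = 2 * m + t" using m by simp
    then have "even (Suc (2 * a + c))" using par by simp
    then show ?thesis by (cases c) auto
  qed
  have "odd \<gamma>"
  proof -
    have "odd (2 * \<alpha> + \<gamma>)" using sum par by simp
    then show ?thesis by simp
  qed
  then have g: "\<gamma> < 2 * m" using m by (cases "\<gamma> = 2 * m") auto
  define x where "x = (2 * m - 1 - \<gamma>) div 2"
  have "even (2 * m - 1 - \<gamma>)" using \<open>odd \<gamma>\<close> g by simp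
  then have x: "2 * x = 2 * m - 1 - \<gamma>" by (simp add: x_def)
  have new: "(x, x, \<gamma> + t - 1) \<in> ?D (2 * m + t - 2)"
    using x g sum m par by (auto simp: standard_triples_def standard_exponents_def)
  have sub: "?f ` ?D (2 * m + t - 1) \<subseteq> ?D (2 * m + t - 2) - {(x, x, \<gamma> + t - 1)}"
  proof
    fix y assume "y \<in> ?f ` ?D (2 * m + t - 1)"
    then obtain a c where ac: "y = (a, a, c - 1)" "(a, a, c) \<in> standard_triples \<alpha> \<alpha> \<gamma> t (2 * m + t - 1)"
      by auto
    then have "0 < c" using odd_c by blast
    then show "y \<in> ?D (2 * m + t - 2) - {(x, x, \<gamma> + t - 1)}"
      using ac by (auto simp: standard_triples_def standard_exponents_def)
  qed
  have "inj_on ?f (?D (2 * m + t - 1))"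
    using odd_c by (auto simp: inj_on_def) (metis Suc_pred)
  then have "card (?D (2 * m + t - 1)) = card (?f ` ?D (2 * m + t - 1))" by (simp add: card_image)
  also have "\<dots> \<le> card (?D (2 * m + t - 2) - {(x, x, \<gamma> + t - 1)})"
    by (rule card_mono[OF _ sub]) (auto intro: finite_subset[OF _ finite_standard_triples])
  also have "\<dots> < card (?D (2 * m + t - 2))"
    using new by (intro psubset_card_mono) (auto intro: finite_subset[OF _ finite_standard_triples])
  finally show ?thesis .
qed

text \<open>
  Look for \<open>g\<close> among the antisymmetric functions. Their values at the standard triples with \<open>a < b\<close> are the
  unknowns, and the relations at triples with \<open>a < b\<close> imply all others. There are more unknowns than
  relations, because the total numbers of standard triples agree in the two degrees while
  there are fewer fixed ones in the higher degree.
\<close>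

lemma has_inverse_system_symmetric:
  assumes sum: "2 * \<alpha> + \<gamma> = 3 * m" and m: "0 < m" "\<alpha> \<le> 2 * m" "\<gamma> \<le> 2 * m" "m \<le> t" and par: "even t" "odd m"
  shows "has_inverse_system \<alpha> \<alpha> \<gamma> t (2 * m + t - 1) (1::'k::field) 1 1"
proof -
  define d where "d = 2 * m + t - 1"
  have d2: "2 * m + t - 2 = d - 1" "d = Suc (d - 1)" using m by (auto simp: d_def)
  define V where "V = {(a, b, c)\<in>standard_triples \<alpha> \<alpha> \<gamma> t d. a < b}"
  define U where "U = {(a, b, c)\<in>standard_triples \<alpha> \<alpha> \<gamma> t (d - 1). a < b}"
  have swap: "(b, a, c) \<in> standard_triples \<alpha> \<alpha> \<gamma> t e" if "(a, b, c) \<in> standard_triples \<alpha> \<alpha> \<gamma> t e" for a b c e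
    using that by (auto simp: standard_triples_def standard_exponents_def)
  have fV: "finite V" and fU: "finite U"
    by (auto simp: V_def U_def intro: finite_subset[OF _ finite_standard_triples])
  have "card (standard_triples \<alpha> \<alpha> \<gamma> t d) = card (standard_triples \<alpha> \<alpha> \<gamma> t (d - 1))"
    using card_standard_triples_peak[of \<alpha> \<alpha> \<gamma> m t] sum m d2 by (simp add: d_def)
  moreover note card_off_diagonal[of "standard_triples \<alpha> \<alpha> \<gamma> t d", OF finite_standard_triples swap]
  moreover note card_off_diagonal[of "standard_triples \<alpha> \<alpha> \<gamma> t (d - 1)", OF finite_standard_triples swap]
  moreover note card_diagonal_standard_triples_less[OF sum m(1,3,4) par, folded d_def, unfolded d2(1)]
  ultimately have "card U < card V" unfolding U_def V_def by linarith
  \<comment> \<open>the antisymmetric function with value 1 at \<open>v\<close>, evaluated at \<open>(a, b, c)\<close>\<close>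
  define s :: "nat \<times> nat \<times> nat \<Rightarrow> nat \<Rightarrow> nat \<Rightarrow> nat \<Rightarrow> 'k" where
    "s v a b c = (if v = (a, b, c) then 1 else 0) - (if v = (b, a, c) then 1 else 0)" for v a b c
  define A where "A u v = (case u of (a, b, c) \<Rightarrow> s v (Suc a) b c + s v a (Suc b) c + s v a b (Suc c))" for u v
  obtain h where h: "\<exists>v\<in>V. h v \<noteq> 0" "\<forall>u\<in>U. (\<Sum>v\<in>V. A u v * h v) = 0"
    using underdetermined_system_has_nonzero_solution[OF fU fV \<open>card U < card V\<close>, of A] by blast
  define g where "g a b c = (\<Sum>v\<in>V. s v a b c * h v)" for a b c
  have anti: "g b a c = - g a b c" for a b c
    by (simp add: g_def s_def left_diff_distrib sum_subtractf)
  have diag: "g a a c = 0" for a c by (simp add: g_def s_def)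
  have out: "g a b c = 0" if "(a, b, c) \<notin> standard_triples \<alpha> \<alpha> \<gamma> t d" for a b c
    unfolding g_def
  proof (rule sum.neutral, rule ballI)
    fix v assume "v \<in> V"
    then have "v \<in> standard_triples \<alpha> \<alpha> \<gamma> t d" by (auto simp: V_def)
    then have "v \<noteq> (a, b, c)" "v \<noteq> (b, a, c)" using that swap by auto
    then show "s v a b c * h v = 0" by (simp add: s_def)
  qed
  have rel_U: "g (Suc a) b c + g a (Suc b) c + g a b (Suc c) = 0" if "(a, b, c) \<in> U" for a b c
  proof -
    have "(\<Sum>v\<in>V. A (a, b, c) v * h v) = 0" using h(2) that by blast
    then show ?thesis by (simp add: A_def g_def distrib_right sum.distrib)
  qed
  have sys: "inverse_system \<alpha> \<alpha> \<gamma> t d 1 1 1 g"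
    unfolding inverse_system_def
  proof (intro conjI allI impI)
    fix a b c assume "a + b + c = d \<and> \<not> standard_exponents \<alpha> \<alpha> \<gamma> t a b c"
    then show "g a b c = 0" by (intro out) (auto simp: standard_triples_def)
  next
    fix a b c assume abc: "Suc (a + b + c) = d"
    show "1 * g (Suc a) b c + 1 * g a (Suc b) c + 1 * g a b (Suc c) = 0"
    proof (cases "standard_exponents \<alpha> \<alpha> \<gamma> t a b c")
      case True
      then have S: "(a, b, c) \<in> standard_triples \<alpha> \<alpha> \<gamma> t (d - 1)" using abc by (auto simp: standard_triples_def)
      consider "a < b" | "b < a" | "a = b" by linarith
      then show ?thesis
      proof cases
        case 1
        then show ?thesis using rel_U[of a b c] S by (simp add: U_def)
      next
        case 2
        then have "g (Suc b) a c + g b (Suc a) c + g b a (Suc c) = 0"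
          using rel_U[of b a c] swap[OF S] by (simp add: U_def)
        then have "- g a (Suc b) c - g (Suc a) b c - g a b (Suc c) = 0"
          by (simp add: anti[of "Suc b" a] anti[of b "Suc a"] anti[of b a])
        then have "- (g (Suc a) b c + g a (Suc b) c + g a b (Suc c)) = 0" by (simp add: algebra_simps)
        then show ?thesis by (simp only: mult_1 neg_equal_0_iff_equal)
      next
        case 3
        then show ?thesis using anti[of a "Suc a" c] by (simp add: diag)
      qed
    next
      case False
      have "g (Suc a) b c = 0" "g a (Suc b) c = 0" "g a b (Suc c) = 0"
        by (rule out; use False in \<open>force simp: standard_triples_def standard_exponents_def\<close>)+
      then show ?thesis by simp
    qed
  qed
  obtain a b c where abc: "(a, b, c) \<in> V" "h (a, b, c) \<noteq> 0" using h(1) by auto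
  have "g a b c = (\<Sum>v\<in>V. (if v = (a, b, c) then 1 else 0) * h v)"
    unfolding g_def using abc(1) by (intro sum.cong) (auto simp: s_def V_def)
  also have "\<dots> = h (a, b, c)" using abc(1) fV by (simp add: if_distrib[of "\<lambda>x. x * _"] cong: if_cong)
  finally have nz: "g a b c \<noteq> 0" using abc(2) by simp
  have "a + b + c = d" using abc(1) by (simp add: V_def standard_triples_def)
  then show ?thesis using sys nz unfolding has_inverse_system_def d_def by blast
qed

text \<open>
  If \<open>p\<close>, \<open>q\<close> and \<open>r\<close> are nonzero, rescaling reduces to the symmetric case, and otherwise a row of the hexagon
  carries a solution. Rotating the coordinates puts the special variable in the third place.
\<close>

theorem has_inverse_system_two_equal:
  fixes p q r :: "'k::field"
  assumes sum: "\<alpha> + \<beta> + \<gamma> = 3 * m" and m: "0 < m" "\<alpha> \<le> 2 * m" "\<beta> \<le> 2 * m" "\<gamma> \<le> 2 * m" "m \<le> t"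
    and par: "even t" "odd m" and eq: "\<alpha> = \<beta> \<or> \<beta> = \<gamma>"
  shows "has_inverse_system \<alpha> \<beta> \<gamma> t (2 * m + t - 1) p q r"
proof -
  have "t \<noteq> m" using par by blast
  then have lt: "\<alpha> < m + t" "\<beta> < m + t" "\<gamma> < m + t" "0 < t" using m by auto
  show ?thesis
  proof (cases "p = 0 \<or> q = 0 \<or> r = 0")
    case False
    have "has_inverse_system \<alpha> \<beta> \<gamma> t (2 * m + t - 1) (1::'k) 1 1"
    proof (cases "\<alpha> = \<beta>")
      case True
      then show ?thesis using has_inverse_system_symmetric[of \<beta> \<gamma> m t] sum m par by simp
    next
      case False
      then have "\<beta> = \<gamma>" using eq by simp
      then show ?thesis
        using has_inverse_system_rotate[OF has_inverse_system_symmetric[of \<gamma> \<alpha> m t]] sum m par by simp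
    qed
    then show ?thesis using False has_inverse_system_rescale by blast
  next
    case True
    consider "r = 0" | "p = 0" | "q = 0" using True by blast
    then show ?thesis
    proof cases
      case 1
      then show ?thesis using has_inverse_system_degenerate[OF sum m(1,4) lt(1,2,4)] by simp
    next
      case 2
      have "has_inverse_system \<beta> \<gamma> \<alpha> t (2 * m + t - 1) q r p"
        using has_inverse_system_degenerate[of \<beta> \<gamma> \<alpha> m t] sum m lt 2 by (simp add: add_ac)
      then show ?thesis by (rule has_inverse_system_rotate)
    next
      case 3
      have "has_inverse_system \<gamma> \<alpha> \<beta> t (2 * m + t - 1) r p q"
        using has_inverse_system_degenerate[of \<gamma> \<alpha> \<beta> m t] sum m lt 3 by (simp add: add_ac)
      then show ?thesis by (rule has_inverse_system_rotate[OF has_inverse_system_rotate])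
    qed
  qed
qed

section \<open>Monomial ideals and their quotients\<close>

lemma mpol_ring_simps [simp]:
  "carrier mpol_ring = UNIV" "f \<otimes>\<^bsub>mpol_ring\<^esub> g = f * g" "f \<oplus>\<^bsub>mpol_ring\<^esub> g = f + g"
  "\<zero>\<^bsub>mpol_ring\<^esub> = 0" "\<one>\<^bsub>mpol_ring\<^esub> = 1"
  by (simp_all add: ring_of_type_algebra_def)

lemma a_inv_mpol_ring: "\<ominus>\<^bsub>mpol_ring\<^esub> f = - (f :: ('v, 'k::field) mpol)"
proof -
  interpret R: ring "mpol_ring :: ('v, 'k) mpol ring" by (rule ring_from_type_algebra)
  show ?thesis by (rule R.minus_equality) auto
qed

lemma ideal_mpol_ringI:
  fixes I :: "('v, 'k::field) mpol set"
  assumes zero: "0 \<in> I" and add: "\<And>f g. f \<in> I \<Longrightarrow> g \<in> I \<Longrightarrow> f + g \<in> I"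
    and mult: "\<And>f g. f \<in> I \<Longrightarrow> g * f \<in> I"
  shows "ideal I mpol_ring"
proof -
  interpret R: ring "mpol_ring :: ('v, 'k) mpol ring" by (rule ring_from_type_algebra)
  have neg: "- f \<in> I" if "f \<in> I" for f using mult[OF that, of "- 1"] by simp
  show ?thesis
  proof (rule idealI)
    show "ring (mpol_ring :: ('v, 'k) mpol ring)" by (rule R.ring_axioms)
    show "subgroup I (add_monoid mpol_ring)"
    proof (rule R.add.subgroupI)
      show "I \<noteq> {}" using zero by blast
      show "\<ominus>\<^bsub>mpol_ring\<^esub> f \<in> I" if "f \<in> I" for f
        using neg[OF that] by (simp add: a_inv_mpol_ring)
    qed (use add in auto)
  qed (use mult in \<open>auto simp: mult.commute\<close>)
qed

lemma ideal_mpol_ringD: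
  fixes I :: "('v, 'k::field) mpol set"
  assumes "ideal I mpol_ring"
  shows "0 \<in> I" and "f \<in> I \<Longrightarrow> g \<in> I \<Longrightarrow> f + g \<in> I" and "f \<in> I \<Longrightarrow> g * f \<in> I"
    and "f \<in> I \<Longrightarrow> g \<in> I \<Longrightarrow> f - g \<in> I"
proof -
  interpret ideal I mpol_ring by fact
  show "0 \<in> I" using additive_subgroup.zero_closed[OF additive_subgroup_axioms] by simp
  show add: "f + g \<in> I" if "f \<in> I" "g \<in> I" for f g
    using additive_subgroup.a_closed[OF additive_subgroup_axioms that] by simp
  show mult: "g * f \<in> I" if "f \<in> I" for f g using I_l_closed[OF that, of g] by simp
  show "f - g \<in> I" if "f \<in> I" "g \<in> I" using add[OF that(1) mult[OF that(2), of "- 1"]] by simp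
qed

lemma ideal_mpol_ring_sum:
  fixes I :: "('v, 'k::field) mpol set"
  assumes "ideal I mpol_ring" and "\<And>x. x \<in> A \<Longrightarrow> f x \<in> I"
  shows "sum f A \<in> I"
  using assms(2)
proof (induction A rule: infinite_finite_induct)
  case (insert x A)
  then show ?case using ideal_mpol_ringD(2)[OF assms(1), of "f x" "sum f A"] by simp
qed (simp_all add: ideal_mpol_ringD(1)[OF assms(1)])

lemma coset_mpol_ring_eq_iff:
  fixes I :: "('v, 'k::field) mpol set"
  assumes I: "ideal I mpol_ring"
  shows "I +>\<^bsub>mpol_ring\<^esub> f = I +>\<^bsub>mpol_ring\<^esub> g \<longleftrightarrow> f - g \<in> I"
proof
  assume "I +>\<^bsub>mpol_ring\<^esub> f = I +>\<^bsub>mpol_ring\<^esub> g"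
  moreover have "f \<in> I +>\<^bsub>mpol_ring\<^esub> f" using ideal_mpol_ringD(1)[OF I] by (force simp: a_r_coset_def')
  ultimately obtain i where "i \<in> I" "f = i + g" by (auto simp: a_r_coset_def')
  then show "f - g \<in> I" by simp
next
  assume d: "f - g \<in> I"
  have "\<exists>j\<in>I. i + f = j + g" if "i \<in> I" for i
    by (rule bexI[of _ "i + (f - g)"]) (use ideal_mpol_ringD(2)[OF I that d] in auto)
  moreover have "\<exists>j\<in>I. i + g = j + f" if "i \<in> I" for i
    by (rule bexI[of _ "i - (f - g)"]) (use ideal_mpol_ringD(4)[OF I that d] in auto)
  ultimately show "I +>\<^bsub>mpol_ring\<^esub> f = I +>\<^bsub>mpol_ring\<^esub> g"
    unfolding a_r_coset_def' by (auto simp: set_eq_iff)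
qed

lemma coset_mpol_ring_mult:
  fixes I :: "('v, 'k::field) mpol set"
  assumes "ideal I mpol_ring"
  shows "(I +>\<^bsub>mpol_ring\<^esub> f) \<otimes>\<^bsub>mpol_ring Quot I\<^esub> (I +>\<^bsub>mpol_ring\<^esub> g) = I +>\<^bsub>mpol_ring\<^esub> (f * g)"
proof -
  interpret ideal I mpol_ring by fact
  show ?thesis using rcoset_mult_add[of f g] by (simp add: FactRing_def)
qed

lemma monom_degree_add:
  fixes m n :: "'v \<Rightarrow>\<^sub>0 nat"
  shows "monom_degree (m + n) = monom_degree m + monom_degree n"
proof -
  let ?K = "Poly_Mapping.keys m \<union> Poly_Mapping.keys n"
  have "monom_degree k = (\<Sum>v\<in>?K. Poly_Mapping.lookup k v)" if "Poly_Mapping.keys k \<subseteq> ?K" for k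
    unfolding monom_degree_def by (rule sum.mono_neutral_left) (use that in \<open>auto simp: in_keys_iff\<close>)
  moreover have "Poly_Mapping.keys (m + n) \<subseteq> ?K" by (rule keys_add)
  ultimately show ?thesis by (simp add: lookup_add sum.distrib)
qed

lemma homogeneous_component_mult:
  assumes "f \<in> homogeneous_component d" and "g \<in> homogeneous_component e"
  shows "f * g \<in> homogeneous_component (d + e)"
  unfolding homogeneous_component_def
proof (intro CollectI ballI)
  fix m assume "m \<in> Poly_Mapping.keys (f * g)"
  then obtain m1 m2 where m: "m = m1 + m2" "m1 \<in> Poly_Mapping.keys f" "m2 \<in> Poly_Mapping.keys g"
    using keys_mult[of f g] by blast
  then have "int (monom_degree m1) = d" "int (monom_degree m2) = e"
    using assms by (auto simp: homogeneous_component_def)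
  then show "int (monom_degree m) = d + e" using m(1) by (simp add: monom_degree_add)
qed

lemma homogeneous_component_diff:
  assumes "f \<in> homogeneous_component d" and "g \<in> homogeneous_component d"
  shows "f - g \<in> homogeneous_component d"
  using assms unfolding homogeneous_component_def
  by (auto simp: in_keys_iff lookup_minus)

lemma homogeneous_component_sum:
  assumes "\<And>x. x \<in> A \<Longrightarrow> f x \<in> homogeneous_component d"
  shows "sum f A \<in> homogeneous_component d"
proof -
  have "Poly_Mapping.lookup (sum f A) m = 0" if "int (monom_degree m) \<noteq> d" for m
    unfolding lookup_sum by (rule sum.neutral) (use assms that in \<open>force simp: homogeneous_component_def in_keys_iff\<close>)
  then show ?thesis by (auto simp: homogeneous_component_def in_keys_iff)
qed

text \<open>
  Injectivity on the quotient in terms of representatives; by linearity it suffices that the kernel is zero.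
\<close>

definition lefschetz_injective :: "('v, 'k::field) mpol set \<Rightarrow> ('v, 'k) mpol \<Rightarrow> int \<Rightarrow> bool" where
  "lefschetz_injective I L d \<longleftrightarrow> (\<forall>q\<in>homogeneous_component d. L * q \<in> I \<longrightarrow> q \<in> I)"

definition lefschetz_surjective :: "('v, 'k::field) mpol set \<Rightarrow> ('v, 'k) mpol \<Rightarrow> int \<Rightarrow> bool" where
  "lefschetz_surjective I L d \<longleftrightarrow>
     (\<forall>h\<in>homogeneous_component (d + 1). \<exists>q\<in>homogeneous_component d. h - L * q \<in> I)"

text \<open>
  The cosets of \<open>f\<close> and \<open>g\<close> agree when \<open>f - g\<close> lies in the ideal, so both conditions on the quotient can be
  read off from representatives.
\<close>

lemma weak_Lefschetz_quotient_iff: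
  fixes I :: "('v, 'k::field) mpol set"
  assumes I: "ideal I mpol_ring"
  shows "weak_Lefschetz (mpol_ring Quot I) (quotient_component I) \<longleftrightarrow>
    (\<exists>L\<in>homogeneous_component 1. \<forall>d. lefschetz_injective I L d \<or> lefschetz_surjective I L d)"
proof -
  let ?c = "\<lambda>f. I +>\<^bsub>mpol_ring\<^esub> f"
  note eq = coset_mpol_ring_eq_iff[OF I]
  note mult = coset_mpol_ring_mult[OF I]
  have inj: "inj_on (\<lambda>q. ?c L \<otimes>\<^bsub>mpol_ring Quot I\<^esub> q) (quotient_component I d) \<longleftrightarrow> lefschetz_injective I L d" for L d
  proof
    assume a: "inj_on (\<lambda>q. ?c L \<otimes>\<^bsub>mpol_ring Quot I\<^esub> q) (quotient_component I d)"
    show "lefschetz_injective I L d"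
      unfolding lefschetz_injective_def
    proof (intro ballI impI)
      fix q assume q: "q \<in> homogeneous_component d" "L * q \<in> I"
      have z: "0 \<in> homogeneous_component d" by (simp add: homogeneous_component_def)
      have "?c q = ?c 0"
      proof (rule inj_onD[OF a])
        show "?c L \<otimes>\<^bsub>mpol_ring Quot I\<^esub> ?c q = ?c L \<otimes>\<^bsub>mpol_ring Quot I\<^esub> ?c 0"
          unfolding mult eq using q(2) by simp
      qed (use q(1) z in \<open>auto simp: quotient_component_def\<close>)
      then show "q \<in> I" unfolding eq by simp
    qed
  next
    assume a: "lefschetz_injective I L d"
    show "inj_on (\<lambda>q. ?c L \<otimes>\<^bsub>mpol_ring Quot I\<^esub> q) (quotient_component I d)"
      unfolding quotient_component_def
    proof (rule inj_onI)
      fix y y' assume "y \<in> ?c ` homogeneous_component d" "y' \<in> ?c ` homogeneous_component d"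
        and e: "?c L \<otimes>\<^bsub>mpol_ring Quot I\<^esub> y = ?c L \<otimes>\<^bsub>mpol_ring Quot I\<^esub> y'"
      then obtain q q' where q: "y = ?c q" "y' = ?c q'" "q \<in> homogeneous_component d" "q' \<in> homogeneous_component d"
        by auto
      then have "L * q - L * q' \<in> I" using e unfolding q mult eq by simp
      then have "L * (q - q') \<in> I" by (simp add: right_diff_distrib)
      then have "q - q' \<in> I" using a homogeneous_component_diff[OF q(3,4)] by (auto simp: lefschetz_injective_def)
      then show "y = y'" unfolding q eq .
    qed
  qed
  have surj: "(\<lambda>q. ?c L \<otimes>\<^bsub>mpol_ring Quot I\<^esub> q) ` quotient_component I d = quotient_component I (d + 1)
      \<longleftrightarrow> lefschetz_surjective I L d" if L: "L \<in> homogeneous_component 1" for L d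
  proof -
    have im: "(\<lambda>q. ?c L \<otimes>\<^bsub>mpol_ring Quot I\<^esub> q) ` quotient_component I d = (\<lambda>q. ?c (L * q)) ` homogeneous_component d"
      unfolding quotient_component_def image_image mult ..
    have "L * q \<in> homogeneous_component (d + 1)" if "q \<in> homogeneous_component d" for q
      using homogeneous_component_mult[OF L that] by (simp add: add.commute)
    then have "(\<lambda>q. ?c (L * q)) ` homogeneous_component d \<subseteq> quotient_component I (d + 1)"
      by (auto simp: quotient_component_def)
    then have "(\<lambda>q. ?c (L * q)) ` homogeneous_component d = quotient_component I (d + 1) \<longleftrightarrow>
        quotient_component I (d + 1) \<subseteq> (\<lambda>q. ?c (L * q)) ` homogeneous_component d"
      by blast
    also have "\<dots> \<longleftrightarrow> (\<forall>h\<in>homogeneous_component (d + 1). \<exists>q\<in>homogeneous_component d. ?c h = ?c (L * q))"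
      by (simp only: quotient_component_def image_subset_iff image_iff)
    finally show ?thesis unfolding im eq lefschetz_surjective_def .
  qed
  have "weak_Lefschetz (mpol_ring Quot I) (quotient_component I) \<longleftrightarrow>
    (\<exists>L\<in>homogeneous_component 1. \<forall>d. inj_on (\<lambda>q. ?c L \<otimes>\<^bsub>mpol_ring Quot I\<^esub> q) (quotient_component I d) \<or>
      (\<lambda>q. ?c L \<otimes>\<^bsub>mpol_ring Quot I\<^esub> q) ` quotient_component I d = quotient_component I (d + 1))"
    unfolding weak_Lefschetz_def by (simp add: quotient_component_def[of I 1])
  then show ?thesis using inj surj by auto
qed

definition mon :: "nat \<Rightarrow> nat \<Rightarrow> nat \<Rightarrow> xyz \<Rightarrow>\<^sub>0 nat" where
  "mon a b c = Poly_Mapping.single x_var a + Poly_Mapping.single y_var b + Poly_Mapping.single z_var c"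

lemma lookup_mon [simp]:
  "Poly_Mapping.lookup (mon a b c) x_var = a" "Poly_Mapping.lookup (mon a b c) y_var = b"
  "Poly_Mapping.lookup (mon a b c) z_var = c"
  by (auto simp: mon_def lookup_add lookup_single)

lemma mon_eqI:
  "Poly_Mapping.lookup m x_var = Poly_Mapping.lookup n x_var \<Longrightarrow>
   Poly_Mapping.lookup m y_var = Poly_Mapping.lookup n y_var \<Longrightarrow>
   Poly_Mapping.lookup m z_var = Poly_Mapping.lookup n z_var \<Longrightarrow> m = n"
  by (rule poly_mapping_eqI) (metis xyz.exhaust)

lemma mon_exhaust: obtains a b c where "m = mon a b c"
  using mon_eqI[of m "mon (Poly_Mapping.lookup m x_var) (Poly_Mapping.lookup m y_var) (Poly_Mapping.lookup m z_var)"]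
  by simp

lemma mon_eq_iff [simp]: "mon a b c = mon a' b' c' \<longleftrightarrow> a = a' \<and> b = b' \<and> c = c'"
  by (metis lookup_mon)

lemma mon_add: "mon a b c + mon a' b' c' = mon (a + a') (b + b') (c + c')"
  by (rule mon_eqI) (simp_all add: lookup_add)

lemma monom_degree_single: "monom_degree (Poly_Mapping.single v n) = n"
  by (cases "n = 0") (auto simp: monom_degree_def)

lemma monom_degree_mon [simp]: "monom_degree (mon a b c) = a + b + c"
  by (simp add: mon_def monom_degree_add monom_degree_single)

lemma homogeneous_component_iff:
  "f \<in> homogeneous_component d \<longleftrightarrow>
    (\<forall>a b c. int (a + b + c) \<noteq> d \<longrightarrow> Poly_Mapping.lookup f (mon a b c) = 0)"
proof (intro iffI allI impI)
  fix a b c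
  assume f: "f \<in> homogeneous_component d" "int (a + b + c) \<noteq> d"
  show "Poly_Mapping.lookup f (mon a b c) = 0"
  proof (rule ccontr)
    assume "\<not> ?thesis"
    then have "mon a b c \<in> Poly_Mapping.keys f" by (simp add: in_keys_iff)
    then have "int (monom_degree (mon a b c)) = d" using f(1) unfolding homogeneous_component_def by blast
    with f(2) show False by simp
  qed
next
  assume f: "\<forall>a b c. int (a + b + c) \<noteq> d \<longrightarrow> Poly_Mapping.lookup f (mon a b c) = 0"
  have "int (monom_degree m) = d" if "Poly_Mapping.lookup f m \<noteq> 0" for m
  proof -
    obtain a b c where "m = mon a b c" by (rule mon_exhaust)
    then show ?thesis using f that by (metis monom_degree_mon)
  qed
  then show "f \<in> homogeneous_component d" by (simp add: homogeneous_component_def in_keys_iff)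
qed

lemma lookup_single_times:
  fixes q :: "('v \<Rightarrow>\<^sub>0 nat) \<Rightarrow>\<^sub>0 'k::field"
  shows "Poly_Mapping.lookup (Poly_Mapping.single n k * q) (n + m) = k * Poly_Mapping.lookup q m"
    and "(\<And>m. l \<noteq> n + m) \<Longrightarrow> Poly_Mapping.lookup (Poly_Mapping.single n k * q) l = 0"
proof -
  have "Poly_Mapping.lookup (Poly_Mapping.single n k * q) l
      = k * (\<Sum>m. Poly_Mapping.lookup q m when l = n + m)" for l
    by (simp add: lookup_mult lookup_single when_mult)
  then show "Poly_Mapping.lookup (Poly_Mapping.single n k * q) (n + m) = k * Poly_Mapping.lookup q m"
    and "(\<And>m. l \<noteq> n + m) \<Longrightarrow> Poly_Mapping.lookup (Poly_Mapping.single n k * q) l = 0"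
    by simp_all
qed

lemma poly_mapping_eq_sum_single:
  "f = (\<Sum>m\<in>Poly_Mapping.keys f. Poly_Mapping.single m (Poly_Mapping.lookup f m))"
  by (rule poly_mapping_eqI) (simp add: lookup_sum lookup_single when_def in_keys_iff)

lemma indet_power: "indet v ^ n = Poly_Mapping.single (Poly_Mapping.single v n) (1 :: 'k::field)"
  by (induction n) (simp_all add: indet_def mult_single flip: single_add)

lemma indet_power_mon:
  "(indet x_var ^ n :: (xyz, 'k::field) mpol) = Poly_Mapping.single (mon n 0 0) 1"
  "(indet y_var ^ n :: (xyz, 'k::field) mpol) = Poly_Mapping.single (mon 0 n 0) 1"
  "(indet z_var ^ n :: (xyz, 'k::field) mpol) = Poly_Mapping.single (mon 0 0 n) 1"
  by (simp_all add: indet_power mon_def)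

text \<open>
  The right-hand condition describes an ideal that contains the generators, since the standard
  exponent vectors are closed under taking divisors. Conversely a polynomial is the sum of its terms,
  and a nonstandard monomial is a multiple of one of the four generators.
\<close>

theorem punctured_ideal_iff:
  fixes \<alpha> \<beta> \<gamma> t :: nat
  defines "I \<equiv> Idl\<^bsub>mpol_ring\<^esub>
     {indet x_var ^ (\<alpha> + t), indet y_var ^ (\<beta> + t), indet z_var ^ (\<gamma> + t),
      indet x_var ^ \<alpha> * indet y_var ^ \<beta> * indet z_var ^ \<gamma> :: (xyz, 'k::field) mpol}"
  shows "ideal I mpol_ring"
    and "f \<in> I \<longleftrightarrow> (\<forall>a b c. standard_exponents \<alpha> \<beta> \<gamma> t a b c \<longrightarrow> Poly_Mapping.lookup f (mon a b c) = 0)"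
proof -
  interpret R: ring "mpol_ring :: (xyz, 'k) mpol ring" by (rule ring_from_type_algebra)
  define gen :: "(xyz \<Rightarrow>\<^sub>0 nat) set" where "gen = {mon (\<alpha> + t) 0 0, mon 0 (\<beta> + t) 0, mon 0 0 (\<gamma> + t), mon \<alpha> \<beta> \<gamma>}"
  have I: "I = Idl\<^bsub>mpol_ring\<^esub> ((\<lambda>m. Poly_Mapping.single m (1 :: 'k)) ` gen)"
    by (simp add: I_def gen_def indet_power_mon mult_single mon_add)
  show idl: "ideal I mpol_ring" unfolding I by (rule R.genideal_ideal) simp
  define M where "M = {f :: (xyz, 'k) mpol. \<forall>a b c. standard_exponents \<alpha> \<beta> \<gamma> t a b c \<longrightarrow> Poly_Mapping.lookup f (mon a b c) = 0}"
  have "ideal M mpol_ring"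
  proof (rule ideal_mpol_ringI)
    fix f g :: "(xyz, 'k) mpol" assume f: "f \<in> M"
    show "g * f \<in> M"
      unfolding M_def
    proof (intro CollectI allI impI)
      fix a b c assume s: "standard_exponents \<alpha> \<beta> \<gamma> t a b c"
      have "(Poly_Mapping.lookup f m when mon a b c = l + m) = 0" for l m
      proof -
        obtain a' b' c' where m: "m = mon a' b' c'" by (rule mon_exhaust)
        obtain i j k where l: "l = mon i j k" by (rule mon_exhaust)
        show ?thesis using f s unfolding l m M_def
          by (auto simp: mon_add when_def standard_exponents_def)
      qed
      then show "Poly_Mapping.lookup (g * f) (mon a b c) = 0" by (simp add: lookup_mult)
    qed
  qed (auto simp: M_def lookup_add)
  moreover have "(\<lambda>m. Poly_Mapping.single m (1 :: 'k)) ` gen \<subseteq> M"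
    by (auto simp: gen_def M_def lookup_single when_def standard_exponents_def)
  ultimately have "I \<subseteq> M" unfolding I by (rule R.genideal_minimal)
  moreover have "f \<in> I" if f: "f \<in> M" for f
  proof -
    have "Poly_Mapping.single m (Poly_Mapping.lookup f m) \<in> I" if m: "m \<in> Poly_Mapping.keys f" for m
    proof -
      obtain a b c where abc: "m = mon a b c" by (rule mon_exhaust)
      have "\<not> standard_exponents \<alpha> \<beta> \<gamma> t a b c" using f m abc by (auto simp: M_def in_keys_iff)
      then consider "\<alpha> + t \<le> a" | "\<beta> + t \<le> b" | "\<gamma> + t \<le> c" | "\<alpha> \<le> a" "\<beta> \<le> b" "\<gamma> \<le> c"
        by (auto simp: standard_exponents_def not_less)
      then obtain n n' where n: "n \<in> gen" "m = n' + n"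
      proof cases
        case 1
        then have "m = mon (a - (\<alpha> + t)) b c + mon (\<alpha> + t) 0 0" by (simp add: abc mon_add)
        then show ?thesis using that by (auto simp: gen_def)
      next
        case 2
        then have "m = mon a (b - (\<beta> + t)) c + mon 0 (\<beta> + t) 0" by (simp add: abc mon_add)
        then show ?thesis using that by (auto simp: gen_def)
      next
        case 3
        then have "m = mon a b (c - (\<gamma> + t)) + mon 0 0 (\<gamma> + t)" by (simp add: abc mon_add)
        then show ?thesis using that by (auto simp: gen_def)
      next
        case 4
        then have "m = mon (a - \<alpha>) (b - \<beta>) (c - \<gamma>) + mon \<alpha> \<beta> \<gamma>" by (simp add: abc mon_add)
        then show ?thesis using that by (auto simp: gen_def)
      qed
      have "Poly_Mapping.single n (1 :: 'k) \<in> I" using R.genideal_self[of "(\<lambda>m. Poly_Mapping.single m (1 :: 'k)) ` gen"] n(1) by (auto simp: I)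
      then have "Poly_Mapping.single n' (Poly_Mapping.lookup f m) * Poly_Mapping.single n 1 \<in> I"
        by (rule ideal_mpol_ringD(3)[OF idl])
      then show ?thesis by (simp add: mult_single n(2))
    qed
    then show "f \<in> I" by (subst poly_mapping_eq_sum_single) (rule ideal_mpol_ring_sum[OF idl])
  qed
  ultimately show "f \<in> I \<longleftrightarrow> (\<forall>a b c. standard_exponents \<alpha> \<beta> \<gamma> t a b c \<longrightarrow> Poly_Mapping.lookup f (mon a b c) = 0)"
    by (auto simp: M_def)
qed

definition linear_form :: "'k::field \<Rightarrow> 'k \<Rightarrow> 'k \<Rightarrow> (xyz, 'k) mpol" where
  "linear_form p q r = Poly_Mapping.single (mon 1 0 0) p + Poly_Mapping.single (mon 0 1 0) q
     + Poly_Mapping.single (mon 0 0 1) r"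

lemma linear_form_homogeneous: "linear_form p q r \<in> homogeneous_component 1"
  unfolding homogeneous_component_iff
  by (auto simp: linear_form_def lookup_add lookup_single when_def)

lemma linear_form_exhaust:
  assumes "L \<in> homogeneous_component 1"
  obtains p q r where "L = linear_form p q r"
proof
  show "L = linear_form (Poly_Mapping.lookup L (mon 1 0 0)) (Poly_Mapping.lookup L (mon 0 1 0))
      (Poly_Mapping.lookup L (mon 0 0 1))" (is "L = ?R")
  proof (rule poly_mapping_eqI)
    fix m :: "xyz \<Rightarrow>\<^sub>0 nat"
    obtain a b c where m: "m = mon a b c" by (rule mon_exhaust)
    consider "a = 1" "b = 0" "c = 0" | "a = 0" "b = 1" "c = 0" | "a = 0" "b = 0" "c = 1"
      | "a + b + c \<noteq> 1" by linarith
    then show "Poly_Mapping.lookup L m = Poly_Mapping.lookup ?R m"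
    proof cases
      case 4
      then have "int (a + b + c) \<noteq> 1" by simp
      then have "Poly_Mapping.lookup L (mon a b c) = 0" "Poly_Mapping.lookup ?R (mon a b c) = 0"
        using assms linear_form_homogeneous unfolding homogeneous_component_iff by blast+
      then show ?thesis by (simp add: m)
    qed (simp_all add: m linear_form_def lookup_add lookup_single when_def)
  qed
qed

lemma lookup_variable_times:
  fixes q :: "(xyz, 'k::field) mpol"
  shows "Poly_Mapping.lookup (Poly_Mapping.single (mon 1 0 0) k * q) (mon a b c)
      = (if a = 0 then 0 else k * Poly_Mapping.lookup q (mon (a - 1) b c))"
    and "Poly_Mapping.lookup (Poly_Mapping.single (mon 0 1 0) k * q) (mon a b c)
      = (if b = 0 then 0 else k * Poly_Mapping.lookup q (mon a (b - 1) c))"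
    and "Poly_Mapping.lookup (Poly_Mapping.single (mon 0 0 1) k * q) (mon a b c)
      = (if c = 0 then 0 else k * Poly_Mapping.lookup q (mon a b (c - 1)))"
proof -
  have none: "Poly_Mapping.lookup (Poly_Mapping.single (mon i j l) k * q) (mon a b c) = 0"
    if "a < i \<or> b < j \<or> c < l" for i j l
  proof (rule lookup_single_times(2))
    fix m :: "xyz \<Rightarrow>\<^sub>0 nat"
    obtain a' b' c' where m: "m = mon a' b' c'" by (rule mon_exhaust)
    show "mon a b c \<noteq> mon i j l + m" using that by (auto simp: m mon_add)
  qed
  show "Poly_Mapping.lookup (Poly_Mapping.single (mon 1 0 0) k * q) (mon a b c)
      = (if a = 0 then 0 else k * Poly_Mapping.lookup q (mon (a - 1) b c))"
    using none[of 1 0 0] lookup_single_times(1)[of "mon 1 0 0" k q "mon (a - 1) b c"]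
    by (cases a) (simp_all add: mon_add)
  show "Poly_Mapping.lookup (Poly_Mapping.single (mon 0 1 0) k * q) (mon a b c)
      = (if b = 0 then 0 else k * Poly_Mapping.lookup q (mon a (b - 1) c))"
    using none[of 0 1 0] lookup_single_times(1)[of "mon 0 1 0" k q "mon a (b - 1) c"]
    by (cases b) (simp_all add: mon_add)
  show "Poly_Mapping.lookup (Poly_Mapping.single (mon 0 0 1) k * q) (mon a b c)
      = (if c = 0 then 0 else k * Poly_Mapping.lookup q (mon a b (c - 1)))"
    using none[of 0 0 1] lookup_single_times(1)[of "mon 0 0 1" k q "mon a b (c - 1)"]
    by (cases c) (simp_all add: mon_add)
qed

section \<open>The multiplication map in the middle degree\<close>

text \<open>
  The coefficient of the monomial \<open>v\<close> in the product of \<open>px + qy + rz\<close> with the monomial \<open>(a, b, c)\<close>.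
\<close>

definition lefschetz_matrix ::
  "'k::field \<Rightarrow> 'k \<Rightarrow> 'k \<Rightarrow> nat \<times> nat \<times> nat \<Rightarrow> nat \<times> nat \<times> nat \<Rightarrow> 'k" where
  "lefschetz_matrix p q r = (\<lambda>(a, b, c) v. (if v = (Suc a, b, c) then p else 0)
     + (if v = (a, Suc b, c) then q else 0) + (if v = (a, b, Suc c) then r else 0))"

lemma lefschetz_matrix_row:
  assumes "finite V" and "\<forall>a b c. (a, b, c) \<notin> V \<longrightarrow> g a b c = 0"
  shows "(\<Sum>v\<in>V. lefschetz_matrix p q r (a, b, c) v * (\<lambda>(a, b, c). g a b c) v)
    = p * g (Suc a) b c + q * g a (Suc b) c + r * g a b (Suc c)"
proof -
  have pick: "(\<Sum>v\<in>V. (if v = (a, b, c) then k else 0) * (\<lambda>(a, b, c). g a b c) v) = k * g a b c" for k a b c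
    using assms(1) assms(2)[rule_format, of a b c]
    by (cases "(a, b, c) \<in> V") (auto simp: if_distrib[of "\<lambda>x. x * _"] cong: if_cong)
  show ?thesis unfolding lefschetz_matrix_def prod.case distrib_right sum.distrib pick ..
qed

text \<open>
  Restricted to standard triples, an inverse system is a solution of the square system given by the
  matrix; at nonstandard triples of degree \<open>e\<close> the relation is trivial, as multiples of a nonstandard
  monomial are nonstandard.
\<close>

lemma has_inverse_system_iff:
  fixes \<alpha> \<beta> \<gamma> t e :: nat and p q r :: "'k::field"
  defines "V \<equiv> standard_triples \<alpha> \<beta> \<gamma> t (Suc e)" and "U \<equiv> standard_triples \<alpha> \<beta> \<gamma> t e"
  shows "has_inverse_system \<alpha> \<beta> \<gamma> t (Suc e) p q r \<longleftrightarrow>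
    (\<exists>h. (\<exists>v\<in>V. h v \<noteq> 0) \<and> (\<forall>u\<in>U. (\<Sum>v\<in>V. lefschetz_matrix p q r u v * h v) = 0))"
proof
  assume "has_inverse_system \<alpha> \<beta> \<gamma> t (Suc e) p q r"
  then obtain g a b c where g: "inverse_system \<alpha> \<beta> \<gamma> t (Suc e) p q r g"
    and abc: "a + b + c = Suc e" "g a b c \<noteq> 0" by (auto simp: has_inverse_system_def)
  define g' where "g' a b c = (if (a, b, c) \<in> V then g a b c else 0)" for a b c
  have g': "g' a b c = g a b c" if "a + b + c = Suc e" for a b c
    using inverse_system_outside[OF g that] that by (auto simp: g'_def V_def standard_triples_def)
  have out: "\<forall>a b c. (a, b, c) \<notin> V \<longrightarrow> g' a b c = 0" by (simp add: g'_def)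
  have fV: "finite V" by (simp add: V_def)
  have "(\<Sum>v\<in>V. lefschetz_matrix p q r u v * (\<lambda>(a, b, c). g' a b c) v) = 0" if "u \<in> U" for u
  proof -
    obtain a b c where u: "u = (a, b, c)" by (cases u)
    then have "a + b + c = e" using that by (auto simp: U_def standard_triples_def)
    then show ?thesis
      unfolding u lefschetz_matrix_row[of V g', OF fV out]
      using inverse_system_relation[OF g, of a b c] by (simp add: g')
  qed
  moreover have "(a, b, c) \<in> V" using abc inverse_system_outside[OF g abc(1)] by (auto simp: V_def standard_triples_def)
  moreover have "(\<lambda>(a, b, c). g' a b c) (a, b, c) \<noteq> 0" using abc g' by simp
  ultimately show "\<exists>h. (\<exists>v\<in>V. h v \<noteq> 0) \<and> (\<forall>u\<in>U. (\<Sum>v\<in>V. lefschetz_matrix p q r u v * h v) = 0)" by blast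
next
  assume "\<exists>h. (\<exists>v\<in>V. h v \<noteq> 0) \<and> (\<forall>u\<in>U. (\<Sum>v\<in>V. lefschetz_matrix p q r u v * h v) = 0)"
  then obtain h v0 where h: "v0 \<in> V" "h v0 \<noteq> 0" "\<forall>u\<in>U. (\<Sum>v\<in>V. lefschetz_matrix p q r u v * h v) = 0" by blast
  define g where "g a b c = (if (a, b, c) \<in> V then h (a, b, c) else 0)" for a b c
  have out: "\<forall>a b c. (a, b, c) \<notin> V \<longrightarrow> g a b c = 0" by (simp add: g_def)
  have fV: "finite V" by (simp add: V_def)
  have "inverse_system \<alpha> \<beta> \<gamma> t (Suc e) p q r g"
    unfolding inverse_system_def
  proof (intro conjI allI impI)
    fix a b c assume "a + b + c = Suc e \<and> \<not> standard_exponents \<alpha> \<beta> \<gamma> t a b c"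
    then show "g a b c = 0" by (intro out[rule_format]) (auto simp: V_def standard_triples_def)
  next
    fix a b c assume abc: "Suc (a + b + c) = Suc e"
    show "p * g (Suc a) b c + q * g a (Suc b) c + r * g a b (Suc c) = 0"
    proof (cases "standard_exponents \<alpha> \<beta> \<gamma> t a b c")
      case True
      then have "(a, b, c) \<in> U" using abc by (simp add: U_def standard_triples_def)
      then have "(\<Sum>v\<in>V. lefschetz_matrix p q r (a, b, c) v * h v) = 0" using h(3) by blast
      moreover have "(\<Sum>v\<in>V. lefschetz_matrix p q r (a, b, c) v * h v)
          = (\<Sum>v\<in>V. lefschetz_matrix p q r (a, b, c) v * (\<lambda>(a, b, c). g a b c) v)"
        by (intro sum.cong) (auto simp: g_def)
      ultimately show ?thesis using lefschetz_matrix_row[of V g p q r a b c, OF fV out] by simp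
    next
      case False
      have "g (Suc a) b c = 0" "g a (Suc b) c = 0" "g a b (Suc c) = 0"
        by (rule out[rule_format]; use False in \<open>force simp: V_def standard_triples_def standard_exponents_def\<close>)+
      then show ?thesis by simp
    qed
  qed
  moreover obtain a b c where "v0 = (a, b, c)" by (cases v0)
  moreover from this have "g a b c \<noteq> 0" "a + b + c = Suc e" using h by (auto simp: g_def V_def standard_triples_def)
  ultimately show "has_inverse_system \<alpha> \<beta> \<gamma> t (Suc e) p q r" unfolding has_inverse_system_def by blast
qed

lemma lefschetz_matrix_of_rat:
  "lefschetz_matrix 1 1 1 u v = (of_rat (lefschetz_matrix 1 1 1 u v) :: 'a::field_char_0)"
  by (cases u) (simp add: lefschetz_matrix_def of_rat_add)

lemma has_inverse_system_real:
  assumes card: "card (standard_triples \<alpha> \<beta> \<gamma> t (Suc e)) = card (standard_triples \<alpha> \<beta> \<gamma> t e)"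
    and has: "has_inverse_system \<alpha> \<beta> \<gamma> t (Suc e) (1 :: 'k::field_char_0) 1 1"
  shows "has_inverse_system \<alpha> \<beta> \<gamma> t (Suc e) (1 :: real) 1 1"
proof -
  obtain h :: "_ \<Rightarrow> 'k" and v0 where h: "v0 \<in> standard_triples \<alpha> \<beta> \<gamma> t (Suc e)" "h v0 \<noteq> 0"
    "\<forall>u\<in>standard_triples \<alpha> \<beta> \<gamma> t e. (\<Sum>v\<in>standard_triples \<alpha> \<beta> \<gamma> t (Suc e). lefschetz_matrix 1 1 1 u v * h v) = 0"
    using has unfolding has_inverse_system_iff by blast
  show ?thesis
    unfolding has_inverse_system_iff lefschetz_matrix_of_rat[where 'a = real]
    by (rule rational_square_system_change_of_field[of _ _ "lefschetz_matrix 1 1 1" h v0])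
      (use card h in \<open>simp_all only: simp_thms finite_standard_triples lefschetz_matrix_of_rat[where 'a = 'k, symmetric]\<close>)
qed

locale punctured_quotient =
  fixes \<alpha> \<beta> \<gamma> t :: nat and I :: "(xyz, 'k::field) mpol set"
  assumes ideal_I: "ideal I mpol_ring"
    and mem_I: "f \<in> I \<longleftrightarrow> (\<forall>a b c. standard_exponents \<alpha> \<beta> \<gamma> t a b c \<longrightarrow> Poly_Mapping.lookup f (mon a b c) = 0)"
begin

text \<open>
  Divisors of standard monomials are standard, so only standard monomials of \<open>f\<close> contribute to the
  coefficient of a standard monomial.
\<close>

lemma lookup_linear_form_times:
  assumes v: "v \<in> standard_triples \<alpha> \<beta> \<gamma> t (Suc e)"
  shows "Poly_Mapping.lookup (linear_form p q r * f) ((\<lambda>(a, b, c). mon a b c) v)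
    = (\<Sum>u\<in>standard_triples \<alpha> \<beta> \<gamma> t e. lefschetz_matrix p q r u v * Poly_Mapping.lookup f ((\<lambda>(a, b, c). mon a b c) u))"
proof -
  obtain a b c where abc: "v = (a, b, c)" by (cases v)
  let ?U = "standard_triples \<alpha> \<beta> \<gamma> t e" and ?f = "\<lambda>u. Poly_Mapping.lookup f ((\<lambda>(a, b, c). mon a b c) u)"
  have s: "standard_exponents \<alpha> \<beta> \<gamma> t a b c" "a + b + c = Suc e"
    using v by (auto simp: abc standard_triples_def)
  have split: "lefschetz_matrix p q r u v = (if a \<noteq> 0 \<and> u = (a - 1, b, c) then p else 0)
      + (if b \<noteq> 0 \<and> u = (a, b - 1, c) then q else 0) + (if c \<noteq> 0 \<and> u = (a, b, c - 1) then r else 0)" for u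
    by (cases u) (auto simp: lefschetz_matrix_def abc)
  have pick: "(\<Sum>u\<in>?U. (if P \<and> u = (a', b', c') then k else 0) * ?f u) = (if P then k * ?f (a', b', c') else 0)"
    if "P \<longrightarrow> (a', b', c') \<in> ?U" for P a' b' c' k
    using that by (cases P) (auto simp: if_distrib[of "\<lambda>x. x * _"] cong: if_cong)
  have "a \<noteq> 0 \<longrightarrow> (a - 1, b, c) \<in> ?U"
    using s by (auto simp: standard_triples_def standard_exponents_def)
  note pick_a = pick[OF this]
  have "b \<noteq> 0 \<longrightarrow> (a, b - 1, c) \<in> ?U"
    using s by (auto simp: standard_triples_def standard_exponents_def)
  note pick_b = pick[OF this]
  have "c \<noteq> 0 \<longrightarrow> (a, b, c - 1) \<in> ?U"
    using s by (auto simp: standard_triples_def standard_exponents_def)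
  note pick_c = pick[OF this]
  have "(\<Sum>u\<in>?U. lefschetz_matrix p q r u v * ?f u) = (if a \<noteq> 0 then p * ?f (a - 1, b, c) else 0)
      + (if b \<noteq> 0 then q * ?f (a, b - 1, c) else 0) + (if c \<noteq> 0 then r * ?f (a, b, c - 1) else 0)"
    unfolding split distrib_right sum.distrib by (simp only: pick_a pick_b pick_c)
  then show ?thesis
    unfolding linear_form_def distrib_right lookup_add abc prod.case lookup_variable_times by simp
qed

lemma polynomial_with_coefficients:
  "\<exists>f\<in>homogeneous_component (int e).
    \<forall>u\<in>standard_triples \<alpha> \<beta> \<gamma> t e. Poly_Mapping.lookup f ((\<lambda>(a, b, c). mon a b c) u) = (x u :: 'k)"
proof (intro bexI ballI)
  let ?U = "standard_triples \<alpha> \<beta> \<gamma> t e" and ?m = "\<lambda>(a, b, c). mon a b c"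
  let ?f = "\<Sum>u\<in>?U. Poly_Mapping.single (?m u) (x u)"
  show "?f \<in> homogeneous_component (int e)"
    by (rule homogeneous_component_sum)
      (auto simp: homogeneous_component_iff standard_triples_def lookup_single when_def)
  fix u assume u: "u \<in> ?U"
  have "?m u' = ?m u \<longleftrightarrow> u' = u" for u' by (cases u; cases u') simp
  then show "Poly_Mapping.lookup ?f (?m u) = x u"
    using u by (simp add: lookup_sum lookup_single when_def)
qed

lemma homogeneous_mem_I:
  assumes "f \<in> homogeneous_component (int e)"
  shows "f \<in> I \<longleftrightarrow> (\<forall>u\<in>standard_triples \<alpha> \<beta> \<gamma> t e. Poly_Mapping.lookup f ((\<lambda>(a, b, c). mon a b c) u) = 0)"
proof -
  have "Poly_Mapping.lookup f (mon a b c) = 0" if "a + b + c \<noteq> e" for a b c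
    using assms that unfolding homogeneous_component_iff by (metis of_nat_eq_iff)
  then have "Poly_Mapping.lookup f (mon a b c) = 0 \<or> (a, b, c) \<in> standard_triples \<alpha> \<beta> \<gamma> t e"
    if "standard_exponents \<alpha> \<beta> \<gamma> t a b c" for a b c
    using that by (cases "a + b + c = e") (auto simp: standard_triples_def)
  then show ?thesis unfolding mem_I by (fastforce simp: standard_triples_def)
qed

context
  fixes e :: nat
  assumes card: "card (standard_triples \<alpha> \<beta> \<gamma> t (Suc e)) = card (standard_triples \<alpha> \<beta> \<gamma> t e)"
begin

lemma linear_form_times_homogeneous:
  assumes "f \<in> homogeneous_component (int e)"
  shows "linear_form p q r * f \<in> homogeneous_component (int (Suc e))"
  using homogeneous_component_mult[OF linear_form_homogeneous assms] by (simp add: add.commute)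

text \<open>
  A square matrix whose transpose is injective is bijective.
\<close>

lemma no_inverse_system_imp_bijective:
  assumes no: "\<not> has_inverse_system \<alpha> \<beta> \<gamma> t (Suc e) p q r"
  shows "lefschetz_injective I (linear_form p q r) (int e)" "lefschetz_surjective I (linear_form p q r) (int e)"
proof -
  let ?U = "standard_triples \<alpha> \<beta> \<gamma> t e" and ?V = "standard_triples \<alpha> \<beta> \<gamma> t (Suc e)"
    and ?A = "lefschetz_matrix p q r" and ?m = "\<lambda>(a, b, c). mon a b c"
  have inj: "\<forall>u\<in>?U. x u = 0" if x: "\<forall>v\<in>?V. (\<Sum>u\<in>?U. ?A u v * x u) = 0" for x
  proof (rule ccontr)
    assume "\<not> ?thesis"
    then obtain u0 where "u0 \<in> ?U" "x u0 \<noteq> 0" by blast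
    from square_system_transpose_nonzero_solution[OF finite_standard_triples finite_standard_triples card[symmetric] x this]
    show False using no unfolding has_inverse_system_iff by blast
  qed
  show "lefschetz_injective I (linear_form p q r) (int e)"
    unfolding lefschetz_injective_def
  proof (intro ballI impI)
    fix f assume f: "f \<in> homogeneous_component (int e)" and "linear_form p q r * f \<in> I"
    then have "\<forall>v\<in>?V. Poly_Mapping.lookup (linear_form p q r * f) (?m v) = 0"
      using homogeneous_mem_I[OF linear_form_times_homogeneous[OF f]] by blast
    then have "(\<Sum>u\<in>?U. ?A u v * Poly_Mapping.lookup f (?m u)) = 0" if "v \<in> ?V" for v
      using lookup_linear_form_times[OF that, of p q r f] that by simp
    then have "\<forall>v\<in>?V. (\<Sum>u\<in>?U. ?A u v * Poly_Mapping.lookup f (?m u)) = 0" by blast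
    from inj[OF this] show "f \<in> I" unfolding homogeneous_mem_I[OF f] .
  qed
  show "lefschetz_surjective I (linear_form p q r) (int e)"
    unfolding lefschetz_surjective_def
  proof
    fix h :: "(xyz, 'k) mpol" assume h: "h \<in> homogeneous_component (int e + 1)"
    have "\<exists>x. \<forall>v\<in>?V. (\<Sum>u\<in>?U. ?A u v * x u) = Poly_Mapping.lookup h (?m v)"
      by (rule square_system_injective_imp_surjective[OF _ _ card[symmetric]]) (use inj in auto)
    then obtain x where x: "\<forall>v\<in>?V. (\<Sum>u\<in>?U. ?A u v * x u) = Poly_Mapping.lookup h (?m v)" by blast
    obtain f where f: "f \<in> homogeneous_component (int e)"
      "\<forall>u\<in>?U. Poly_Mapping.lookup f (?m u) = x u"
      using polynomial_with_coefficients[of e x] by blast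
    have h': "h \<in> homogeneous_component (int (Suc e))" using h by (simp add: add.commute)
    have "Poly_Mapping.lookup (linear_form p q r * f) (?m v) = Poly_Mapping.lookup h (?m v)" if "v \<in> ?V" for v
    proof -
      have "Poly_Mapping.lookup (linear_form p q r * f) (?m v) = (\<Sum>u\<in>?U. ?A u v * Poly_Mapping.lookup f (?m u))"
        by (rule lookup_linear_form_times[OF that])
      also have "\<dots> = (\<Sum>u\<in>?U. ?A u v * x u)" by (intro sum.cong) (simp_all add: f(2))
      finally show ?thesis using x that by simp
    qed
    then have "h - linear_form p q r * f \<in> I"
      unfolding homogeneous_mem_I[OF homogeneous_component_diff[OF h' linear_form_times_homogeneous[OF f(1)]]]
      by (simp add: lookup_minus)
    then show "\<exists>f\<in>homogeneous_component (int e). h - linear_form p q r * f \<in> I" using f(1) by blast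
  qed
qed

text \<open>
  An inverse system is a nonzero functional that annihilates the image, which rules out surjectivity;
  as the matrix is square, it has a nonzero kernel as well.
\<close>

lemma inverse_system_imp_not_bijective:
  assumes has: "has_inverse_system \<alpha> \<beta> \<gamma> t (Suc e) p q r"
  shows "\<not> lefschetz_injective I (linear_form p q r) (int e)" "\<not> lefschetz_surjective I (linear_form p q r) (int e)"
proof -
  let ?U = "standard_triples \<alpha> \<beta> \<gamma> t e" and ?V = "standard_triples \<alpha> \<beta> \<gamma> t (Suc e)"
    and ?A = "lefschetz_matrix p q r" and ?m = "\<lambda>(a, b, c). mon a b c"
  obtain g v0 where g: "v0 \<in> ?V" "g v0 \<noteq> 0" "\<forall>u\<in>?U. (\<Sum>v\<in>?V. ?A u v * g v) = 0"
    using has unfolding has_inverse_system_iff by blast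
  obtain x where x: "\<exists>u\<in>?U. x u \<noteq> 0" "\<forall>v\<in>?V. (\<Sum>u\<in>?U. ?A u v * x u) = 0"
    using square_system_transpose_nonzero_solution[OF finite_standard_triples finite_standard_triples card g(3,1,2)] by blast
  obtain f where f: "f \<in> homogeneous_component (int e)"
    "\<forall>u\<in>?U. Poly_Mapping.lookup f (?m u) = x u"
    using polynomial_with_coefficients[of e x] by blast
  have "Poly_Mapping.lookup (linear_form p q r * f) (?m v) = 0" if "v \<in> ?V" for v
  proof -
    have "Poly_Mapping.lookup (linear_form p q r * f) (?m v) = (\<Sum>u\<in>?U. ?A u v * Poly_Mapping.lookup f (?m u))"
      by (rule lookup_linear_form_times[OF that])
    also have "\<dots> = (\<Sum>u\<in>?U. ?A u v * x u)" by (intro sum.cong) (simp_all add: f(2))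
    finally show ?thesis using x(2) that by simp
  qed
  then have "linear_form p q r * f \<in> I"
    unfolding homogeneous_mem_I[OF linear_form_times_homogeneous[OF f(1)]] by blast
  moreover have "f \<notin> I" unfolding homogeneous_mem_I[OF f(1)] using x(1) f(2) by force
  ultimately show "\<not> lefschetz_injective I (linear_form p q r) (int e)"
    using f(1) by (auto simp: lefschetz_injective_def)
  show "\<not> lefschetz_surjective I (linear_form p q r) (int e)"
  proof
    assume surj: "lefschetz_surjective I (linear_form p q r) (int e)"
    obtain h :: "(xyz, 'k) mpol" where h: "h \<in> homogeneous_component (int (Suc e))"
      "\<forall>v\<in>?V. Poly_Mapping.lookup h (?m v) = (if v = v0 then 1 else 0)"
      using polynomial_with_coefficients[of "Suc e" "\<lambda>v. if v = v0 then 1 else 0"] by blast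
    then have "h \<in> homogeneous_component (int e + 1)" by (simp add: add.commute)
    then obtain f where f: "f \<in> homogeneous_component (int e)" "h - linear_form p q r * f \<in> I"
      using surj by (auto simp: lefschetz_surjective_def)
    have eq: "(\<Sum>u\<in>?U. ?A u v * Poly_Mapping.lookup f (?m u)) = (if v = v0 then 1 else 0)" if "v \<in> ?V" for v
      using f(2) that bspec[OF h(2) that]
      unfolding homogeneous_mem_I[OF homogeneous_component_diff[OF h(1) linear_form_times_homogeneous[OF f(1)]]]
      by (simp add: lookup_minus lookup_linear_form_times[OF that])
    have "g v0 = (\<Sum>v\<in>?V. g v * (if v = v0 then 1 else 0))"
      using g(1) by (simp add: if_distrib cong: if_cong)
    also have "\<dots> = (\<Sum>v\<in>?V. g v * (\<Sum>u\<in>?U. ?A u v * Poly_Mapping.lookup f (?m u)))"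
      by (intro sum.cong) (simp_all only: eq)
    also have "\<dots> = (\<Sum>u\<in>?U. Poly_Mapping.lookup f (?m u) * (\<Sum>v\<in>?V. ?A u v * g v))"
      unfolding sum_distrib_left by (subst sum.swap) (simp add: mult_ac)
    also have "\<dots> = 0" using g(3) by simp
    finally show False using g(2) by simp
  qed
qed

end

section \<open>Propagation to the other degrees\<close>

text \<open>
  The socle of the quotient is concentrated in degree \<open>\<alpha> + \<beta> + \<gamma> + 2t - 3\<close>.
\<close>

lemma standard_exponents_extend:
  assumes "standard_exponents \<alpha> \<beta> \<gamma> t a b c" and "a + b + c + 3 < \<alpha> + \<beta> + \<gamma> + 2 * t"
  shows "standard_exponents \<alpha> \<beta> \<gamma> t (Suc a) b c \<or> standard_exponents \<alpha> \<beta> \<gamma> t a (Suc b) c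
    \<or> standard_exponents \<alpha> \<beta> \<gamma> t a b (Suc c)"
  using assms by (auto simp: standard_exponents_def)

text \<open>
  Below the socle degree every nonzero element stays nonzero after multiplication by a suitable
  variable, and this multiple lies in the kernel together with the element.
\<close>

lemma lefschetz_injective_pred:
  assumes inj: "lefschetz_injective I L (d + 1)" and d: "d + 3 < int (\<alpha> + \<beta> + \<gamma> + 2 * t)"
  shows "lefschetz_injective I L d"
  unfolding lefschetz_injective_def
proof (intro ballI impI, rule ccontr)
  fix f assume f: "f \<in> homogeneous_component d" "L * f \<in> I" and "f \<notin> I"
  then obtain a b c where s: "standard_exponents \<alpha> \<beta> \<gamma> t a b c" and nz: "Poly_Mapping.lookup f (mon a b c) \<noteq> 0"
    unfolding mem_I by blast
  have "int (a + b + c) = d" using f(1) nz unfolding homogeneous_component_iff by blast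
  then have "a + b + c + 3 < \<alpha> + \<beta> + \<gamma> + 2 * t" using d by linarith
  then obtain i j k where ijk: "standard_exponents \<alpha> \<beta> \<gamma> t (i + a) (j + b) (k + c)" "i + j + k = 1"
    using standard_exponents_extend[OF s]
    by (metis add.commute add.right_neutral add_0 plus_1_eq_Suc)
  define f' where "f' = Poly_Mapping.single (mon i j k) 1 * f"
  have "Poly_Mapping.single (mon i j k) 1 \<in> homogeneous_component 1"
    using ijk(2) by (auto simp: homogeneous_component_def)
  then have "f' \<in> homogeneous_component (d + 1)"
    using homogeneous_component_mult[OF _ f(1)] by (auto simp: f'_def add.commute)
  moreover have "L * f' \<in> I"
    using ideal_mpol_ringD(3)[OF ideal_I f(2), of "Poly_Mapping.single (mon i j k) 1"] by (simp add: f'_def mult.left_commute)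
  ultimately have "f' \<in> I" using inj by (auto simp: lefschetz_injective_def)
  then have "Poly_Mapping.lookup f' (mon i j k + mon a b c) = 0" using ijk(1) unfolding mem_I by (simp add: mon_add)
  then show False using nz unfolding f'_def lookup_single_times(1) by simp
qed

text \<open>
  A monomial of degree \<open>d + 2\<close> is a variable times a monomial of degree \<open>d + 1\<close>.
\<close>

lemma lefschetz_surjective_Suc:
  assumes surj: "lefschetz_surjective I L d" and d: "0 \<le> d"
  shows "lefschetz_surjective I L (d + 1)"
  unfolding lefschetz_surjective_def
proof
  fix h :: "(xyz, 'k) mpol" assume h: "h \<in> homogeneous_component (d + 1 + 1)"
  have "\<exists>f\<in>homogeneous_component (d + 1). Poly_Mapping.single m (Poly_Mapping.lookup h m) - L * f \<in> I"
    if m: "m \<in> Poly_Mapping.keys h" for m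
  proof -
    obtain a b c where abc: "m = mon a b c" by (rule mon_exhaust)
    have "int (monom_degree m) = d + 1 + 1" using h m unfolding homogeneous_component_def by blast
    then have deg: "int (a + b + c) = d + 2" by (simp add: abc)
    then have "a \<noteq> 0 \<or> b \<noteq> 0 \<or> c \<noteq> 0" using d by auto
    then obtain i j k a' b' c' where ijk: "i + j + k = 1" "m = mon i j k + mon a' b' c'"
    proof (elim disjE)
      assume "a \<noteq> 0"
      then show thesis using that[of 1 0 0 "a - 1" b c] by (simp add: abc mon_add)
    next
      assume "b \<noteq> 0"
      then show thesis using that[of 0 1 0 a "b - 1" c] by (simp add: abc mon_add)
    next
      assume "c \<noteq> 0"
      then show thesis using that[of 0 0 1 a b "c - 1"] by (simp add: abc mon_add)
    qed
    let ?x = "Poly_Mapping.single (mon i j k) (1 :: 'k)"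
    let ?h = "Poly_Mapping.single (mon a' b' c') (Poly_Mapping.lookup h m)"
    have "i + a' = a" "j + b' = b" "k + c' = c" using ijk(2) by (auto simp: abc mon_add)
    then have "int (a' + b' + c') = d + 1" using ijk(1) deg by linarith
    then have "?h \<in> homogeneous_component (d + 1)" by (auto simp: homogeneous_component_def)
    then obtain f where f: "f \<in> homogeneous_component d" "?h - L * f \<in> I"
      using surj by (auto simp: lefschetz_surjective_def)
    have "?x \<in> homogeneous_component 1" using ijk(1) by (auto simp: homogeneous_component_def)
    then have "?x * f \<in> homogeneous_component (d + 1)"
      using homogeneous_component_mult[OF _ f(1)] by (auto simp: add.commute)
    moreover have "Poly_Mapping.single m (Poly_Mapping.lookup h m) - L * (?x * f) = ?x * (?h - L * f)"
      by (simp add: ijk(2) right_diff_distrib mult_single mult.left_commute)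
    moreover have "?x * (?h - L * f) \<in> I" by (rule ideal_mpol_ringD(3)[OF ideal_I f(2)])
    ultimately show ?thesis by metis
  qed
  then obtain F where F: "\<And>m. m \<in> Poly_Mapping.keys h \<Longrightarrow> F m \<in> homogeneous_component (d + 1)"
    "\<And>m. m \<in> Poly_Mapping.keys h \<Longrightarrow> Poly_Mapping.single m (Poly_Mapping.lookup h m) - L * F m \<in> I"
    by metis
  define f where "f = (\<Sum>m\<in>Poly_Mapping.keys h. F m)"
  have "h - L * f = (\<Sum>m\<in>Poly_Mapping.keys h. Poly_Mapping.single m (Poly_Mapping.lookup h m) - L * F m)"
    unfolding sum_subtractf poly_mapping_eq_sum_single[of h, symmetric] f_def sum_distrib_left ..
  also have "\<dots> \<in> I" by (rule ideal_mpol_ring_sum[OF ideal_I F(2)])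
  finally have "h - L * f \<in> I" .
  moreover have "f \<in> homogeneous_component (d + 1)" unfolding f_def by (rule homogeneous_component_sum[OF F(1)])
  ultimately show "\<exists>f\<in>homogeneous_component (d + 1). h - L * f \<in> I" by blast
qed

lemma lefschetz_all_degrees:
  assumes inj: "lefschetz_injective I L (int e)" and surj: "lefschetz_surjective I L (int e)"
    and e: "e + 2 < \<alpha> + \<beta> + \<gamma> + 2 * t"
  shows "lefschetz_injective I L d \<or> lefschetz_surjective I L d"
proof (cases "d \<le> int e")
  case True
  then have "lefschetz_injective I L d"
  proof (induction d rule: int_le_induct)
    case base
    show ?case by (rule inj)
  next
    case (step i)
    then show ?case using lefschetz_injective_pred[of L "i - 1"] e by simp
  qed
  then show ?thesis ..
next
  case False
  then have "int e \<le> d" by simp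
  then have "lefschetz_surjective I L d"
  proof (induction d rule: int_ge_induct)
    case base
    show ?case by (rule surj)
  next
    case (step i)
    then show ?case by (intro lefschetz_surjective_Suc) auto
  qed
  then show ?thesis ..
qed

end

section \<open>Deciding the weak Lefschetz property\<close>

theorem proposition7p7:
  fixes \<alpha> \<beta> \<gamma> t :: nat
    and I :: "(xyz, 'k::field_char_0) mpol set"
  assumes "0 < \<alpha>" and "\<alpha> \<le> \<beta>" and "\<beta> \<le> \<gamma>" and "\<gamma> \<le> 2 * (\<alpha> + \<beta>)"
    and "real t \<ge> 1 / 3 * real (\<alpha> + \<beta> + \<gamma>)"
    and "3 dvd \<alpha> + \<beta> + \<gamma>"
    and "I = Idl\<^bsub>mpol_ring\<^esub>
               {indet x_var ^ (\<alpha> + t), indet y_var ^ (\<beta> + t), indet z_var ^ (\<gamma> + t),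
                indet x_var ^ \<alpha> * indet y_var ^ \<beta> * indet z_var ^ \<gamma>}"
  shows "(even t \<and> odd (\<alpha> + \<beta> + \<gamma>) \<and> (\<alpha> = \<beta> \<or> \<beta> = \<gamma>) \<longrightarrow>
            \<not> weak_Lefschetz (mpol_ring Quot I) (quotient_component I)) \<and>
         ((even t \<longleftrightarrow> even (\<alpha> + \<beta> + \<gamma>)) \<or> (odd t \<and> \<alpha> = \<beta> \<and> \<beta> = \<gamma> \<and> even \<alpha>) \<longrightarrow>
            weak_Lefschetz (mpol_ring Quot I) (quotient_component I))"
proof -
  obtain m where m: "\<alpha> + \<beta> + \<gamma> = 3 * m" using assms(6) by (auto elim: dvdE)
  have "real (\<alpha> + \<beta> + \<gamma>) = 3 * real m" using m by simp
  then have mt: "m \<le> t" using assms(5) by simp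
  have bounds: "0 < m" "\<alpha> \<le> m" "m \<le> \<gamma>" "\<alpha> \<le> 2 * m" "\<beta> \<le> 2 * m" "\<gamma> \<le> 2 * m"
    using assms(1-4) m by (auto simp: algebra_simps)
  define e where "e = 2 * m + t - 2"
  have e: "Suc e = 2 * m + t - 1" using bounds mt by (simp add: e_def)
  have card: "card (standard_triples \<alpha> \<beta> \<gamma> t (Suc e)) = card (standard_triples \<alpha> \<beta> \<gamma> t e)"
    unfolding e unfolding e_def by (rule card_standard_triples_peak) (use m bounds mt in auto)
  interpret punctured_quotient \<alpha> \<beta> \<gamma> t I
    unfolding assms(7) by (rule punctured_quotient.intro) (rule punctured_ideal_iff)+
  note wl = weak_Lefschetz_quotient_iff[OF ideal_I]
  have fail: "\<not> weak_Lefschetz (mpol_ring Quot I) (quotient_component I)"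
    if h: "even t" "odd (\<alpha> + \<beta> + \<gamma>)" "\<alpha> = \<beta> \<or> \<beta> = \<gamma>"
  proof
    assume "weak_Lefschetz (mpol_ring Quot I) (quotient_component I)"
    then obtain L where L: "L \<in> homogeneous_component 1"
      "lefschetz_injective I L (int e) \<or> lefschetz_surjective I L (int e)"
      unfolding wl by blast
    obtain p q r where pqr: "L = linear_form p q r" by (rule linear_form_exhaust[OF L(1)])
    have "odd m" using h(2) m by simp
    then have "has_inverse_system \<alpha> \<beta> \<gamma> t (Suc e) p q r"
      unfolding e using has_inverse_system_two_equal[OF m] bounds mt h by blast
    then show False using inverse_system_imp_not_bijective[OF card] L(2) pqr by blast
  qed
  have hold: "weak_Lefschetz (mpol_ring Quot I) (quotient_component I)"
    if h: "(even t \<longleftrightarrow> even (\<alpha> + \<beta> + \<gamma>)) \<or> (odd t \<and> \<alpha> = \<beta> \<and> \<beta> = \<gamma> \<and> even \<alpha>)"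
  proof -
    have "g a b c = 0" if g: "inverse_system \<alpha> \<beta> \<gamma> t (Suc e) 1 1 1 g" and abc: "a + b + c = Suc e"
      for g :: "nat \<Rightarrow> nat \<Rightarrow> nat \<Rightarrow> real" and a b c
      using h
    proof
      assume "even t \<longleftrightarrow> even (\<alpha> + \<beta> + \<gamma>)"
      then have "even (t - m)" using m mt by simp
      then show ?thesis
        using inverse_system_even_puncture[OF m bounds(1,2,3,6,5) mt _ g[unfolded e] abc[unfolded e]] by blast
    next
      assume h: "odd t \<and> \<alpha> = \<beta> \<and> \<beta> = \<gamma> \<and> even \<alpha>"
      then have eq: "\<alpha> = m" "\<beta> = m" "\<gamma> = m" using m by auto
      then have "odd (t - m)" "even m" using h mt by auto
      then show ?thesis
        using inverse_system_odd_puncture[OF g[unfolded e eq] mt _ bounds(1) _ abc[unfolded e]] by blast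
    qed
    then have "\<not> has_inverse_system \<alpha> \<beta> \<gamma> t (Suc e) (1 :: real) 1 1"
      by (auto simp: has_inverse_system_def)
    then have "\<not> has_inverse_system \<alpha> \<beta> \<gamma> t (Suc e) (1 :: 'k) 1 1"
      using has_inverse_system_real[OF card] by blast
    note bij = no_inverse_system_imp_bijective[OF card this]
    have "e + 2 < \<alpha> + \<beta> + \<gamma> + 2 * t" using m bounds mt by (simp add: e_def)
    then show ?thesis
      unfolding wl using lefschetz_all_degrees[OF bij] linear_form_homogeneous by blast
  qed
  show ?thesis using fail hold by blast
qed

end
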